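(* Let $G$ be an amenable branch group and let $A$ be either $\ell^1(G)^{**}$ (with the first Arens product) or $\mathcal{J}_{sn}(G)$. Then $A$ contains nilpotent left ideals of arbitrarily large index of nilpotence. Hence $\ell^1(G)^{**}$ contains non-nilpotent radical elements, i.e. the Jacobson radical $\operatorname{rad}\ell^1(G)^{**}$ contains elements that are not nilpotent.
   Context: All groups are discrete. For a group $G$, $\ell^1(G)$ is the Banach algebra of absolutely summable functions $G\to\mathbb{C}$ under convolution; $\delta_t$ is the point mass at $t$; $\ell^1(G)^*=\ell^\infty(G)$, and $1$ is the constant function. The bidual $\ell^1(G)^{**}$ carries the first Arens product $\Box$: for a Banach algebra $A$, $\langle \Psi\Box\Phi,\lambda\rangle=\langle\Psi,\Phi\cdot\lambda\rangle$, $\langle a,\Phi\cdot\lambda\rangle=\langle\Phi,\lambda\cdot a\rangle$, $\langle b,\lambda\cdot a\rangle=\langle ab,\lambda\rangle$ ($\Phi,\Psi\in A^{**}$, $\lambda\in A^*$, $a,b\in A$). For $H\le G$, $\ell^1(H)^{**}$ is identified with its image in $\ell^1(G)^{**}$ under the second adjoint of the inclusion $\ell^1(H)\hookrightarrow\ell^1(G)$. An invariant difference on a group $H$ is an element $\Gamma\in\ell^1(H)^{**}$ with $\delta_s\Box\Gamma=\Gamma$ for all $s\in H$ and $\langle\Gamma,1\rangle=0$. $\mathcal{D}(H)$ is the set of invariant differences on $H$. A subgroup $H\le G$ is subnormal if there is a finite chain $H=H_n\lhd H_{n-1}\lhd\cdots\lhd H_1\lhd G$. Define the left ideal of $\ell^1(G)^{**}$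 $$\mathcal{J}_{sn}(G)=\operatorname{span}\{\Phi\Box\Gamma:\Phi\in\ell^1(G)^{**},\ \Gamma\in\mathcal{D}(H)\text{ for some subnormal subgroup } H\text{ of } G\}.$$ An algebra (or left ideal) $I$ is nilpotent if $I^n=\{0\}$ for some $n\in\mathbb{N}$ (all $n$-fold products vanish); the least such $n$ is its index of nilpotence. The Jacobson radical $\operatorname{rad}A$ of a unital algebra $A$ is the intersection of its maximal left ideals. An infinite group $G$ is a branch group if there exist descending chains of subgroups $H_1\supset H_2\supset\cdots$ and $L_1\supset L_2\supset\cdots$ and natural numbers $(k_i)_{i\in\mathbb{N}}$ such that: (1) $\bigcap_i H_i=1$; (2) each $H_i$ is a finite-index normal subgroup of $G$; (3) each $H_i$ is an (internal) direct product $L_i^{(1)}\times\cdots\times L_i^{(k_i)}$ with each factor isomorphic to $L_i$; (4) for each $i$, $m_i:=k_{i+1}/k_i$ is an integer at least $2$, and the decomposition of $H_{i+1}$ properly refines that of $H_i$ in the sense that each $L_i^{(j)}$ contains the subgroups $L_{i+1}^{(l)}$ for $l=(j-1)m_i+1,\dots,jm_i$; (5) conjugation by $G$ transitively permutes the subgroups $L_i^{(1)},\dots,L_i^{(k_i)}$. *)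

theory Defs
  imports
    "HOL-Analysis.Analysis"
    "HOL-Algebra.Generated_Groups"
    "HOL-Library.Function_Algebras"
begin

section \<open>Normed spaces of complex-valued functions and their duals\<close>

text \<open>
  All spaces below are sets of complex-valued functions with the pointwise operations. A normed
  space is given by such a set \<open>V\<close> together with a norm \<open>nrm\<close>, only relevant on \<open>V\<close>.
  A functional on \<open>V\<close> is itself a complex-valued function, extended by \<open>0\<close> outside \<open>V\<close>,
  so that duals can be iterated.
\<close>

definition cscale :: "complex \<Rightarrow> ('x \<Rightarrow> complex) \<Rightarrow> ('x \<Rightarrow> complex)" where
  "cscale c f = (\<lambda>x. c * f x)"

interpretation cfun: vector_space "cscale :: complex \<Rightarrow> ('x \<Rightarrow> complex) \<Rightarrow> ('x \<Rightarrow> complex)"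
  by unfold_locales (auto simp: cscale_def fun_eq_iff algebra_simps)

definition dual_space ::
  "('x \<Rightarrow> complex) set \<Rightarrow> (('x \<Rightarrow> complex) \<Rightarrow> real) \<Rightarrow> (('x \<Rightarrow> complex) \<Rightarrow> complex) set" where
  "dual_space V nrm = {F.
     (\<forall>v. v \<notin> V \<longrightarrow> F v = 0) \<and>
     (\<forall>u\<in>V. \<forall>v\<in>V. F (u + v) = F u + F v) \<and>
     (\<forall>c. \<forall>v\<in>V. F (cscale c v) = c * F v) \<and>
     (\<exists>C. \<forall>v\<in>V. cmod (F v) \<le> C * nrm v)}"

definition dual_norm ::
  "('x \<Rightarrow> complex) set \<Rightarrow> (('x \<Rightarrow> complex) \<Rightarrow> real) \<Rightarrow> (('x \<Rightarrow> complex) \<Rightarrow> complex) \<Rightarrow> real" where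
  "dual_norm V nrm F = (SUP v\<in>{v \<in> V. nrm v \<le> 1}. cmod (F v))"

definition bidual_space ::
  "('x \<Rightarrow> complex) set \<Rightarrow> (('x \<Rightarrow> complex) \<Rightarrow> real)
     \<Rightarrow> ((('x \<Rightarrow> complex) \<Rightarrow> complex) \<Rightarrow> complex) set" where
  "bidual_space V nrm = dual_space (dual_space V nrm) (dual_norm V nrm)"

definition bidual_norm ::
  "('x \<Rightarrow> complex) set \<Rightarrow> (('x \<Rightarrow> complex) \<Rightarrow> real)
     \<Rightarrow> ((('x \<Rightarrow> complex) \<Rightarrow> complex) \<Rightarrow> complex) \<Rightarrow> real" where
  "bidual_norm V nrm = dual_norm (dual_space V nrm) (dual_norm V nrm)"

definition bidual_embed ::
  "('x \<Rightarrow> complex) set \<Rightarrow> (('x \<Rightarrow> complex) \<Rightarrow> real)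
     \<Rightarrow> ('x \<Rightarrow> complex) \<Rightarrow> ((('x \<Rightarrow> complex) \<Rightarrow> complex) \<Rightarrow> complex)" where
  "bidual_embed V nrm a = (\<lambda>F. if F \<in> dual_space V nrm then F a else 0)"

text \<open>The adjoint of \<open>T : V \<rightarrow> W\<close>, as a map from functionals on \<open>W\<close> to functionals on \<open>V\<close>.\<close>

definition banach_adjoint ::
  "('x \<Rightarrow> complex) set \<Rightarrow> (('x \<Rightarrow> complex) \<Rightarrow> ('y \<Rightarrow> complex))
     \<Rightarrow> (('y \<Rightarrow> complex) \<Rightarrow> complex) \<Rightarrow> (('x \<Rightarrow> complex) \<Rightarrow> complex)" where
  "banach_adjoint V T F = (\<lambda>v. if v \<in> V then F (T v) else 0)"

section \<open>The first Arens product\<close>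

text \<open>
  For a Banach algebra \<open>V\<close> with norm \<open>nrm\<close> and product \<open>mul\<close>:
  \<open>arens_right\<close> is \<open>\<lambda> \<cdot> a\<close>, \<open>arens_left\<close> is \<open>\<Phi> \<cdot> \<lambda>\<close> and \<open>arens\<close> is \<open>\<Psi> \<box> \<Phi>\<close>.
\<close>

definition arens_right ::
  "('x \<Rightarrow> complex) set \<Rightarrow> (('x \<Rightarrow> complex) \<Rightarrow> ('x \<Rightarrow> complex) \<Rightarrow> ('x \<Rightarrow> complex))
     \<Rightarrow> (('x \<Rightarrow> complex) \<Rightarrow> complex) \<Rightarrow> ('x \<Rightarrow> complex) \<Rightarrow> (('x \<Rightarrow> complex) \<Rightarrow> complex)" where
  "arens_right V mul F a = (\<lambda>b. if b \<in> V then F (mul a b) else 0)"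

definition arens_left ::
  "('x \<Rightarrow> complex) set \<Rightarrow> (('x \<Rightarrow> complex) \<Rightarrow> ('x \<Rightarrow> complex) \<Rightarrow> ('x \<Rightarrow> complex))
     \<Rightarrow> ((('x \<Rightarrow> complex) \<Rightarrow> complex) \<Rightarrow> complex)
     \<Rightarrow> (('x \<Rightarrow> complex) \<Rightarrow> complex) \<Rightarrow> (('x \<Rightarrow> complex) \<Rightarrow> complex)" where
  "arens_left V mul \<Phi> F = (\<lambda>a. if a \<in> V then \<Phi> (arens_right V mul F a) else 0)"

definition arens ::
  "('x \<Rightarrow> complex) set \<Rightarrow> (('x \<Rightarrow> complex) \<Rightarrow> real)
     \<Rightarrow> (('x \<Rightarrow> complex) \<Rightarrow> ('x \<Rightarrow> complex) \<Rightarrow> ('x \<Rightarrow> complex))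
     \<Rightarrow> ((('x \<Rightarrow> complex) \<Rightarrow> complex) \<Rightarrow> complex) \<Rightarrow> ((('x \<Rightarrow> complex) \<Rightarrow> complex) \<Rightarrow> complex)
     \<Rightarrow> ((('x \<Rightarrow> complex) \<Rightarrow> complex) \<Rightarrow> complex)" where
  "arens V nrm mul \<Psi> \<Phi> =
     (\<lambda>F. if F \<in> dual_space V nrm then \<Psi> (arens_left V mul \<Phi> F) else 0)"

section \<open>The group algebra and its bidual\<close>

text \<open>
  Functions on \<open>G\<close> are extended by \<open>0\<close> outside \<open>carrier G\<close>. In particular, for a subgroup \<open>H\<close>,
  the inclusion of \<open>l1_space (G\<lparr>carrier := H\<rparr>)\<close> in \<open>l1_space G\<close> is the identity map.
\<close>

definition l1_space :: "('a, 'b) monoid_scheme \<Rightarrow> ('a \<Rightarrow> complex) set" where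
  "l1_space G = {f. (\<forall>x. x \<notin> carrier G \<longrightarrow> f x = 0) \<and> (\<lambda>x. cmod (f x)) summable_on carrier G}"

definition l1_norm :: "('a, 'b) monoid_scheme \<Rightarrow> ('a \<Rightarrow> complex) \<Rightarrow> real" where
  "l1_norm G f = infsum (\<lambda>x. cmod (f x)) (carrier G)"

definition l1_conv ::
  "('a, 'b) monoid_scheme \<Rightarrow> ('a \<Rightarrow> complex) \<Rightarrow> ('a \<Rightarrow> complex) \<Rightarrow> ('a \<Rightarrow> complex)" where
  "l1_conv G f g = (\<lambda>t. if t \<in> carrier G
      then infsum (\<lambda>s. f s * g (inv\<^bsub>G\<^esub> s \<otimes>\<^bsub>G\<^esub> t)) (carrier G) else 0)"

definition point_mass :: "'a \<Rightarrow> 'a \<Rightarrow> complex" where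
  "point_mass t = (\<lambda>x. if x = t then 1 else 0)"

text \<open>The functional on \<open>\<ell>\<^sup>1(G)\<close> identified with the bounded function \<open>\<phi>\<close> on \<open>G\<close>.\<close>

definition linf_functional ::
  "('a, 'b) monoid_scheme \<Rightarrow> ('a \<Rightarrow> complex) \<Rightarrow> (('a \<Rightarrow> complex) \<Rightarrow> complex)" where
  "linf_functional G \<phi> =
     (\<lambda>f. if f \<in> l1_space G then infsum (\<lambda>t. f t * \<phi> t) (carrier G) else 0)"

definition l1_bidual ::
  "('a, 'b) monoid_scheme \<Rightarrow> ((('a \<Rightarrow> complex) \<Rightarrow> complex) \<Rightarrow> complex) set" where
  "l1_bidual G = bidual_space (l1_space G) (l1_norm G)"

definition l1_arens ::
  "('a, 'b) monoid_scheme \<Rightarrow> ((('a \<Rightarrow> complex) \<Rightarrow> complex) \<Rightarrow> complex)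
     \<Rightarrow> ((('a \<Rightarrow> complex) \<Rightarrow> complex) \<Rightarrow> complex) \<Rightarrow> ((('a \<Rightarrow> complex) \<Rightarrow> complex) \<Rightarrow> complex)" where
  "l1_arens G = arens (l1_space G) (l1_norm G) (l1_conv G)"

definition bidual_point_mass ::
  "('a, 'b) monoid_scheme \<Rightarrow> 'a \<Rightarrow> ((('a \<Rightarrow> complex) \<Rightarrow> complex) \<Rightarrow> complex)" where
  "bidual_point_mass G t = bidual_embed (l1_space G) (l1_norm G) (point_mass t)"

text \<open>
  The second adjoint of the inclusion \<open>\<ell>\<^sup>1(H) \<rightarrow> \<ell>\<^sup>1(G)\<close>; \<open>\<lambda>f. f\<close> is that inclusion, so the inner
  adjoint restricts functionals from \<open>\<ell>\<^sup>1(G)\<close> to \<open>\<ell>\<^sup>1(H)\<close>.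
\<close>

definition l1_bidual_incl ::
  "('a, 'b) monoid_scheme \<Rightarrow> 'a set
     \<Rightarrow> ((('a \<Rightarrow> complex) \<Rightarrow> complex) \<Rightarrow> complex) \<Rightarrow> ((('a \<Rightarrow> complex) \<Rightarrow> complex) \<Rightarrow> complex)" where
  "l1_bidual_incl G H =
     banach_adjoint (dual_space (l1_space G) (l1_norm G))
       (banach_adjoint (l1_space (G\<lparr>carrier := H\<rparr>)) (\<lambda>f. f))"

definition invariant_differences ::
  "('a, 'b) monoid_scheme \<Rightarrow> ((('a \<Rightarrow> complex) \<Rightarrow> complex) \<Rightarrow> complex) set" where
  "invariant_differences H = {\<Gamma> \<in> l1_bidual H.
     (\<forall>s\<in>carrier H. l1_arens H (bidual_point_mass H s) \<Gamma> = \<Gamma>) \<and>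
     \<Gamma> (linf_functional H (\<lambda>_. 1)) = 0}"

text \<open>Amenability of a discrete group: existence of a left-invariant mean on \<open>\<ell>\<^sup>\<infinity>(G)\<close>.\<close>

definition amenable_group :: "('a, 'b) monoid_scheme \<Rightarrow> bool" where
  "amenable_group G \<longleftrightarrow> group G \<and> (\<exists>M \<in> l1_bidual G.
     bidual_norm (l1_space G) (l1_norm G) M = 1 \<and>
     M (linf_functional G (\<lambda>_. 1)) = 1 \<and>
     (\<forall>s\<in>carrier G. l1_arens G (bidual_point_mass G s) M = M))"

section \<open>Subnormal subgroups and the left ideal they define\<close>

inductive subnormal :: "('a, 'b) monoid_scheme \<Rightarrow> 'a set \<Rightarrow> bool" for G where
  top: "subnormal G (carrier G)"
| step: "subnormal G K \<Longrightarrow> H \<lhd> G\<lparr>carrier := K\<rparr> \<Longrightarrow> subnormal G H"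

definition J_sn ::
  "('a, 'b) monoid_scheme \<Rightarrow> ((('a \<Rightarrow> complex) \<Rightarrow> complex) \<Rightarrow> complex) set" where
  "J_sn G = cfun.span {l1_arens G \<Phi> (l1_bidual_incl G H \<Gamma>) | \<Phi> \<Gamma> H.
     \<Phi> \<in> l1_bidual G \<and> subnormal G H \<and> \<Gamma> \<in> invariant_differences (G\<lparr>carrier := H\<rparr>)}"

section \<open>Left ideals, nilpotence and the Jacobson radical\<close>

text \<open>Here an algebra is a set \<open>A\<close> of complex-valued functions with a product \<open>mul\<close>.\<close>

definition left_ideal ::
  "('x \<Rightarrow> complex) set \<Rightarrow> (('x \<Rightarrow> complex) \<Rightarrow> ('x \<Rightarrow> complex) \<Rightarrow> ('x \<Rightarrow> complex))
     \<Rightarrow> ('x \<Rightarrow> complex) set \<Rightarrow> bool" where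
  "left_ideal A mul I \<longleftrightarrow> I \<subseteq> A \<and> cfun.subspace I \<and> (\<forall>a\<in>A. \<forall>x\<in>I. mul a x \<in> I)"

definition maximal_left_ideal ::
  "('x \<Rightarrow> complex) set \<Rightarrow> (('x \<Rightarrow> complex) \<Rightarrow> ('x \<Rightarrow> complex) \<Rightarrow> ('x \<Rightarrow> complex))
     \<Rightarrow> ('x \<Rightarrow> complex) set \<Rightarrow> bool" where
  "maximal_left_ideal A mul M \<longleftrightarrow> left_ideal A mul M \<and> M \<noteq> A \<and>
     (\<forall>I. left_ideal A mul I \<and> M \<subseteq> I \<longrightarrow> I = M \<or> I = A)"

definition jacobson_radical ::
  "('x \<Rightarrow> complex) set \<Rightarrow> (('x \<Rightarrow> complex) \<Rightarrow> ('x \<Rightarrow> complex) \<Rightarrow> ('x \<Rightarrow> complex))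
     \<Rightarrow> ('x \<Rightarrow> complex) set" where
  "jacobson_radical A mul = {x \<in> A. \<forall>M. maximal_left_ideal A mul M \<longrightarrow> x \<in> M}"

text \<open>
  Powers start at exponent \<open>1\<close>: there are no \<open>0\<close>-fold products, and the iterate in
  \<open>nilpotent_element\<close> is \<open>x\<^sup>n\<^sup>+\<^sup>1\<close>.
\<close>

inductive nfold_product ::
  "('x \<Rightarrow> 'x \<Rightarrow> 'x) \<Rightarrow> 'x set \<Rightarrow> nat \<Rightarrow> 'x \<Rightarrow> bool" for mul I where
  one: "x \<in> I \<Longrightarrow> nfold_product mul I 1 x"
| mult: "nfold_product mul I n x \<Longrightarrow> y \<in> I \<Longrightarrow> nfold_product mul I (Suc n) (mul x y)"

definition power_vanishes :: "('x \<Rightarrow> 'x \<Rightarrow> 'x::zero) \<Rightarrow> 'x set \<Rightarrow> nat \<Rightarrow> bool" where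
  "power_vanishes mul I n \<longleftrightarrow> n \<ge> 1 \<and> (\<forall>x. nfold_product mul I n x \<longrightarrow> x = 0)"

definition nilpotent_ideal :: "('x \<Rightarrow> 'x \<Rightarrow> 'x::zero) \<Rightarrow> 'x set \<Rightarrow> bool" where
  "nilpotent_ideal mul I \<longleftrightarrow> (\<exists>n. power_vanishes mul I n)"

definition nilpotence_index :: "('x \<Rightarrow> 'x \<Rightarrow> 'x::zero) \<Rightarrow> 'x set \<Rightarrow> nat" where
  "nilpotence_index mul I = (LEAST n. power_vanishes mul I n)"

definition nilpotent_element :: "('x \<Rightarrow> 'x \<Rightarrow> 'x::zero) \<Rightarrow> 'x \<Rightarrow> bool" where
  "nilpotent_element mul x \<longleftrightarrow> (\<exists>n. ((\<lambda>y. mul y x) ^^ n) x = 0)"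

section \<open>Branch groups\<close>

definition internal_direct_product ::
  "('a, 'b) monoid_scheme \<Rightarrow> 'a set \<Rightarrow> 'i set \<Rightarrow> ('i \<Rightarrow> 'a set) \<Rightarrow> bool" where
  "internal_direct_product G H J L \<longleftrightarrow>
     subgroup H G \<and>
     (\<forall>j\<in>J. L j \<lhd> G\<lparr>carrier := H\<rparr>) \<and>
     generate G (\<Union>j\<in>J. L j) = H \<and>
     (\<forall>j\<in>J. L j \<inter> generate G (\<Union>i\<in>J - {j}. L i) = {\<one>\<^bsub>G\<^esub>})"

definition conjugate_set :: "('a, 'b) monoid_scheme \<Rightarrow> 'a \<Rightarrow> 'a set \<Rightarrow> 'a set" where
  "conjugate_set G g L = (g <#\<^bsub>G\<^esub> L) #>\<^bsub>G\<^esub> inv\<^bsub>G\<^esub> g"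

text \<open>
  All sequences are indexed from \<open>1\<close>; their values at \<open>0\<close> play no role. \<open>F i j\<close> is the
  \<open>j\<close>-th factor \<open>L\<^sub>i\<^sup>(\<^sup>j\<^sup>)\<close> of \<open>H i\<close>.
\<close>

definition branch_group :: "('a, 'b) monoid_scheme \<Rightarrow> bool" where
  "branch_group G \<longleftrightarrow> group G \<and> infinite (carrier G) \<and>
     (\<exists>(H :: nat \<Rightarrow> 'a set) (L :: nat \<Rightarrow> 'a set) (k :: nat \<Rightarrow> nat) (F :: nat \<Rightarrow> nat \<Rightarrow> 'a set).
        (\<forall>i\<ge>1. subgroup (H i) G \<and> H (Suc i) \<subseteq> H i) \<and>
        (\<forall>i\<ge>1. subgroup (L i) G \<and> L (Suc i) \<subseteq> L i) \<and>
        (\<forall>i\<ge>1. k i \<ge> 1) \<and>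
        (\<Inter>i\<in>{1..}. H i) = {\<one>\<^bsub>G\<^esub>} \<and>
        (\<forall>i\<ge>1. H i \<lhd> G \<and> finite (rcosets\<^bsub>G\<^esub> (H i))) \<and>
        (\<forall>i\<ge>1. internal_direct_product G (H i) {1..k i} (F i) \<and>
           (\<forall>j\<in>{1..k i}. G\<lparr>carrier := F i j\<rparr> \<cong> G\<lparr>carrier := L i\<rparr>)) \<and>
        (\<forall>i\<ge>1. \<exists>m\<ge>2. k (Suc i) = m * k i \<and>
           (\<forall>j\<in>{1..k i}. \<forall>l\<in>{(j - 1) * m + 1..j * m}. F (Suc i) l \<subseteq> F i j)) \<and>
        (\<forall>i\<ge>1.
           (\<forall>g\<in>carrier G. \<forall>j\<in>{1..k i}. \<exists>j'\<in>{1..k i}. conjugate_set G g (F i j) = F i j') \<and>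
           (\<forall>j\<in>{1..k i}. \<forall>j'\<in>{1..k i}. \<exists>g\<in>carrier G. conjugate_set G g (F i j) = F i j')))"

end

theory Submission
  imports Defs
begin

text \<open>
  Under \<open>\<ell>\<^sup>1(G)\<^sup>* = \<ell>\<^sup>\<infinity>(G)\<close> an element of the bidual is a bounded functional on bounded functions, and
  \<open>\<langle>\<Psi> \<box> \<Phi>, f\<rangle> = \<langle>\<Psi>, s \<mapsto> \<langle>\<Phi>, t \<mapsto> f (s t)\<rangle>\<rangle>\<close>.

  Let \<open>N\<^sub>1, \<dots>, N\<^sub>k\<close> be the factors of some \<open>H\<^sub>i\<close> and \<open>I\<close> the left ideal generated by their invariant
  differences. Conjugation permutes the \<open>N\<^sub>j\<close>, and \<open>H\<^sub>i\<close> has finite index, so every functional is a finite sum of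
  functionals supported on cosets of \<open>H\<^sub>i\<close>. Hence, if \<open>\<Omega>\<close> is invariant under \<open>r\<close> of the factors, \<open>\<Phi> \<box> \<Omega>\<close> is a sum
  of functionals each invariant under some \<open>r\<close> factors. Left multiplication by an invariant difference on \<open>N\<^sub>j\<close> kills
  those invariant under \<open>N\<^sub>j\<close> and makes the others invariant under one factor more, so \<open>I\<^sup>k\<^sup>+\<^sup>1 = 0\<close>. Conversely,
  if \<open>\<langle>\<Gamma>\<^sub>j, f\<^sub>j\<rangle> = 1\<close> for \<open>\<Gamma>\<^sub>j \<in> \<D>(N\<^sub>j)\<close> and \<open>x = \<Gamma>\<^sub>1 + \<dots> + \<Gamma>\<^sub>k\<close>, then \<open>\<langle>x\<^sup>k, f\<rangle> = k!\<close> for the product \<open>f\<close>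
  of the pullbacks of the \<open>f\<^sub>j\<close> to \<open>H\<^sub>i\<close>.

  For a radical element that is not nilpotent, take a sequence of factors \<open>N\<^sub>i\<close> at increasing levels which
  generate their direct product, and \<open>x = \<Sum> c\<^sub>i \<Gamma>\<^sub>i\<close> with \<open>c\<^sub>i \<noteq> 0\<close> decreasing fast: the radical contains the nilpotent
  left ideals, hence the \<open>\<Gamma>\<^sub>i\<close>, and it is closed, while \<open>x\<^sup>n \<noteq> 0\<close> by the same computation.
\<close>

section \<open>Functionals on bounded functions and the bidual\<close>

text \<open>What resists is left multiplication by an arbitrary \<Phi>: \<Phi> \<box> \<Omega>
  averages left translates of \<Omega>, and translation by t turns invariance under N into
  invariance under t N t^-1. The individual factors are lost; only their number survives, and only
  on pieces of \<Phi> where t N t^-1 does not depend on t. That is what the cosets are for. Pieces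
  are invariant under different sets of factors, so the count is kept on spans. Amenability supplies
  an invariant difference with a nonzero value on every infinite subgroup. The factors are infinite
  because of the branching: a finite one would contain ever smaller factors. A single level has
  finitely many factors and yields a nilpotent ideal; an element with all powers nonzero needs
  infinitely many independent factors, found by leaving one sibling behind at each level and
  descending into another. A maximal left ideal is a purely algebraic notion here. Closedness of the
  radical rests on the Neumann series: were the limit outside such an ideal M, some 1 - v with v of
  norm at most 1/2 would lie in M, and it is left invertible.\<close>

definition bounded_on :: "'x set \<Rightarrow> ('x \<Rightarrow> complex) \<Rightarrow> bool" where
  "bounded_on X f \<longleftrightarrow> (\<exists>K. \<forall>x\<in>X. cmod (f x) \<le> K)"

lemma bounded_onI: "(\<And>x. x \<in> X \<Longrightarrow> cmod (f x) \<le> K) \<Longrightarrow> bounded_on X f"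
  by (auto simp: bounded_on_def)

lemma bounded_onE:
  assumes "bounded_on X f"
  obtains K where "K \<ge> 0" "\<And>x. x \<in> X \<Longrightarrow> cmod (f x) \<le> K"
proof -
  obtain K where "\<forall>x\<in>X. cmod (f x) \<le> K" using assms by (auto simp: bounded_on_def)
  then show ?thesis by (intro that[of "max K 0"]) (auto simp: max.coboundedI1)
qed

lemma bounded_on_const [simp]: "bounded_on X (\<lambda>_. c)"
  by (rule bounded_onI[of _ _ "cmod c"]) simp

lemma bounded_on_add: 
  assumes "bounded_on X f" "bounded_on X g"
  shows "bounded_on X (\<lambda>x. f x + g x)"
proof -
  obtain K L where "\<And>x. x \<in> X \<Longrightarrow> cmod (f x) \<le> K" "\<And>x. x \<in> X \<Longrightarrow> cmod (g x) \<le> L"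
    using assms by (auto simp: bounded_on_def)
  then show ?thesis by (intro bounded_onI[of _ _ "K + L"] norm_triangle_mono)
qed

lemma bounded_on_mult: 
  assumes "bounded_on X f" "bounded_on X g"
  shows "bounded_on X (\<lambda>x. f x * g x)"
proof -
  obtain K L where "K \<ge> 0" "\<And>x. x \<in> X \<Longrightarrow> cmod (f x) \<le> K" "\<And>x. x \<in> X \<Longrightarrow> cmod (g x) \<le> L"
    using assms by (auto elim!: bounded_onE)
  then show ?thesis by (intro bounded_onI[of _ _ "K * L"]) (auto simp: norm_mult intro!: mult_mono)
qed

lemma bounded_on_uminus: "bounded_on X f \<Longrightarrow> bounded_on X (\<lambda>x. - f x)"
  by (simp add: bounded_on_def)

lemma bounded_on_diff:
  "bounded_on X f \<Longrightarrow> bounded_on X g \<Longrightarrow> bounded_on X (\<lambda>x. f x - g x)"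
  using bounded_on_add[of X f "\<lambda>x. - g x"] bounded_on_uminus[of X g] by simp

lemma bounded_on_sum:
  "(\<And>i. i \<in> I \<Longrightarrow> bounded_on X (f i)) \<Longrightarrow> bounded_on X (\<lambda>x. \<Sum>i\<in>I. f i x)"
  by (induction I rule: infinite_finite_induct) (auto intro: bounded_on_add)

lemma bounded_on_prod:
  "(\<And>i. i \<in> I \<Longrightarrow> bounded_on X (f i)) \<Longrightarrow> bounded_on X (\<lambda>x. \<Prod>i\<in>I. f i x)"
  by (induction I rule: infinite_finite_induct) (auto intro: bounded_on_mult)

lemma bounded_on_compose:
  "bounded_on Y f \<Longrightarrow> (\<And>x. x \<in> X \<Longrightarrow> h x \<in> Y) \<Longrightarrow> bounded_on X (\<lambda>x. f (h x))"
  by (auto simp: bounded_on_def)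

lemma bounded_on_subset: "bounded_on Y f \<Longrightarrow> X \<subseteq> Y \<Longrightarrow> bounded_on X f"
  by (auto simp: bounded_on_def)

lemma bounded_on_cong: "(\<And>x. x \<in> X \<Longrightarrow> f x = g x) \<Longrightarrow> bounded_on X f \<longleftrightarrow> bounded_on X g"
  by (simp add: bounded_on_def)

lemma bounded_on_if:
  assumes "bounded_on X f" "bounded_on X g"
  shows "bounded_on X (\<lambda>x. if P x then f x else g x)"
proof -
  obtain K L where "\<And>x. x \<in> X \<Longrightarrow> cmod (f x) \<le> K" "\<And>x. x \<in> X \<Longrightarrow> cmod (g x) \<le> L"
    using assms by (auto simp: bounded_on_def)
  then show ?thesis
    by (intro bounded_onI[of _ _ "max K L"]) (auto intro: max.coboundedI1 max.coboundedI2)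
qed

text \<open>No value is prescribed on unbounded functions. The bound is quantified over all K
  instead of using a supremum norm; with K = 0 it forces the value at a bounded function to depend
  only on its restriction to X, so functions need not be cut off outside X.\<close>

definition bdd_functional :: "'x set \<Rightarrow> (('x \<Rightarrow> complex) \<Rightarrow> complex) \<Rightarrow> bool" where
  "bdd_functional X m \<longleftrightarrow>
     (\<forall>f g. bounded_on X f \<longrightarrow> bounded_on X g \<longrightarrow> m (\<lambda>x. f x + g x) = m f + m g) \<and>
     (\<forall>c f. bounded_on X f \<longrightarrow> m (\<lambda>x. c * f x) = c * m f) \<and>
     (\<exists>C\<ge>0. \<forall>f K. K \<ge> 0 \<longrightarrow> (\<forall>x\<in>X. cmod (f x) \<le> K) \<longrightarrow> cmod (m f) \<le> C * K)"

lemma bdd_functional_add: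
  "bdd_functional X m \<Longrightarrow> bounded_on X f \<Longrightarrow> bounded_on X g \<Longrightarrow> m (\<lambda>x. f x + g x) = m f + m g"
  by (simp add: bdd_functional_def)

lemma bdd_functional_cmult:
  "bdd_functional X m \<Longrightarrow> bounded_on X f \<Longrightarrow> m (\<lambda>x. c * f x) = c * m f"
  by (simp add: bdd_functional_def)

lemma bdd_functional_bound:
  assumes "bdd_functional X m"
  obtains C where "C \<ge> 0"
    "\<And>f K. K \<ge> 0 \<Longrightarrow> (\<And>x. x \<in> X \<Longrightarrow> cmod (f x) \<le> K) \<Longrightarrow> cmod (m f) \<le> C * K"
  using assms unfolding bdd_functional_def by blast

lemma bdd_functional_zero: "bdd_functional X m \<Longrightarrow> m (\<lambda>_. 0) = 0"
  using bdd_functional_cmult[of X m "\<lambda>_. 0" 0] by simp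

lemma bdd_functional_const:
  assumes "bdd_functional X m"
  shows "m (\<lambda>_. c) = c * m (\<lambda>_. 1)"
  using bdd_functional_cmult[OF assms, of "\<lambda>_. 1" c] by simp

lemma bdd_functional_diff:
  assumes "bdd_functional X m" "bounded_on X f" "bounded_on X g"
  shows "m (\<lambda>x. f x - g x) = m f - m g"
  using bdd_functional_add[OF assms(1,2) bounded_on_uminus[OF assms(3)]]
    bdd_functional_cmult[OF assms(1,3), of "-1"] by simp

lemma bdd_functional_vanish:
  assumes "bdd_functional X m" "\<And>x. x \<in> X \<Longrightarrow> f x = 0"
  shows "m f = 0"
proof -
  obtain C where "\<And>f K. K \<ge> 0 \<Longrightarrow> (\<And>x. x \<in> X \<Longrightarrow> cmod (f x) \<le> K) \<Longrightarrow> cmod (m f) \<le> C * K"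
    using bdd_functional_bound[OF assms(1)] by metis
  from this[of 0 f] assms(2) show ?thesis by simp
qed

lemma bdd_functional_cong:
  assumes "bdd_functional X m" "bounded_on X f" "\<And>x. x \<in> X \<Longrightarrow> f x = g x"
  shows "m f = m g"
proof -
  have "bounded_on X g" using assms(2,3) bounded_on_cong by metis
  then have "m f - m g = m (\<lambda>x. f x - g x)" using assms(1,2) bdd_functional_diff by metis
  also have "\<dots> = 0" by (rule bdd_functional_vanish[OF assms(1)]) (simp add: assms(3))
  finally show ?thesis by simp
qed

lemma bdd_functional_sum:
  assumes "bdd_functional X m" "\<And>i. i \<in> I \<Longrightarrow> bounded_on X (f i)"
  shows "m (\<lambda>x. \<Sum>i\<in>I. f i x) = (\<Sum>i\<in>I. m (f i))"
  using assms(2)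
proof (induction I rule: infinite_finite_induct)
  case (insert i I)
  then show ?case using bdd_functional_add[OF assms(1), of "f i" "\<lambda>x. \<Sum>i\<in>I. f i x"]
    by (simp add: bounded_on_sum)
qed (simp_all add: bdd_functional_zero[OF assms(1)])

text \<open>Serves iterated pairings: the inner value must be a bounded function of the outer
  variable s, which needs one K for all s.\<close>

lemma bdd_functional_bounded_on:
  assumes "bdd_functional X m" "K \<ge> 0" "\<And>s x. s \<in> Y \<Longrightarrow> x \<in> X \<Longrightarrow> cmod (F s x) \<le> K"
  shows "bounded_on Y (\<lambda>s. m (F s))"
proof -
  obtain C where "\<And>f K. K \<ge> 0 \<Longrightarrow> (\<And>x. x \<in> X \<Longrightarrow> cmod (f x) \<le> K) \<Longrightarrow> cmod (m f) \<le> C * K"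
    using bdd_functional_bound[OF assms(1)] by metis
  then show ?thesis using assms(2,3) by (intro bounded_onI[of _ _ "C * K"]) blast
qed

subsection \<open>The dual of the group algebra\<close>

lemma l1_space_abs_summable:
  assumes "f \<in> l1_space G" "bounded_on (carrier G) \<phi>"
  shows "(\<lambda>t. cmod (f t * \<phi> t)) summable_on carrier G"
proof -
  obtain K where K: "\<And>x. x \<in> carrier G \<Longrightarrow> cmod (\<phi> x) \<le> K"
    using assms(2) by (auto simp: bounded_on_def)
  have "(\<lambda>t. cmod (f t) * K) summable_on carrier G"
    using assms(1) by (auto simp: l1_space_def intro: summable_on_cmult_left)
  then show ?thesis
    by (rule Infinite_Sum.abs_summable_on_comparison_test') (auto simp: norm_mult K mult_left_mono)
qed

lemma l1_norm_nonneg: "l1_norm G f \<ge> 0"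
  by (simp add: l1_norm_def infsum_nonneg)

lemma zero_in_l1_space: "0 \<in> l1_space G"
  by (simp add: l1_space_def)

lemma l1_norm_zero: "l1_norm G 0 = 0"
  by (simp add: l1_norm_def)

lemma l1_space_add:
  assumes "f \<in> l1_space G" "g \<in> l1_space G"
  shows "f + g \<in> l1_space G"
proof -
  have "(\<lambda>x. cmod (f x) + cmod (g x)) summable_on carrier G"
    using assms by (auto simp: l1_space_def intro: summable_on_add)
  then have "(\<lambda>x. cmod (f x + g x)) summable_on carrier G"
    by (rule Infinite_Sum.abs_summable_on_comparison_test') (rule norm_triangle_ineq)
  then show ?thesis using assms by (simp add: l1_space_def)
qed

lemma l1_space_cscale:
  assumes "f \<in> l1_space G"
  shows "cscale c f \<in> l1_space G"
  using assms by (auto simp: l1_space_def cscale_def norm_mult intro: summable_on_cmult_right)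

lemma point_mass_eqs:
  assumes "t \<in> carrier G"
  shows point_mass_in_l1_space: "point_mass t \<in> l1_space G"
    and l1_norm_point_mass: "l1_norm G (point_mass t) = 1"
    and infsum_point_mass: "infsum (\<lambda>s. point_mass t s * \<phi> s) (carrier G) = \<phi> t"
proof -
  have "((\<lambda>x. cmod (point_mass t x)) has_sum (\<Sum>x\<in>{t}. cmod (point_mass t x))) {t}"
    by (rule has_sum_finite) simp
  then have hs: "((\<lambda>x. cmod (point_mass t x)) has_sum 1) (carrier G)"
    using has_sum_cong_neutral[of "carrier G" "{t}" "\<lambda>x. cmod (point_mass t x)" 
        "\<lambda>x. cmod (point_mass t x)"] assms by (simp add: point_mass_def)
  then show "point_mass t \<in> l1_space G"
    using assms by (auto simp: l1_space_def point_mass_def summable_on_def)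
  show "l1_norm G (point_mass t) = 1" using hs by (simp add: l1_norm_def infsumI)
  have "infsum (\<lambda>s. point_mass t s * \<phi> s) (carrier G) = infsum (\<lambda>s. point_mass t s * \<phi> s) {t}"
    using assms by (intro infsum_cong_neutral) (auto simp: point_mass_def)
  then show "infsum (\<lambda>s. point_mass t s * \<phi> s) (carrier G) = \<phi> t" by (simp add: point_mass_def)
qed

lemma linf_functional_point_mass:
  "t \<in> carrier G \<Longrightarrow> linf_functional G \<phi> (point_mass t) = \<phi> t"
  by (simp add: linf_functional_def point_mass_in_l1_space infsum_point_mass)

lemma linf_functional_bound:
  assumes "K \<ge> 0" "\<And>x. x \<in> carrier G \<Longrightarrow> cmod (\<phi> x) \<le> K"
  shows "cmod (linf_functional G \<phi> f) \<le> K * l1_norm G f"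
proof (cases "f \<in> l1_space G")
  case True
  have b: "bounded_on (carrier G) \<phi>" using assms(2) by (rule bounded_onI)
  have s: "(\<lambda>t. cmod (f t)) summable_on carrier G" using True by (simp add: l1_space_def)
  have "cmod (linf_functional G \<phi> f) \<le> infsum (\<lambda>t. cmod (f t * \<phi> t)) (carrier G)"
    using norm_infsum_bound[OF l1_space_abs_summable[OF True b]] True
    by (simp add: linf_functional_def)
  also have "\<dots> \<le> infsum (\<lambda>t. K * cmod (f t)) (carrier G)"
  proof (rule infsum_mono)
    show "(\<lambda>t. cmod (f t * \<phi> t)) summable_on carrier G" by (rule l1_space_abs_summable[OF True b])
    show "(\<lambda>t. K * cmod (f t)) summable_on carrier G" by (rule summable_on_cmult_right[OF s])
    show "cmod (f t * \<phi> t) \<le> K * cmod (f t)" if "t \<in> carrier G" for t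
      using mult_right_mono[OF assms(2)[OF that], of "cmod (f t)"] by (simp add: norm_mult mult.commute)
  qed
  also have "\<dots> = K * l1_norm G f" by (simp add: infsum_cmult_right' l1_norm_def)
  finally show ?thesis .
qed (simp add: linf_functional_def assms(1) l1_norm_nonneg)

lemma linf_functional_in_dual:
  assumes "bounded_on (carrier G) \<phi>"
  shows "linf_functional G \<phi> \<in> dual_space (l1_space G) (l1_norm G)"
proof -
  obtain K where "K \<ge> 0" "\<And>x. x \<in> carrier G \<Longrightarrow> cmod (\<phi> x) \<le> K" using bounded_onE[OF assms] by metis
  note bd = linf_functional_bound[of K G \<phi>, OF this]
  have "linf_functional G \<phi> (u + v) = linf_functional G \<phi> u + linf_functional G \<phi> v"
    if "u \<in> l1_space G" "v \<in> l1_space G" for u v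
    using infsum_add[OF abs_summable_summable[OF l1_space_abs_summable[OF that(1) assms]]
       abs_summable_summable[OF l1_space_abs_summable[OF that(2) assms]]] that l1_space_add[OF that]
    by (simp add: linf_functional_def distrib_right)
  moreover have "linf_functional G \<phi> (cscale c v) = c * linf_functional G \<phi> v"
    if "v \<in> l1_space G" for c v
    using that l1_space_cscale[OF that, of c]
    by (simp add: linf_functional_def cscale_def mult.assoc infsum_cmult_right')
  moreover have "linf_functional G \<phi> v = 0" if "v \<notin> l1_space G" for v
    using that by (simp add: linf_functional_def)
  ultimately show ?thesis
    unfolding dual_space_def using bd by blast
qed

lemma linf_functional_cong:
  "(\<And>t. t \<in> carrier G \<Longrightarrow> f t = g t) \<Longrightarrow> linf_functional G f = linf_functional G g"
  by (auto simp: linf_functional_def fun_eq_iff intro!: infsum_cong)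

lemma dual_space_zero:
  assumes "F \<in> dual_space V nrm" "0 \<in> V"
  shows "F 0 = 0"
proof -
  have "cscale 0 0 = (0 :: 'a \<Rightarrow> complex)" by (simp add: cscale_def fun_eq_iff)
  then show ?thesis using assms unfolding dual_space_def by (auto dest!: spec[of _ 0])
qed

text \<open>Finitely supported functions are combinations of point masses and are dense in \<ell>1,
  so a bounded functional is determined by its values at point masses.\<close>

lemma dual_space_l1:
  assumes F: "F \<in> dual_space (l1_space G) (l1_norm G)"
  shows bounded_on_dual: "bounded_on (carrier G) (\<lambda>t. F (point_mass t))"
    and dual_eq_linf_functional: "F = linf_functional G (\<lambda>t. F (point_mass t))"
proof -
  obtain C where "\<forall>v\<in>l1_space G. cmod (F v) \<le> C * l1_norm G v"
    using F by (auto simp: dual_space_def)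
  then have C: "cmod (F v) \<le> C * l1_norm G v" if "v \<in> l1_space G" for v using that by blast
  show b: "bounded_on (carrier G) (\<lambda>t. F (point_mass t))"
    using C[OF point_mass_in_l1_space] l1_norm_point_mass[of _ G]
    by (intro bounded_onI[of _ _ C]) simp
  have add: "F (u + v) = F u + F v" if "u \<in> l1_space G" "v \<in> l1_space G" for u v
    using F that by (simp add: dual_space_def)
  have sc: "F (cscale c v) = c * F v" if "v \<in> l1_space G" for c v
    using F that by (simp add: dual_space_def)
  show "F = linf_functional G (\<lambda>t. F (point_mass t))"
  proof
    fix f show "F f = linf_functional G (\<lambda>t. F (point_mass t)) f"
    proof (cases "f \<in> l1_space G")
      case False
      then show ?thesis using F by (simp add: dual_space_def linf_functional_def)
    next
      case True
      define cut where "cut S = (\<lambda>x. if x \<in> S then f x else 0)" for S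
      have sf: "(\<lambda>x. cmod (f x)) summable_on carrier G" using True by (simp add: l1_space_def)
      have cut_in: "cut S \<in> l1_space G" for S
        using True Infinite_Sum.abs_summable_on_comparison_test'[OF sf, of "cut S"]
        by (auto simp: l1_space_def cut_def)
      have Fcut: "F (cut S) = (\<Sum>t\<in>S. f t * F (point_mass t))" 
        if "finite S" "S \<subseteq> carrier G" for S
        using that
      proof (induction S rule: finite_induct)
        case empty
        have "cut {} = 0" by (simp add: cut_def fun_eq_iff)
        then show ?case using dual_space_zero[OF F zero_in_l1_space] by (metis sum.empty)
      next
        case (insert t S)
        have "cut (insert t S) = cscale (f t) (point_mass t) + cut S"
          using insert(2) by (auto simp: cut_def fun_eq_iff cscale_def point_mass_def)
        then show ?case
          using insert add[OF l1_space_cscale cut_in] sc point_mass_in_l1_space[of t G]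
          by (simp del: plus_fun_apply)
      qed
      \<comment> \<open>The error is \<open>F\<close> on the tail \<open>cut (- S)\<close>, hence at
        most C times the norm of the tail, which is the norm of f minus a finite partial
        sum.\<close>
      have est: "norm ((\<Sum>t\<in>S. f t * F (point_mass t)) - F f)
                 \<le> C * (l1_norm G f - (\<Sum>t\<in>S. cmod (f t)))"
        if "finite S" "S \<subseteq> carrier G" for S
      proof -
        have "f = cut S + cut (- S)" by (auto simp: cut_def fun_eq_iff)
        then have "F f = F (cut S) + F (cut (- S))" using add[OF cut_in cut_in] by metis
        then have "norm ((\<Sum>t\<in>S. f t * F (point_mass t)) - F f) = cmod (F (cut (- S)))"
          using Fcut[OF that] by simp
        also have "\<dots> \<le> C * l1_norm G (cut (- S))" by (rule C[OF cut_in])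
        also have "l1_norm G (cut (- S)) = infsum (\<lambda>x. cmod (f x)) (carrier G - S)"
          unfolding l1_norm_def by (rule infsum_cong_neutral) (auto simp: cut_def)
        also have "\<dots> = l1_norm G f - (\<Sum>t\<in>S. cmod (f t))"
          using infsum_Diff[OF sf _ that(2)] that by (simp add: l1_norm_def)
        finally show ?thesis .
      qed
      have "((\<lambda>S. \<Sum>t\<in>S. cmod (f t)) \<longlongrightarrow> l1_norm G f) (finite_subsets_at_top (carrier G))"
        using has_sum_infsum[OF sf] by (simp add: has_sum_def l1_norm_def)
      then have "((\<lambda>S. C * (l1_norm G f - (\<Sum>t\<in>S. cmod (f t)))) \<longlongrightarrow> C * (l1_norm G f - l1_norm G f))
          (finite_subsets_at_top (carrier G))"
        by (intro tendsto_intros)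
      then have lim: "((\<lambda>S. C * (l1_norm G f - (\<Sum>t\<in>S. cmod (f t)))) \<longlongrightarrow> 0)
          (finite_subsets_at_top (carrier G))" by simp
      have "((\<lambda>S. (\<Sum>t\<in>S. f t * F (point_mass t)) - F f) \<longlongrightarrow> 0) (finite_subsets_at_top (carrier G))"
        by (rule Lim_null_comparison[OF _ lim]) (auto intro: eventually_finite_subsets_at_top_weakI est)
      then have "((\<lambda>t. f t * F (point_mass t)) has_sum F f) (carrier G)"
        by (simp add: has_sum_def LIM_zero_iff)
      then show ?thesis using True by (simp add: linf_functional_def infsumI)
    qed
  qed
qed

lemma dual_norm_l1:
  assumes F: "F \<in> dual_space (l1_space G) (l1_norm G)"
  shows cmod_point_mass_le_dual_norm:
      "t \<in> carrier G \<Longrightarrow> cmod (F (point_mass t)) \<le> dual_norm (l1_space G) (l1_norm G) F"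
    and dual_norm_nonneg: "dual_norm (l1_space G) (l1_norm G) F \<ge> 0"
proof -
  obtain K where K: "K \<ge> 0" "\<And>x. x \<in> carrier G \<Longrightarrow> cmod (F (point_mass x)) \<le> K" 
    using bounded_onE[OF bounded_on_dual[OF F]] by metis
  have "cmod (F v) \<le> K" if "l1_norm G v \<le> 1" for v
  proof -
    have "cmod (F v) \<le> K * l1_norm G v"
      using linf_functional_bound[of K G "\<lambda>t. F (point_mass t)" v, OF K] dual_eq_linf_functional[OF F, symmetric] by simp
    also have "\<dots> \<le> K" using that K(1) by (simp add: mult_left_le)
    finally show ?thesis .
  qed
  then have bdd: "bdd_above ((\<lambda>v. cmod (F v)) ` {v \<in> l1_space G. l1_norm G v \<le> 1})"
    by (intro bdd_aboveI[of _ K]) auto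
  show "cmod (F (point_mass t)) \<le> dual_norm (l1_space G) (l1_norm G) F" if "t \<in> carrier G"
    unfolding dual_norm_def using that
    by (intro cSUP_upper[OF _ bdd]) (simp add: point_mass_in_l1_space l1_norm_point_mass)
  have "cmod (F 0) \<le> dual_norm (l1_space G) (l1_norm G) F"
    unfolding dual_norm_def by (intro cSUP_upper[OF _ bdd]) (simp add: zero_in_l1_space l1_norm_zero)
  then show "dual_norm (l1_space G) (l1_norm G) F \<ge> 0" using norm_ge_zero order_trans by blast
qed

lemma dual_norm_linf_functional_le:
  assumes "K \<ge> 0" "\<And>x. x \<in> carrier G \<Longrightarrow> cmod (\<phi> x) \<le> K"
  shows "dual_norm (l1_space G) (l1_norm G) (linf_functional G \<phi>) \<le> K"
  unfolding dual_norm_def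
proof (rule cSUP_least)
  show "{v \<in> l1_space G. l1_norm G v \<le> 1} \<noteq> {}"
    using zero_in_l1_space[of G] l1_norm_zero[of G] by (metis (mono_tags, lifting) empty_iff mem_Collect_eq zero_le_one)
  fix v assume "v \<in> {v \<in> l1_space G. l1_norm G v \<le> 1}"
  then have "K * l1_norm G v \<le> K" using assms(1) by (simp add: mult_left_le)
  then show "cmod (linf_functional G \<phi> v) \<le> K"
    using linf_functional_bound[of K G \<phi> v, OF assms] by linarith
qed

text \<open>\<open>pairing G \<Phi>\<close> is \<open>\<Phi>\<close> as a functional on bounded functions on \<open>G\<close>, through
  \<open>\<ell>\<^sup>1(G)\<^sup>* = \<ell>\<^sup>\<infinity>(G)\<close>; \<open>bidual_of G\<close> is the converse passage.\<close>

definition pairing ::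
  "('a, 'b) monoid_scheme \<Rightarrow> ((('a \<Rightarrow> complex) \<Rightarrow> complex) \<Rightarrow> complex) \<Rightarrow> ('a \<Rightarrow> complex) \<Rightarrow> complex" where
  "pairing G \<Phi> f = \<Phi> (linf_functional G f)"

definition bidual_of ::
  "('a, 'b) monoid_scheme \<Rightarrow> (('a \<Rightarrow> complex) \<Rightarrow> complex) \<Rightarrow> ((('a \<Rightarrow> complex) \<Rightarrow> complex) \<Rightarrow> complex)" where
  "bidual_of G m F =
     (if F \<in> dual_space (l1_space G) (l1_norm G) then m (\<lambda>t. F (point_mass t)) else 0)"

lemma linf_functional_add:
  assumes "bounded_on (carrier G) f" "bounded_on (carrier G) g"
  shows "linf_functional G (\<lambda>x. f x + g x) = linf_functional G f + linf_functional G g"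
proof
  fix u show "linf_functional G (\<lambda>x. f x + g x) u = (linf_functional G f + linf_functional G g) u"
    using infsum_add[OF abs_summable_summable[OF l1_space_abs_summable[of u G f]]
       abs_summable_summable[OF l1_space_abs_summable[of u G g]]] assms
    by (simp add: linf_functional_def distrib_left)
qed

lemma linf_functional_cmult:
  "linf_functional G (\<lambda>x. c * f x) = cscale c (linf_functional G f)"
  by (auto simp: fun_eq_iff linf_functional_def cscale_def mult.left_commute[of _ c] infsum_cmult_right')

lemma bdd_functional_pairing:
  assumes "\<Phi> \<in> l1_bidual G"
  shows "bdd_functional (carrier G) (pairing G \<Phi>)"
proof -
  note P = assms[unfolded l1_bidual_def bidual_space_def dual_space_def[of "dual_space _ _"], simplified]
  obtain C where C: "\<And>F. F \<in> dual_space (l1_space G) (l1_norm G) \<Longrightarrow>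
      cmod (\<Phi> F) \<le> C * dual_norm (l1_space G) (l1_norm G) F" using P by blast
  have "cmod (pairing G \<Phi> f) \<le> max C 0 * K"
    if "K \<ge> 0" "\<forall>x\<in>carrier G. cmod (f x) \<le> K" for f K
  proof -
    have d: "linf_functional G f \<in> dual_space (l1_space G) (l1_norm G)"
      using that(2) by (auto intro: linf_functional_in_dual bounded_onI)
    have "cmod (pairing G \<Phi> f) \<le> C * dual_norm (l1_space G) (l1_norm G) (linf_functional G f)"
      using C[OF d] by (simp add: pairing_def)
    also have "\<dots> \<le> max C 0 * dual_norm (l1_space G) (l1_norm G) (linf_functional G f)"
      using dual_norm_nonneg[OF d] by (simp add: mult_right_mono)
    also have "\<dots> \<le> max C 0 * K" using that by (intro mult_left_mono dual_norm_linf_functional_le) auto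
    finally show ?thesis .
  qed
  moreover have "pairing G \<Phi> (\<lambda>x. f x + g x) = pairing G \<Phi> f + pairing G \<Phi> g"
    if "bounded_on (carrier G) f" "bounded_on (carrier G) g" for f g
    using P linf_functional_in_dual[OF that(1)] linf_functional_in_dual[OF that(2)] that
    by (simp add: pairing_def linf_functional_add)
  moreover have "pairing G \<Phi> (\<lambda>x. c * f x) = c * pairing G \<Phi> f" if "bounded_on (carrier G) f" for c f
    using P linf_functional_in_dual[OF that] by (simp add: pairing_def linf_functional_cmult)
  ultimately show ?thesis
    unfolding bdd_functional_def using max.cobounded2 by blast
qed

lemma bidual_of_in_bidual:
  assumes "bdd_functional (carrier G) m"
  shows "bidual_of G m \<in> l1_bidual G"
proof -
  obtain C where C: "C \<ge> 0"
    "\<And>f K. K \<ge> 0 \<Longrightarrow> (\<And>x. x \<in> carrier G \<Longrightarrow> cmod (f x) \<le> K) \<Longrightarrow> cmod (m f) \<le> C * K"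
    using bdd_functional_bound[OF assms] by metis
  let ?D = "dual_space (l1_space G) (l1_norm G)"
  have add: "F + F' \<in> ?D" if "F \<in> ?D" "F' \<in> ?D" for F F'
    using linf_functional_add[OF bounded_on_dual[OF that(1)] bounded_on_dual[OF that(2)]]
      dual_eq_linf_functional[OF that(1)] dual_eq_linf_functional[OF that(2)]
      linf_functional_in_dual[OF bounded_on_add[OF bounded_on_dual[OF that(1)] bounded_on_dual[OF that(2)]]]
    by metis
  have scale: "cscale c F \<in> ?D" if "F \<in> ?D" for c F
    using linf_functional_cmult[of G c] dual_eq_linf_functional[OF that]
      linf_functional_in_dual[OF bounded_on_mult[OF bounded_on_const bounded_on_dual[OF that]]]
    by metis
  have "bidual_of G m (F + F') = bidual_of G m F + bidual_of G m F'" if "F \<in> ?D" "F' \<in> ?D" for F F'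
    using that add[OF that] bdd_functional_add[OF assms bounded_on_dual bounded_on_dual]
    by (simp add: bidual_of_def)
  moreover have "bidual_of G m (cscale c F) = c * bidual_of G m F" if "F \<in> ?D" for c F
    using that scale[OF that] bdd_functional_cmult[OF assms bounded_on_dual, of F c]
    by (simp add: bidual_of_def cscale_def)
  moreover have "cmod (bidual_of G m F) \<le> C * dual_norm (l1_space G) (l1_norm G) F" if "F \<in> ?D" for F
    using that C(2)[OF dual_norm_nonneg[OF that] cmod_point_mass_le_dual_norm[OF that]]
    by (simp add: bidual_of_def)
  ultimately show ?thesis
    unfolding l1_bidual_def bidual_space_def dual_space_def[of ?D]
    by (intro CollectI conjI allI ballI impI exI[of _ C]) (simp_all add: bidual_of_def)
qed

lemma pairing_bidual_of:
  assumes "bdd_functional (carrier G) m" "bounded_on (carrier G) f"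
  shows "pairing G (bidual_of G m) f = m f"
proof -
  have "pairing G (bidual_of G m) f = m (\<lambda>t. linf_functional G f (point_mass t))"
    using linf_functional_in_dual[OF assms(2)] by (simp add: pairing_def bidual_of_def)
  also have "\<dots> = m f"
    using bdd_functional_cong[OF assms] linf_functional_point_mass by metis
  finally show ?thesis .
qed

lemma bidual_apply:
  assumes "F \<in> dual_space (l1_space G) (l1_norm G)"
  shows "\<Phi> F = pairing G \<Phi> (\<lambda>t. F (point_mass t))"
  using dual_eq_linf_functional[OF assms] by (simp add: pairing_def)

lemma bidual_outside:
  "\<Phi> \<in> l1_bidual G \<Longrightarrow> F \<notin> dual_space (l1_space G) (l1_norm G) \<Longrightarrow> \<Phi> F = 0"
  by (simp add: l1_bidual_def bidual_space_def dual_space_def[of "dual_space _ _"])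

text \<open>Elements of the bidual vanish off the dual by convention, so testing on bounded
  functions suffices.\<close>

lemma bidual_eqI:
  assumes "\<Phi> \<in> l1_bidual G" "\<Psi> \<in> l1_bidual G"
    "\<And>f. bounded_on (carrier G) f \<Longrightarrow> pairing G \<Phi> f = pairing G \<Psi> f"
  shows "\<Phi> = \<Psi>"
proof
  fix F show "\<Phi> F = \<Psi> F"
    using assms bidual_outside bidual_apply bounded_on_dual by metis
qed

text \<open>Trades the dual norm for a sup bound, so that closure properties can be checked on
  functions on the group.\<close>

lemma l1_bidual_iff:
  "\<Phi> \<in> l1_bidual G \<longleftrightarrow> (\<forall>F. F \<notin> dual_space (l1_space G) (l1_norm G) \<longrightarrow> \<Phi> F = 0) \<and>
     bdd_functional (carrier G) (pairing G \<Phi>)"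
proof
  assume R: "(\<forall>F. F \<notin> dual_space (l1_space G) (l1_norm G) \<longrightarrow> \<Phi> F = 0) \<and>
    bdd_functional (carrier G) (pairing G \<Phi>)"
  have "bidual_of G (pairing G \<Phi>) = \<Phi>"
    using R bidual_apply[of _ G \<Phi>] by (auto simp: bidual_of_def fun_eq_iff)
  then show "\<Phi> \<in> l1_bidual G" using R bidual_of_in_bidual by metis
qed (simp add: bidual_outside bdd_functional_pairing)

lemma bdd_functional_plus:
  assumes m: "bdd_functional X m" "bdd_functional X m'" 
  shows "bdd_functional X (\<lambda>f. m f + m' f)"
proof -
  obtain C where C: "C \<ge> 0"
    "\<And>f K. K \<ge> 0 \<Longrightarrow> (\<And>x. x \<in> X \<Longrightarrow> cmod (f x) \<le> K) \<Longrightarrow> cmod (m f) \<le> C * K"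
    using bdd_functional_bound[OF m(1)] by metis
  obtain C' where C': "C' \<ge> 0"
    "\<And>f K. K \<ge> 0 \<Longrightarrow> (\<And>x. x \<in> X \<Longrightarrow> cmod (f x) \<le> K) \<Longrightarrow> cmod (m' f) \<le> C' * K"
    using bdd_functional_bound[OF m(2)] by metis
  have "cmod (m f + m' f) \<le> (C + C') * K" if "K \<ge> 0" "\<forall>x\<in>X. cmod (f x) \<le> K" for f K
    using norm_triangle_mono[OF C(2)[of K f] C'(2)[of K f]] that by (simp add: distrib_right)
  then have "\<exists>C\<ge>0. \<forall>f K. K \<ge> 0 \<longrightarrow> (\<forall>x\<in>X. cmod (f x) \<le> K) \<longrightarrow> cmod (m f + m' f) \<le> C * K"
    using C(1) C'(1) by (intro exI[of _ "C + C'"]) simp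
  then show ?thesis using m by (simp add: bdd_functional_def algebra_simps)
qed

lemma bdd_functional_times:
  assumes m: "bdd_functional X m"
  shows "bdd_functional X (\<lambda>f. c * m f)"
proof -
  obtain C where C: "C \<ge> 0"
    "\<And>f K. K \<ge> 0 \<Longrightarrow> (\<And>x. x \<in> X \<Longrightarrow> cmod (f x) \<le> K) \<Longrightarrow> cmod (m f) \<le> C * K"
    using bdd_functional_bound[OF m] by metis
  have "cmod (c * m f) \<le> (cmod c * C) * K" if "K \<ge> 0" "\<forall>x\<in>X. cmod (f x) \<le> K" for f K
    using mult_left_mono[OF C(2)[of K f], of "cmod c"] that by (simp add: norm_mult mult.assoc)
  then have "\<exists>C\<ge>0. \<forall>f K. K \<ge> 0 \<longrightarrow> (\<forall>x\<in>X. cmod (f x) \<le> K) \<longrightarrow> cmod (c * m f) \<le> C * K"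
    using C(1) by (intro exI[of _ "cmod c * C"]) simp
  then show ?thesis using m by (simp add: bdd_functional_def algebra_simps)
qed

lemma pairing_plus: "pairing G (\<Phi> + \<Psi>) f = pairing G \<Phi> f + pairing G \<Psi> f"
  by (simp add: pairing_def)

lemma pairing_cscale: "pairing G (cscale c \<Phi>) f = c * pairing G \<Phi> f"
  by (simp add: pairing_def cscale_def)

lemma l1_bidual_subspace: "cfun.subspace (l1_bidual G)"
proof -
  have "pairing G 0 = (\<lambda>_. 0)" by (simp add: pairing_def fun_eq_iff)
  then have "0 \<in> l1_bidual G"
    by (auto simp: l1_bidual_iff bdd_functional_def intro: exI[of _ 0])
  moreover have "\<Phi> + \<Psi> \<in> l1_bidual G" if "\<Phi> \<in> l1_bidual G" "\<Psi> \<in> l1_bidual G" for \<Phi> \<Psi>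
  proof -
    have "pairing G (\<Phi> + \<Psi>) = (\<lambda>f. pairing G \<Phi> f + pairing G \<Psi> f)" 
      by (simp add: pairing_plus fun_eq_iff)
    then show ?thesis
      using that bdd_functional_plus[OF that[THEN bdd_functional_pairing]] by (simp add: l1_bidual_iff)
  qed
  moreover have "cscale c \<Phi> \<in> l1_bidual G" if "\<Phi> \<in> l1_bidual G" for c \<Phi>
  proof -
    have "pairing G (cscale c \<Phi>) = (\<lambda>f. c * pairing G \<Phi> f)" 
      by (simp add: pairing_cscale fun_eq_iff)
    then show ?thesis using that bdd_functional_times[OF bdd_functional_pairing[OF that]]
      by (simp add: l1_bidual_iff cscale_def)
  qed
  ultimately show ?thesis unfolding cfun.subspace_def by blast
qed

subsection \<open>The Arens product through pairings\<close>

lemma (in group) inv_translation_bij: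
  assumes "s \<in> carrier G"
  shows "bij_betw (\<lambda>t. inv s \<otimes> t) (carrier G) (carrier G)"
  by (rule bij_betw_byWitness[where f' = "\<lambda>t. s \<otimes> t"]) (use assms in \<open>auto simp: m_assoc[symmetric]\<close>)

section \<open>Convolution on the group algebra and its action on the dual\<close>

context group
begin

text \<open>Tonelli on G x G: for fixed s the substitution t -> s^-1 t does not change the norm of
  b, so summing over t first gives |a s| times that norm; interchanging the sums yields all three
  claims.\<close>

lemma l1_conv_summable:
  assumes a: "a \<in> l1_space G" and b: "b \<in> l1_space G"
  shows l1_conv_summable_left: "t \<in> carrier G \<Longrightarrow> (\<lambda>s. cmod (a s * b (inv s \<otimes> t))) summable_on carrier G"
    and l1_conv_summable_norm: 
      "(\<lambda>t. infsum (\<lambda>s. cmod (a s * b (inv s \<otimes> t))) (carrier G)) summable_on carrier G"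
    and l1_conv_infsum_norm: 
      "infsum (\<lambda>t. infsum (\<lambda>s. cmod (a s * b (inv s \<otimes> t))) (carrier G)) (carrier G)
        = l1_norm G a * l1_norm G b"
proof -
  let ?X = "carrier G"
  define h where "h s t = cmod (a s * b (inv s \<otimes> t))" for s t
  have sa: "(\<lambda>x. cmod (a x)) summable_on ?X" and sb: "(\<lambda>x. cmod (b x)) summable_on ?X"
    using a b by (auto simp: l1_space_def)
  have h_s: "h s summable_on ?X" and h_i: "infsum (h s) ?X = cmod (a s) * l1_norm G b"
    if "s \<in> ?X" for s
  proof -
    have "(\<lambda>t. cmod (b (inv s \<otimes> t))) summable_on ?X"
      using sb summable_on_reindex_bij_betw[OF inv_translation_bij[OF that], of "\<lambda>x. cmod (b x)"] by simp
    then show "h s summable_on ?X" 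
      unfolding h_def norm_mult by (rule summable_on_cmult_right)
    have "infsum (\<lambda>t. cmod (b (inv s \<otimes> t))) ?X = l1_norm G b"
      using infsum_reindex_bij_betw[OF inv_translation_bij[OF that], of "\<lambda>x. cmod (b x)"] 
      by (simp add: l1_norm_def)
    moreover have "h s = (\<lambda>t. cmod (a s) * cmod (b (inv s \<otimes> t)))"
      by (simp add: h_def norm_mult fun_eq_iff)
    ultimately show "infsum (h s) ?X = cmod (a s) * l1_norm G b"
      by (simp add: infsum_cmult_right')
  qed
  have nonneg: "\<bar>h s t\<bar> = h s t" for s t by (simp add: h_def)
  have "(\<lambda>s. cmod (a s) * l1_norm G b) summable_on ?X" by (rule summable_on_cmult_left[OF sa])
  then have "(\<lambda>s. infsum (h s) ?X) summable_on ?X" using h_i by (simp cong: summable_on_cong)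
  moreover have "\<bar>infsum (h s) ?X\<bar> = infsum (h s) ?X" for s
    by (simp add: h_def infsum_nonneg)
  ultimately have "(\<lambda>p. norm (case p of (s, t) \<Rightarrow> h s t)) summable_on (?X \<times> ?X)"
    using h_s by (subst Infinite_Sum.abs_summable_on_Sigma_iff) (simp add: nonneg)
  then have sum: "(\<lambda>(s, t). h s t) summable_on (?X \<times> ?X)"
    by (simp add: nonneg case_prod_unfold)
  then have "(\<lambda>(t, s). h s t) summable_on (?X \<times> ?X)" 
    by (subst summable_on_swap) simp
  then have "(\<lambda>p. norm (case p of (t, s) \<Rightarrow> h s t)) summable_on (?X \<times> ?X)"
    by (simp add: nonneg case_prod_unfold)
  then have "(\<forall>t\<in>?X. (\<lambda>s. h s t) summable_on ?X) \<and> (\<lambda>t. \<bar>infsum (\<lambda>s. h s t) ?X\<bar>) summable_on ?X"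
    by (subst (asm) Infinite_Sum.abs_summable_on_Sigma_iff) (simp add: nonneg)
  moreover have "\<bar>infsum (\<lambda>s. h s t) ?X\<bar> = infsum (\<lambda>s. h s t) ?X" for t
    by (simp add: h_def infsum_nonneg)
  ultimately show "t \<in> ?X \<Longrightarrow> (\<lambda>s. cmod (a s * b (inv s \<otimes> t))) summable_on ?X"
    and "(\<lambda>t. infsum (\<lambda>s. cmod (a s * b (inv s \<otimes> t))) ?X) summable_on ?X"
    by (simp_all add: h_def)
  have "infsum (\<lambda>t. infsum (\<lambda>s. h s t) ?X) ?X = infsum (\<lambda>s. infsum (h s) ?X) ?X"
    using infsum_swap_banach[OF sum] by simp
  also have "\<dots> = infsum (\<lambda>s. cmod (a s) * l1_norm G b) ?X" using h_i by (rule infsum_cong)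
  also have "\<dots> = l1_norm G a * l1_norm G b" by (simp add: infsum_cmult_left' l1_norm_def)
  finally show "infsum (\<lambda>t. infsum (\<lambda>s. cmod (a s * b (inv s \<otimes> t))) ?X) ?X 
      = l1_norm G a * l1_norm G b" by (simp add: h_def)
qed

lemma l1_conv_closed:
  assumes a: "a \<in> l1_space G" and b: "b \<in> l1_space G"
  shows l1_conv_in_l1_space: "l1_conv G a b \<in> l1_space G"
    and l1_norm_conv_le: "l1_norm G (l1_conv G a b) \<le> l1_norm G a * l1_norm G b"
proof -
  have le: "cmod (l1_conv G a b t) \<le> infsum (\<lambda>s. cmod (a s * b (inv s \<otimes> t))) (carrier G)"
    if "t \<in> carrier G" for t
    using norm_infsum_bound[OF l1_conv_summable_left[OF a b that]] that by (simp add: l1_conv_def)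
  have s: "(\<lambda>t. cmod (l1_conv G a b t)) summable_on carrier G"
    by (rule Infinite_Sum.abs_summable_on_comparison_test'[OF l1_conv_summable_norm[OF a b] le])
  then show "l1_conv G a b \<in> l1_space G" by (simp add: l1_space_def l1_conv_def)
  show "l1_norm G (l1_conv G a b) \<le> l1_norm G a * l1_norm G b"
    unfolding l1_norm_def[of G "l1_conv G a b"] l1_conv_infsum_norm[OF a b, symmetric]
    by (rule infsum_mono[OF s l1_conv_summable_norm[OF a b] le])
qed

lemma l1_conv_bilinear:
  assumes "a \<in> l1_space G" "a' \<in> l1_space G" "b \<in> l1_space G" "b' \<in> l1_space G"
  shows l1_conv_add_left: "l1_conv G (a + a') b = l1_conv G a b + l1_conv G a' b"
    and l1_conv_add_right: "l1_conv G a (b + b') = l1_conv G a b + l1_conv G a b'"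
    and l1_conv_cscale_left: "l1_conv G (cscale c a) b = cscale c (l1_conv G a b)"
    and l1_conv_cscale_right: "l1_conv G a (cscale c b) = cscale c (l1_conv G a b)"
proof -
  note sum = abs_summable_summable[OF l1_conv_summable_left]
  show "l1_conv G (a + a') b = l1_conv G a b + l1_conv G a' b"
  proof
    fix t show "l1_conv G (a + a') b t = (l1_conv G a b + l1_conv G a' b) t"
      using infsum_add[OF sum[OF assms(1,3), of t] sum[OF assms(2,3), of t]] 
      by (simp add: l1_conv_def distrib_right)
  qed
  show "l1_conv G a (b + b') = l1_conv G a b + l1_conv G a b'"
  proof
    fix t show "l1_conv G a (b + b') t = (l1_conv G a b + l1_conv G a b') t"
      using infsum_add[OF sum[OF assms(1,3), of t] sum[OF assms(1,4), of t]] 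
      by (simp add: l1_conv_def distrib_left)
  qed
  show "l1_conv G (cscale c a) b = cscale c (l1_conv G a b)"
    by (simp add: l1_conv_def cscale_def fun_eq_iff infsum_cmult_right' mult.assoc)
  show "l1_conv G a (cscale c b) = cscale c (l1_conv G a b)"
    by (simp add: l1_conv_def cscale_def fun_eq_iff infsum_cmult_right' mult.left_commute[of _ c])
qed

lemma l1_conv_point_mass:
  assumes "s \<in> carrier G" "t \<in> carrier G"
  shows "l1_conv G (point_mass s) (point_mass t) = point_mass (s \<otimes> t)"
proof
  fix u show "l1_conv G (point_mass s) (point_mass t) u = point_mass (s \<otimes> t) u"
  proof (cases "u \<in> carrier G")
    case True
    then have "inv s \<otimes> u = t \<longleftrightarrow> u = s \<otimes> t"
      using assms by (metis inv_solve_left)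
    moreover have "l1_conv G (point_mass s) (point_mass t) u = point_mass t (inv s \<otimes> u)"
      using True infsum_point_mass[OF assms(1), of "\<lambda>s. point_mass t (inv s \<otimes> u)"] 
      by (simp add: l1_conv_def)
    ultimately show ?thesis by (simp add: point_mass_def)
  next
    case False
    then show ?thesis using assms by (auto simp: l1_conv_def point_mass_def)
  qed
qed

lemma arens_right_in_dual:
  assumes F: "F \<in> dual_space (l1_space G) (l1_norm G)" and a: "a \<in> l1_space G"
  shows "arens_right (l1_space G) (l1_conv G) F a \<in> dual_space (l1_space G) (l1_norm G)"
proof -
  note D = F[unfolded dual_space_def, simplified]
  obtain K where K: "K \<ge> 0" "\<And>x. x \<in> carrier G \<Longrightarrow> cmod (F (point_mass x)) \<le> K" 
    using bounded_onE[OF bounded_on_dual[OF F]] by metis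
  have K': "cmod (F v) \<le> K * l1_norm G v" for v
    using linf_functional_bound[of K G "\<lambda>t. F (point_mass t)" v, OF K] dual_eq_linf_functional[OF F, symmetric] by simp
  have "cmod (F (l1_conv G a b)) \<le> (K * l1_norm G a) * l1_norm G b" if "b \<in> l1_space G" for b
    using order_trans[OF K' mult_left_mono[OF l1_norm_conv_le[OF a that] K(1)]] by (simp add: mult.assoc)
  moreover have "F (l1_conv G a (b + b')) = F (l1_conv G a b) + F (l1_conv G a b')"
    if "b \<in> l1_space G" "b' \<in> l1_space G" for b b'
    using D l1_conv_add_right[OF a a that] l1_conv_in_l1_space[OF a] that by metis
  moreover have "F (l1_conv G a (cscale c b)) = c * F (l1_conv G a b)"
    if "b \<in> l1_space G" for b c
    using D l1_conv_cscale_right[OF a a that that] l1_conv_in_l1_space[OF a] that by metis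
  ultimately show ?thesis
    unfolding arens_right_def dual_space_def
    by (intro CollectI conjI allI ballI impI exI[of _ "K * l1_norm G a"])
       (simp_all add: l1_space_add l1_space_cscale del: plus_fun_apply)
qed

lemma dual_norm_arens_right_le:
  assumes F: "F \<in> dual_space (l1_space G) (l1_norm G)" and a: "a \<in> l1_space G"
    and K: "K \<ge> 0" "\<And>x. x \<in> carrier G \<Longrightarrow> cmod (F (point_mass x)) \<le> K"
  shows "dual_norm (l1_space G) (l1_norm G) (arens_right (l1_space G) (l1_conv G) F a) \<le> K * l1_norm G a"
proof -
  let ?R = "arens_right (l1_space G) (l1_conv G) F a"
  have K': "cmod (F v) \<le> K * l1_norm G v" for v
    using linf_functional_bound[of K G "\<lambda>t. F (point_mass t)" v, OF K] dual_eq_linf_functional[OF F, symmetric] by simp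
  have "cmod (?R (point_mass t)) \<le> K * l1_norm G a" if "t \<in> carrier G" for t
    using order_trans[OF K' mult_left_mono[OF l1_norm_conv_le[OF a point_mass_in_l1_space[OF that]] K(1)]]
    by (simp add: arens_right_def l1_norm_point_mass[OF that] point_mass_in_l1_space[OF that])
  then have "dual_norm (l1_space G) (l1_norm G) (linf_functional G (\<lambda>t. ?R (point_mass t))) \<le> K * l1_norm G a"
    using K(1) l1_norm_nonneg[of G a] by (intro dual_norm_linf_functional_le) auto
  then show ?thesis using dual_eq_linf_functional[OF arens_right_in_dual[OF F a]] by simp
qed

lemma arens_left_in_dual:
  assumes F: "F \<in> dual_space (l1_space G) (l1_norm G)" and \<Phi>: "\<Phi> \<in> l1_bidual G"
  shows "arens_left (l1_space G) (l1_conv G) \<Phi> F \<in> dual_space (l1_space G) (l1_norm G)"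
proof -
  let ?D = "dual_space (l1_space G) (l1_norm G)" and ?R = "arens_right (l1_space G) (l1_conv G) F"
  note P = \<Phi>[unfolded l1_bidual_def bidual_space_def dual_space_def[of "dual_space _ _"], simplified]
  note D = F[unfolded dual_space_def, simplified]
  obtain C where C: "\<And>F. F \<in> ?D \<Longrightarrow> cmod (\<Phi> F) \<le> C * dual_norm (l1_space G) (l1_norm G) F" 
    using P by blast
  obtain K where K: "K \<ge> 0" "\<And>x. x \<in> carrier G \<Longrightarrow> cmod (F (point_mass x)) \<le> K" 
    using bounded_onE[OF bounded_on_dual[OF F]] by metis
  have "cmod (\<Phi> (?R a)) \<le> (max C 0 * K) * l1_norm G a" if a: "a \<in> l1_space G" for a
  proof -
    have "cmod (\<Phi> (?R a)) \<le> max C 0 * dual_norm (l1_space G) (l1_norm G) (?R a)"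
      using C[OF arens_right_in_dual[OF F a]] dual_norm_nonneg[OF arens_right_in_dual[OF F a]]
      by (meson max.cobounded1 mult_right_mono order_trans)
    also have "\<dots> \<le> max C 0 * (K * l1_norm G a)"
      by (intro mult_left_mono dual_norm_arens_right_le[OF F a K]) auto
    finally show ?thesis by (simp add: mult.assoc)
  qed
  moreover have "\<Phi> (?R (a + a')) = \<Phi> (?R a) + \<Phi> (?R a')"
    if "a \<in> l1_space G" "a' \<in> l1_space G" for a a'
  proof -
    have "?R (a + a') = ?R a + ?R a'"
    proof
      fix b show "?R (a + a') b = (?R a + ?R a') b"
        using D l1_conv_add_left[OF that, of b b] l1_conv_in_l1_space[of _ b] that
        by (simp add: arens_right_def del: plus_fun_apply) (simp add: arens_right_def)
    qed
    then show ?thesis using P arens_right_in_dual[OF F] that by metis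
  qed
  moreover have "\<Phi> (?R (cscale c a)) = c * \<Phi> (?R a)" if "a \<in> l1_space G" for a c
  proof -
    have "?R (cscale c a) = cscale c (?R a)"
    proof
      fix b show "?R (cscale c a) b = cscale c (?R a) b"
        using D l1_conv_cscale_left[OF that that, of b b] l1_conv_in_l1_space[OF that, of b]
        by (simp add: arens_right_def) (simp add: cscale_def)
    qed
    then show ?thesis using P arens_right_in_dual[OF F] that by metis
  qed
  ultimately show ?thesis
    unfolding arens_left_def dual_space_def[of "l1_space G"]
    by (intro CollectI conjI allI ballI impI exI[of _ "max C 0 * K"])
       (simp_all add: l1_space_add l1_space_cscale del: plus_fun_apply)
qed

text \<open>Convolving point masses multiplies group elements, so acting with the point mass at s
  turns the functional of f into that of t -> f (s t). Later computations go through this formula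
  and no longer through convolution.\<close>

lemma pairing_arens:
  assumes \<Phi>: "\<Phi> \<in> l1_bidual G" and f: "bounded_on (carrier G) f"
  shows "pairing G (l1_arens G \<Psi> \<Phi>) f = pairing G \<Psi> (\<lambda>s. pairing G \<Phi> (\<lambda>t. f (s \<otimes> t)))"
proof -
  let ?F = "linf_functional G f"
  let ?R = "arens_right (l1_space G) (l1_conv G) ?F" and ?L = "arens_left (l1_space G) (l1_conv G) \<Phi> ?F"
  have F: "?F \<in> dual_space (l1_space G) (l1_norm G)" by (rule linf_functional_in_dual[OF f])
  have "?L (point_mass s) = pairing G \<Phi> (\<lambda>t. f (s \<otimes> t))" if s: "s \<in> carrier G" for s
  proof -
    have "?R (point_mass s) = linf_functional G (\<lambda>t. ?R (point_mass s) (point_mass t))"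
      by (rule dual_eq_linf_functional[OF arens_right_in_dual[OF F point_mass_in_l1_space[OF s]]])
    also have "\<dots> = linf_functional G (\<lambda>t. f (s \<otimes> t))"
      using s by (intro linf_functional_cong)
         (simp add: arens_right_def point_mass_in_l1_space l1_conv_point_mass linf_functional_point_mass)
    finally show ?thesis using s by (simp add: arens_left_def point_mass_in_l1_space pairing_def)
  qed
  then have "?L = linf_functional G (\<lambda>s. pairing G \<Phi> (\<lambda>t. f (s \<otimes> t)))"
    using linf_functional_cong[of G "\<lambda>s. ?L (point_mass s)" "\<lambda>s. pairing G \<Phi> (\<lambda>t. f (s \<otimes> t))"]
      dual_eq_linf_functional[OF arens_left_in_dual[OF F \<Phi>]] by simp
  then show ?thesis using F by (simp add: pairing_def l1_arens_def arens_def)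
qed

lemma bounded_on_pairing:
  assumes "\<Phi> \<in> l1_bidual G" "bounded_on (carrier G) f" "Y \<subseteq> carrier G"
  shows "bounded_on Y (\<lambda>s. pairing G \<Phi> (\<lambda>t. f (s \<otimes> t)))"
proof -
  obtain K where K: "K \<ge> 0" "\<And>x. x \<in> carrier G \<Longrightarrow> cmod (f x) \<le> K" 
    using bounded_onE[OF assms(2)] by metis
  show ?thesis
    by (rule bdd_functional_bounded_on[OF bdd_functional_pairing[OF assms(1)] K(1)])
       (use K(2) assms(3) in auto)
qed

text \<open>The iterated pairing is a bounded functional whose bound is the product of the two
  bounds, and the Arens product is its image under \<open>bidual_of\<close>.\<close>

lemma arens_closed:
  assumes "\<Psi> \<in> l1_bidual G" "\<Phi> \<in> l1_bidual G"
  shows "l1_arens G \<Psi> \<Phi> \<in> l1_bidual G"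
proof -
  define m where "m f = pairing G \<Psi> (\<lambda>s. pairing G \<Phi> (\<lambda>t. f (s \<otimes> t)))" for f
  note b\<Phi> = bdd_functional_pairing[OF assms(2)] and b\<Psi> = bdd_functional_pairing[OF assms(1)]
  have shift: "bounded_on (carrier G) (\<lambda>t. f (s \<otimes> t))" if "bounded_on (carrier G) f" "s \<in> carrier G" for f s
    using that by (auto intro: bounded_on_compose)
  obtain C where C: "C \<ge> 0"
    "\<And>f K. K \<ge> 0 \<Longrightarrow> (\<And>x. x \<in> carrier G \<Longrightarrow> cmod (f x) \<le> K) \<Longrightarrow> cmod (pairing G \<Phi> f) \<le> C * K"
    using bdd_functional_bound[OF b\<Phi>] by metis
  obtain D where D: "D \<ge> 0"
    "\<And>f K. K \<ge> 0 \<Longrightarrow> (\<And>x. x \<in> carrier G \<Longrightarrow> cmod (f x) \<le> K) \<Longrightarrow> cmod (pairing G \<Psi> f) \<le> D * K"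
    using bdd_functional_bound[OF b\<Psi>] by metis
  have "cmod (m f) \<le> (D * C) * K" if "K \<ge> 0" "\<forall>x\<in>carrier G. cmod (f x) \<le> K" for f K
    unfolding m_def mult.assoc using that C(1) by (intro D(2) C(2)) auto
  moreover have "m (\<lambda>x. f x + g x) = m f + m g" 
    if fg: "bounded_on (carrier G) f" "bounded_on (carrier G) g" for f g
  proof -
    have "m (\<lambda>x. f x + g x) = pairing G \<Psi> (\<lambda>s. pairing G \<Phi> (\<lambda>t. f (s \<otimes> t)) + pairing G \<Phi> (\<lambda>t. g (s \<otimes> t)))"
      unfolding m_def using fg bdd_functional_add[OF b\<Phi> shift[OF fg(1)] shift[OF fg(2)]]
        bounded_on_pairing[OF assms(2) bounded_on_add[OF fg]]
      by (intro bdd_functional_cong[OF b\<Psi>]) auto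
    then show ?thesis
      using bdd_functional_add[OF b\<Psi> bounded_on_pairing[OF assms(2) fg(1)] bounded_on_pairing[OF assms(2) fg(2)]]
      by (simp add: m_def)
  qed
  moreover have "m (\<lambda>x. c * f x) = c * m f" if f: "bounded_on (carrier G) f" for c f
  proof -
    have "m (\<lambda>x. c * f x) = pairing G \<Psi> (\<lambda>s. c * pairing G \<Phi> (\<lambda>t. f (s \<otimes> t)))"
      unfolding m_def using bdd_functional_cmult[OF b\<Phi> shift[OF f]]
        bounded_on_pairing[OF assms(2) bounded_on_mult[OF bounded_on_const f]]
      by (intro bdd_functional_cong[OF b\<Psi>]) auto
    then show ?thesis
      using bdd_functional_cmult[OF b\<Psi> bounded_on_pairing[OF assms(2) f]] by (simp add: m_def)
  qed
  ultimately have m: "bdd_functional (carrier G) m"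
    unfolding bdd_functional_def using C(1) D(1)
    by (intro conjI allI impI exI[of _ "D * C"]) simp_all
  have "l1_arens G \<Psi> \<Phi> = bidual_of G m"
  proof
    fix F show "l1_arens G \<Psi> \<Phi> F = bidual_of G m F"
    proof (cases "F \<in> dual_space (l1_space G) (l1_norm G)")
      case True
      then show ?thesis
        using bidual_apply[OF True] pairing_arens[OF assms(2) bounded_on_dual[OF True]]
        by (simp add: bidual_of_def m_def)
    qed (simp add: l1_arens_def arens_def bidual_of_def)
  qed
  then show ?thesis using bidual_of_in_bidual[OF m] by simp
qed

lemma bidual_point_mass_facts:
  assumes "s \<in> carrier G"
  shows bidual_point_mass_in_bidual: "bidual_point_mass G s \<in> l1_bidual G"
    and pairing_point_mass: "bounded_on (carrier G) f \<Longrightarrow> pairing G (bidual_point_mass G s) f = f s"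
proof -
  have "bdd_functional (carrier G) (\<lambda>f. f s)"
    using assms by (auto simp: bdd_functional_def intro!: exI[of _ 1])
  moreover have "bidual_point_mass G s = bidual_of G (\<lambda>f. f s)"
    by (simp add: bidual_point_mass_def bidual_embed_def bidual_of_def fun_eq_iff)
  ultimately show "bidual_point_mass G s \<in> l1_bidual G" 
    "bounded_on (carrier G) f \<Longrightarrow> pairing G (bidual_point_mass G s) f = f s"
    using bidual_of_in_bidual pairing_bidual_of by metis+
qed

text \<open>Both sides pair with \<Psi>, \<Phi>, \<Omega> in the same order, so no interchange of
  functionals is involved; only the argument \<open>s \<otimes> t \<otimes> u\<close> is
  rebracketed.\<close>

lemma arens_assoc:
  assumes "\<Psi> \<in> l1_bidual G" "\<Phi> \<in> l1_bidual G" "\<Omega> \<in> l1_bidual G"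
  shows "l1_arens G (l1_arens G \<Psi> \<Phi>) \<Omega> = l1_arens G \<Psi> (l1_arens G \<Phi> \<Omega>)"
proof (rule bidual_eqI[of _ G])
  fix f assume f: "bounded_on (carrier G) f"
  have "pairing G (l1_arens G (l1_arens G \<Psi> \<Phi>) \<Omega>) f =
     pairing G \<Psi> (\<lambda>s. pairing G \<Phi> (\<lambda>t. pairing G \<Omega> (\<lambda>u. f (s \<otimes> t \<otimes> u))))"
    using pairing_arens[OF assms(3) f] pairing_arens[OF assms(2) bounded_on_pairing[OF assms(3) f order_refl]]
    by simp
  also have "\<dots> = pairing G \<Psi> (\<lambda>s. pairing G (l1_arens G \<Phi> \<Omega>) (\<lambda>u. f (s \<otimes> u)))"
  proof (rule sym, rule bdd_functional_cong[OF bdd_functional_pairing[OF assms(1)] 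
        bounded_on_pairing[OF arens_closed[OF assms(2,3)] f order_refl]])
    fix s assume s: "s \<in> carrier G"
    have "bounded_on (carrier G) (\<lambda>u. f (s \<otimes> u))" using s f by (auto intro: bounded_on_compose)
    note pairing_arens[OF assms(3) this, of \<Phi>]
    also have "pairing G \<Phi> (\<lambda>t. pairing G \<Omega> (\<lambda>u. f (s \<otimes> (t \<otimes> u)))) 
       = pairing G \<Phi> (\<lambda>t. pairing G \<Omega> (\<lambda>u. f (s \<otimes> t \<otimes> u)))"
    proof (rule bdd_functional_cong[OF bdd_functional_pairing[OF assms(2)]])
      show "bounded_on (carrier G) (\<lambda>t. pairing G \<Omega> (\<lambda>u. f (s \<otimes> (t \<otimes> u))))"
        by (rule bounded_on_pairing[OF assms(3) \<open>bounded_on (carrier G) (\<lambda>u. f (s \<otimes> u))\<close> order_refl])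
      fix t assume t: "t \<in> carrier G"
      show "pairing G \<Omega> (\<lambda>u. f (s \<otimes> (t \<otimes> u))) = pairing G \<Omega> (\<lambda>u. f (s \<otimes> t \<otimes> u))"
        using s t f by (intro bdd_functional_cong[OF bdd_functional_pairing[OF assms(3)]])
          (auto intro: bounded_on_compose simp: m_assoc)
    qed
    finally show "pairing G (l1_arens G \<Phi> \<Omega>) (\<lambda>u. f (s \<otimes> u)) 
       = pairing G \<Phi> (\<lambda>t. pairing G \<Omega> (\<lambda>u. f (s \<otimes> t \<otimes> u)))" .
  qed
  also have "\<dots> = pairing G (l1_arens G \<Psi> (l1_arens G \<Phi> \<Omega>)) f"
    by (rule pairing_arens[OF arens_closed[OF assms(2,3)] f, symmetric])
  finally show "pairing G (l1_arens G (l1_arens G \<Psi> \<Phi>) \<Omega>) f = pairing G (l1_arens G \<Psi> (l1_arens G \<Phi> \<Omega>)) f" .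
qed (intro arens_closed assms)+

lemma arens_add_left:
  assumes "\<Omega> \<in> l1_bidual G"
  shows "l1_arens G (\<Phi> + \<Psi>) \<Omega> = l1_arens G \<Phi> \<Omega> + l1_arens G \<Psi> \<Omega>"
  by (simp add: l1_arens_def arens_def fun_eq_iff)

lemma arens_cscale_left: "l1_arens G (cscale c \<Phi>) \<Omega> = cscale c (l1_arens G \<Phi> \<Omega>)"
  by (simp add: l1_arens_def arens_def fun_eq_iff cscale_def)

lemma arens_zero_left: "l1_arens G 0 \<Omega> = 0"
  by (simp add: l1_arens_def arens_def fun_eq_iff)

text \<open>In the left variable the product is literally evaluation of the left factor; here
  additivity of \<Omega> itself on bounded functions is what is used.\<close>

lemma arens_add_right:
  assumes "\<Omega> \<in> l1_bidual G" "\<Phi> \<in> l1_bidual G" "\<Psi> \<in> l1_bidual G"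
  shows "l1_arens G \<Omega> (\<Phi> + \<Psi>) = l1_arens G \<Omega> \<Phi> + l1_arens G \<Omega> \<Psi>"
proof (rule bidual_eqI[of _ G])
  have sum: "\<Phi> + \<Psi> \<in> l1_bidual G" using l1_bidual_subspace assms by (metis cfun.subspace_def)
  show "l1_arens G \<Omega> (\<Phi> + \<Psi>) \<in> l1_bidual G" by (rule arens_closed[OF assms(1) sum])
  show "l1_arens G \<Omega> \<Phi> + l1_arens G \<Omega> \<Psi> \<in> l1_bidual G" 
    using l1_bidual_subspace[of G] assms arens_closed by (metis cfun.subspace_def)
  fix f assume f: "bounded_on (carrier G) f"
  show "pairing G (l1_arens G \<Omega> (\<Phi> + \<Psi>)) f = pairing G (l1_arens G \<Omega> \<Phi> + l1_arens G \<Omega> \<Psi>) f"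
    using f bdd_functional_add[OF bdd_functional_pairing[OF assms(1)] bounded_on_pairing[OF assms(2) f order_refl]
       bounded_on_pairing[OF assms(3) f order_refl]]
    by (simp add: pairing_plus pairing_arens assms sum del: plus_fun_apply)
qed

lemma arens_cscale_right:
  assumes "\<Omega> \<in> l1_bidual G" "\<Phi> \<in> l1_bidual G"
  shows "l1_arens G \<Omega> (cscale c \<Phi>) = cscale c (l1_arens G \<Omega> \<Phi>)"
proof (rule bidual_eqI[of _ G])
  have sc: "cscale c \<Phi> \<in> l1_bidual G" using l1_bidual_subspace assms by (metis cfun.subspace_def)
  show "l1_arens G \<Omega> (cscale c \<Phi>) \<in> l1_bidual G" by (rule arens_closed[OF assms(1) sc])
  show "cscale c (l1_arens G \<Omega> \<Phi>) \<in> l1_bidual G" 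
    using l1_bidual_subspace[of G] assms arens_closed by (metis cfun.subspace_def)
  fix f assume f: "bounded_on (carrier G) f"
  show "pairing G (l1_arens G \<Omega> (cscale c \<Phi>)) f = pairing G (cscale c (l1_arens G \<Omega> \<Phi>)) f"
    using f bdd_functional_cmult[OF bdd_functional_pairing[OF assms(1)] bounded_on_pairing[OF assms(2) f order_refl]]
    by (simp add: pairing_cscale pairing_arens assms sc)
qed

lemma arens_zero_right:
  assumes "\<Omega> \<in> l1_bidual G" shows "l1_arens G \<Omega> 0 = 0"
proof -
  have "cscale 0 (0 :: (('a \<Rightarrow> complex) \<Rightarrow> complex) \<Rightarrow> complex) = 0" by (simp add: cscale_def fun_eq_iff)
  moreover have "0 \<in> l1_bidual G" using l1_bidual_subspace cfun.subspace_0 by blast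
  moreover have "cscale 0 (l1_arens G \<Omega> 0) = 0" by (simp add: cscale_def fun_eq_iff)
  ultimately show ?thesis using arens_cscale_right[OF assms, of 0 0] by simp
qed

abbreviation bidual_one where "bidual_one \<equiv> bidual_point_mass G \<one>"

lemma arens_one:
  assumes "\<Phi> \<in> l1_bidual G"
  shows arens_one_left: "l1_arens G bidual_one \<Phi> = \<Phi>" 
    and arens_one_right: "l1_arens G \<Phi> bidual_one = \<Phi>"
proof -
  note one = bidual_point_mass_in_bidual[OF one_closed]
  show "l1_arens G bidual_one \<Phi> = \<Phi>"
  proof (rule bidual_eqI[OF arens_closed[OF one assms] assms])
    fix f assume f: "bounded_on (carrier G) f"
    have "pairing G (l1_arens G bidual_one \<Phi>) f = pairing G \<Phi> (\<lambda>t. f (\<one> \<otimes> t))"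
      using pairing_arens[OF assms f] pairing_point_mass[OF one_closed bounded_on_pairing[OF assms f order_refl]] by simp
    also have "\<dots> = pairing G \<Phi> f"
      by (rule bdd_functional_cong[OF bdd_functional_pairing[OF assms], symmetric, OF f]) simp
    finally show "pairing G (l1_arens G bidual_one \<Phi>) f = pairing G \<Phi> f" .
  qed
  show "l1_arens G \<Phi> bidual_one = \<Phi>"
  proof (rule bidual_eqI[OF arens_closed[OF assms one] assms])
    fix f assume f: "bounded_on (carrier G) f"
    have "pairing G (l1_arens G \<Phi> bidual_one) f = pairing G \<Phi> (\<lambda>s. pairing G bidual_one (\<lambda>t. f (s \<otimes> t)))"
      by (rule pairing_arens[OF one f])
    also have "\<dots> = pairing G \<Phi> f"
    proof (rule bdd_functional_cong[OF bdd_functional_pairing[OF assms], symmetric, OF f])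
      fix s assume "s \<in> carrier G"
      then have "bounded_on (carrier G) (\<lambda>t. f (s \<otimes> t))" using f by (auto intro: bounded_on_compose)
      then show "f s = pairing G bidual_one (\<lambda>t. f (s \<otimes> t))"
        using pairing_point_mass[OF one_closed] \<open>s \<in> carrier G\<close> by simp
    qed
    finally show "pairing G (l1_arens G \<Phi> bidual_one) f = pairing G \<Phi> f" .
  qed
qed

end

section \<open>The Jacobson radical of the bidual\<close>

context group
begin

lemma l1_bidual_add: "\<Phi> \<in> l1_bidual G \<Longrightarrow> \<Psi> \<in> l1_bidual G \<Longrightarrow> \<Phi> + \<Psi> \<in> l1_bidual G"
  by (rule cfun.subspace_add[OF l1_bidual_subspace])

lemma left_ideal_sum:
  assumes I: "left_ideal (l1_bidual G) (l1_arens G) I" and J: "left_ideal (l1_bidual G) (l1_arens G) J"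
  shows "left_ideal (l1_bidual G) (l1_arens G) {u + v |u v. u \<in> I \<and> v \<in> J}"
  unfolding left_ideal_def
proof (intro conjI ballI)
  have sI: "cfun.subspace I" and sJ: "cfun.subspace J" and IA: "I \<subseteq> l1_bidual G" and JA: "J \<subseteq> l1_bidual G"
    using I J by (auto simp: left_ideal_def)
  show "{u + v |u v. u \<in> I \<and> v \<in> J} \<subseteq> l1_bidual G"
    using IA JA l1_bidual_add by (force simp del: plus_fun_apply)
  show "cfun.subspace {u + v |u v. u \<in> I \<and> v \<in> J}"
    using cfun.subspace_sums[OF sI sJ] .
  fix a x assume a: "a \<in> l1_bidual G" and "x \<in> {u + v |u v. u \<in> I \<and> v \<in> J}"
  then obtain u v where uv: "u \<in> I" "v \<in> J" and x: "x = u + v" by blast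
  have "l1_arens G a x = l1_arens G a u + l1_arens G a v"
    unfolding x using IA JA uv by (intro arens_add_right a) auto
  moreover have "l1_arens G a u \<in> I" "l1_arens G a v \<in> J" 
    using I J uv a by (auto simp: left_ideal_def)
  ultimately show "l1_arens G a x \<in> {u + v |u v. u \<in> I \<and> v \<in> J}" by blast
qed

lemma left_ideal_principal:
  assumes x: "x \<in> l1_bidual G"
  shows "left_ideal (l1_bidual G) (l1_arens G) {l1_arens G a x |a. a \<in> l1_bidual G}"
  unfolding left_ideal_def cfun.subspace_def
proof (intro conjI ballI allI)
  let ?I = "{l1_arens G a x |a. a \<in> l1_bidual G}"
  show "?I \<subseteq> l1_bidual G" using arens_closed x by blast
  show "0 \<in> ?I" using arens_zero_left[of x] cfun.subspace_0[OF l1_bidual_subspace] by (metis (mono_tags, lifting) mem_Collect_eq)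
  show "u + v \<in> ?I" if "u \<in> ?I" "v \<in> ?I" for u v
    using that arens_add_left[OF x] l1_bidual_add by (smt (verit, best) mem_Collect_eq)
  show "cscale c u \<in> ?I" if "u \<in> ?I" for c u
    using that arens_cscale_left[of c _ x] cfun.subspace_scale[OF l1_bidual_subspace] 
    by (smt (verit, best) mem_Collect_eq)
  fix a u assume "a \<in> l1_bidual G" "u \<in> ?I"
  then show "l1_arens G a u \<in> ?I"
    using arens_assoc[of a _ x] arens_closed[of a] x by (smt (verit, best) mem_Collect_eq)
qed

lemma one_notin_maximal_left_ideal:
  assumes "maximal_left_ideal (l1_bidual G) (l1_arens G) M"
  shows "bidual_one \<notin> M"
proof
  assume "bidual_one \<in> M"
  then have "l1_bidual G \<subseteq> M" 
    using assms arens_one_right unfolding maximal_left_ideal_def left_ideal_def by (metis subsetI)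
  then show False using assms unfolding maximal_left_ideal_def left_ideal_def by blast
qed

text \<open>I + M is a left ideal properly containing M, hence everything, and so contains the
  identity.\<close>

lemma maximal_left_ideal_comaximal:
  assumes M: "maximal_left_ideal (l1_bidual G) (l1_arens G) M"
    and I: "left_ideal (l1_bidual G) (l1_arens G) I" and "\<not> I \<subseteq> M"
  obtains u m where "u \<in> I" "m \<in> M" "u + m = bidual_one"
proof -
  let ?S = "{u + v |u v. u \<in> I \<and> v \<in> M}"
  have LM: "left_ideal (l1_bidual G) (l1_arens G) M" using M by (simp add: maximal_left_ideal_def)
  have z: "0 \<in> M" "0 \<in> I" using LM I by (auto simp: left_ideal_def cfun.subspace_0)
  have "v \<in> ?S" if "v \<in> M" for v
    using that z by (intro CollectI exI[of _ 0] exI[of _ v]) simp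
  moreover have "u \<in> ?S" if "u \<in> I" for u
    using that z by (intro CollectI exI[of _ u] exI[of _ 0]) simp
  ultimately have "?S = l1_bidual G"
    using M left_ideal_sum[OF I LM] assms(3) unfolding maximal_left_ideal_def by (smt (verit) subsetI)
  then have "bidual_one \<in> ?S" using bidual_point_mass_in_bidual[OF one_closed] by simp
  then obtain u m where "u \<in> I" "m \<in> M" "bidual_one = u + m" 
    by (auto simp del: plus_fun_apply)
  then show ?thesis using that[of u m] by simp
qed

text \<open>If 1 = u + m with u in I and m in M, then u^k = u^(k+1) + u^k m, so u^(k+1) in M gives
  u^k in M; from u^n = 0 one descends to 1 in M.\<close>

lemma nilpotent_left_ideal_subset_maximal:
  assumes I: "left_ideal (l1_bidual G) (l1_arens G) I" and nil: "nilpotent_ideal (l1_arens G) I"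
    and M: "maximal_left_ideal (l1_bidual G) (l1_arens G) M"
  shows "I \<subseteq> M"
proof (rule ccontr)
  assume "\<not> I \<subseteq> M"
  then obtain u m where u: "u \<in> I" and m: "m \<in> M" and um: "u + m = bidual_one"
    using maximal_left_ideal_comaximal[OF M I] by metis
  have LM: "left_ideal (l1_bidual G) (l1_arens G) M" using M by (simp add: maximal_left_ideal_def)
  have uA: "u \<in> l1_bidual G" and mA: "m \<in> l1_bidual G" using u m I LM by (auto simp: left_ideal_def)
  obtain n where n: "power_vanishes (l1_arens G) I n" using nil by (auto simp: nilpotent_ideal_def)
  define p where "p k = ((\<lambda>y. l1_arens G y u) ^^ k) bidual_one" for k
  have p_Suc: "p (Suc k) = l1_arens G (p k) u" for k by (simp add: p_def)
  have pA: "p k \<in> l1_bidual G" for k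
    by (induction k) (simp_all add: p_def bidual_point_mass_in_bidual arens_closed uA)
  \<comment> \<open>\<open>p\<close> starts at the identity, \<open>nfold_product\<close> at
    exponent 1; the two meet at \<open>p 1 = u\<close>.\<close>
  have nf: "nfold_product (l1_arens G) I (Suc k) (p (Suc k))" for k
  proof (induction k)
    case 0
    have "p (Suc 0) = u" using arens_one_left[OF uA] by (simp add: p_def)
    then show ?case using nfold_product.one[OF u, of "l1_arens G"] by simp
  next
    case (Suc k)
    then show ?case using nfold_product.mult[OF Suc u] p_Suc[of "Suc k"] by simp
  qed
  have down: "p k \<in> M" if "p (Suc k) \<in> M" for k
  proof -
    have "p k = l1_arens G (p k) (u + m)" using um arens_one_right[OF pA] by simp
    also have "\<dots> = p (Suc k) + l1_arens G (p k) m"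
      by (simp only: arens_add_right[OF pA uA mA] p_Suc)
    finally show ?thesis
      using that m pA LM cfun.subspace_add unfolding left_ideal_def by metis
  qed
  obtain j where j: "n = Suc j" using n by (auto simp: power_vanishes_def dest: Suc_le_D)
  then have "p n = 0" using n nf[of j] by (auto simp: power_vanishes_def)
  then have "p n \<in> M" using LM cfun.subspace_0 by (auto simp: left_ideal_def)
  then have "p 0 \<in> M" by (induction n) (use down in auto)
  then show False using one_notin_maximal_left_ideal[OF M] by (simp add: p_def)
qed

lemma nilpotent_left_ideal_subset_radical:
  assumes "left_ideal (l1_bidual G) (l1_arens G) I" "nilpotent_ideal (l1_arens G) I"
  shows "I \<subseteq> jacobson_radical (l1_bidual G) (l1_arens G)"
  using nilpotent_left_ideal_subset_maximal[OF assms] assms(1)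
  by (auto simp: jacobson_radical_def left_ideal_def)

lemma radical_subspace: "cfun.subspace (jacobson_radical (l1_bidual G) (l1_arens G))"
  using l1_bidual_subspace[of G]
  by (auto simp: jacobson_radical_def cfun.subspace_def maximal_left_ideal_def left_ideal_def
      simp del: plus_fun_apply)

text \<open>The Neumann series \<open>S = \<Sum>v\<^sup>n\<close>, summed pointwise: \<open>\<langle>v\<^sup>n, f\<rangle>\<close> is the value at \<open>\<one>\<close> of the
  \<open>n\<close>-th iterate of \<open>f \<mapsto> v \<cdot> f\<close>.\<close>

lemma neumann_series:
  assumes v: "v \<in> l1_bidual G"
    and bound: "\<And>f K. K \<ge> 0 \<Longrightarrow> (\<And>x. x \<in> carrier G \<Longrightarrow> cmod (f x) \<le> K) \<Longrightarrow> cmod (pairing G v f) \<le> K / 2"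
  obtains S where "S \<in> l1_bidual G" "S = l1_arens G S v + bidual_one"
proof -
  define T where "T f = (\<lambda>s. pairing G v (\<lambda>t. f (s \<otimes> t)))" for f
  note bv = bdd_functional_pairing[OF v]
  have shift: "bounded_on (carrier G) (\<lambda>t. f (s \<otimes> t))" if "bounded_on (carrier G) f" "s \<in> carrier G" for f s
    using that by (auto intro: bounded_on_compose)
  have T_cong: "T f s = T g s" 
    if "bounded_on (carrier G) f" "\<And>x. x \<in> carrier G \<Longrightarrow> f x = g x" "s \<in> carrier G" for f g s
    unfolding T_def using that by (intro bdd_functional_cong[OF bv shift]) auto
  have bT: "bounded_on (carrier G) (T f)" if "bounded_on (carrier G) f" for f
    unfolding T_def by (rule bounded_on_pairing[OF v that order_refl])
  have bTn: "bounded_on (carrier G) ((T ^^ n) f)" if "bounded_on (carrier G) f" for f n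
    by (induction n) (use that bT in auto)
  have add: "(T ^^ n) (\<lambda>x. f x + g x) s = (T ^^ n) f s + (T ^^ n) g s"
    if "bounded_on (carrier G) f" "bounded_on (carrier G) g" "s \<in> carrier G" for f g n s
    using that(3)
  proof (induction n arbitrary: s)
    case (Suc n)
    have "(T ^^ Suc n) (\<lambda>x. f x + g x) s = T (\<lambda>x. (T ^^ n) f x + (T ^^ n) g x) s"
      using that bTn[OF bounded_on_add[OF that(1,2)], of n] Suc by (auto intro!: T_cong)
    also have "\<dots> = (T ^^ Suc n) f s + (T ^^ Suc n) g s"
      using bdd_functional_add[OF bv shift[OF bTn[OF that(1)] Suc(2), of n] shift[OF bTn[OF that(2)] Suc(2), of n]] 
      by (simp add: T_def)
    finally show ?case .
  qed simp
  have scale: "(T ^^ n) (\<lambda>x. c * f x) s = c * (T ^^ n) f s"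
    if "bounded_on (carrier G) f" "s \<in> carrier G" for f c n s
    using that(2)
  proof (induction n arbitrary: s)
    case (Suc n)
    have "(T ^^ Suc n) (\<lambda>x. c * f x) s = T (\<lambda>x. c * (T ^^ n) f x) s"
      using that bTn[OF bounded_on_mult[OF bounded_on_const that(1)], of n c] Suc by (auto intro!: T_cong)
    also have "\<dots> = c * (T ^^ Suc n) f s"
      using bdd_functional_cmult[OF bv shift[OF bTn[OF that(1)] Suc(2), of n]]
      by (simp add: T_def)
    finally show ?case .
  qed simp
  have est: "cmod ((T ^^ n) f s) \<le> K * (1 / 2) ^ n"
    if "K \<ge> 0" "\<And>x. x \<in> carrier G \<Longrightarrow> cmod (f x) \<le> K" "s \<in> carrier G" for f K n s
    using that(3)
  proof (induction n arbitrary: s)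
    case (Suc n)
    have "cmod (T ((T ^^ n) f) s) \<le> (K * (1 / 2) ^ n) / 2"
      unfolding T_def[of "(T ^^ n) f"] using that(1) Suc by (intro bound) auto
    then show ?case by simp
  qed (use that in simp)
  define S where "S f = (\<Sum>n. (T ^^ n) f \<one>)" for f
  have summ: "summable (\<lambda>n. (T ^^ n) f \<one>)" if f: "bounded_on (carrier G) f" for f
  proof -
    obtain K where K: "K \<ge> 0" "\<And>x. x \<in> carrier G \<Longrightarrow> cmod (f x) \<le> K" 
      using bounded_onE[OF f] by metis
    have "summable (\<lambda>n. K * (1 / 2) ^ n)" by (intro summable_mult summable_geometric) simp
    then show ?thesis by (rule summable_comparison_test') (rule est[OF K one_closed])
  qed
  have "cmod (S f) \<le> 2 * K" if K: "K \<ge> 0" "\<forall>x\<in>carrier G. cmod (f x) \<le> K" for f K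
  proof -
    have g: "(\<lambda>n. K * (1 / 2) ^ n) sums (K * 2)"
      using sums_mult[OF geometric_sums[of "1/2::real"], of K] by simp
    have "cmod (S f) \<le> (\<Sum>n. K * (1 / 2) ^ n)"
      unfolding S_def using K est by (intro norm_suminf_le sums_summable[OF g]) auto
    then show ?thesis using sums_unique[OF g] by simp
  qed
  moreover have "S (\<lambda>x. f x + g x) = S f + S g"
    if "bounded_on (carrier G) f" "bounded_on (carrier G) g" for f g
    using suminf_add[OF summ[OF that(1)] summ[OF that(2)]] that by (simp add: S_def add)
  moreover have "S (\<lambda>x. c * f x) = c * S f" if "bounded_on (carrier G) f" for c f
    using suminf_mult[OF summ[OF that], of c] that by (simp add: S_def scale)
  ultimately have bS: "bdd_functional (carrier G) S"
    unfolding bdd_functional_def by (intro conjI allI impI exI[of _ 2]) auto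
  have SA: "bidual_of G S \<in> l1_bidual G" by (rule bidual_of_in_bidual[OF bS])
  have "bidual_of G S = l1_arens G (bidual_of G S) v + bidual_one"
  proof (rule bidual_eqI[OF SA l1_bidual_add[OF arens_closed[OF SA v] bidual_point_mass_in_bidual[OF one_closed]]])
    fix f assume f: "bounded_on (carrier G) f"
    \<comment> \<open>Pairing \<open>S v\<close> with f applies the series to \<open>T f\<close>,
      which merely drops the term n = 0, namely \<open>f \<one>\<close>; this is S = S v +
      1.\<close>
    have "(T ^^ n) (T f) = (T ^^ Suc n) f" for n by (simp add: funpow_swap1)
    then have "S (T f) = (\<Sum>n. (T ^^ Suc n) f \<one>)" by (simp only: S_def)
    also have "\<dots> = S f - f \<one>"
      using suminf_split_head[OF summ[OF f]] by (simp add: S_def)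
    finally have "S f = S (T f) + f \<one>" by simp
    then show "pairing G (bidual_of G S) f = pairing G (l1_arens G (bidual_of G S) v + bidual_one) f"
      using pairing_bidual_of[OF bS f] pairing_bidual_of[OF bS bT[OF f]] pairing_arens[OF v f]
         pairing_point_mass[OF one_closed f]
      by (simp add: pairing_plus T_def)
  qed
  then show ?thesis using that SA by blast
qed

text \<open>The hypothesis is norm approximation read through pairings. If x is outside M, then 1 =
  a x + m with m in M; replacing x by a nearby y of the radical gives 1 = v + w with w in M and v =
  a (x - y) of norm at most 1/2. The Neumann series is a left inverse of 1 - v = w and puts 1 into
  M.\<close>

lemma radical_closed:
  assumes x: "x \<in> l1_bidual G"
    and approx: "\<And>e. e > 0 \<Longrightarrow> \<exists>y \<in> jacobson_radical (l1_bidual G) (l1_arens G).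
       \<forall>f K. K \<ge> 0 \<longrightarrow> (\<forall>t\<in>carrier G. cmod (f t) \<le> K) \<longrightarrow> cmod (pairing G (x - y) f) \<le> e * K"
  shows "x \<in> jacobson_radical (l1_bidual G) (l1_arens G)"
proof -
  have "x \<in> M" if M: "maximal_left_ideal (l1_bidual G) (l1_arens G) M" for M
  proof (rule ccontr)
    assume "x \<notin> M"
    have "x \<in> {l1_arens G a x |a. a \<in> l1_bidual G}" 
      using arens_one_left[OF x] bidual_point_mass_in_bidual[OF one_closed] by force
    then obtain u m where "u \<in> {l1_arens G a x |a. a \<in> l1_bidual G}" and m: "m \<in> M" and um: "u + m = bidual_one"
      using maximal_left_ideal_comaximal[OF M left_ideal_principal[OF x]] \<open>x \<notin> M\<close> by blast
    then obtain a where a: "a \<in> l1_bidual G" and u: "u = l1_arens G a x" by blast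
    obtain C where C: "C \<ge> 0"
      "\<And>f K. K \<ge> 0 \<Longrightarrow> (\<And>x. x \<in> carrier G \<Longrightarrow> cmod (f x) \<le> K) \<Longrightarrow> cmod (pairing G a f) \<le> C * K"
      using bdd_functional_bound[OF bdd_functional_pairing[OF a]] by metis
    \<comment> \<open>With C a bound for a, this distance gives a (x - y) the bound C / (2 (C + 1))
      \<le> 1/2; the + 1 covers C = 0.\<close>
    have "1 / (2 * (C + 1)) > 0" using C(1) by simp
    from approx[OF this] obtain y where y: "y \<in> jacobson_radical (l1_bidual G) (l1_arens G)"
      and e: "\<And>f K. K \<ge> 0 \<Longrightarrow> (\<And>t. t \<in> carrier G \<Longrightarrow> cmod (f t) \<le> K) \<Longrightarrow> 
         cmod (pairing G (x - y) f) \<le> 1 / (2 * (C + 1)) * K" by metis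
    have yA: "y \<in> l1_bidual G" and yM: "y \<in> M" using y M by (auto simp: jacobson_radical_def)
    have zA: "x - y \<in> l1_bidual G" by (rule cfun.subspace_diff[OF l1_bidual_subspace x yA])
    define v where "v = l1_arens G a (x - y)"
    have vA: "v \<in> l1_bidual G" unfolding v_def by (rule arens_closed[OF a zA])
    have LM: "left_ideal (l1_bidual G) (l1_arens G) M" using M by (simp add: maximal_left_ideal_def)
    have bv: "cmod (pairing G v f) \<le> K / 2" if "K \<ge> 0" "\<And>x. x \<in> carrier G \<Longrightarrow> cmod (f x) \<le> K" for f K
    proof -
      have "cmod (pairing G v f) = cmod (pairing G a (\<lambda>s. pairing G (x - y) (\<lambda>t. f (s \<otimes> t))))"
        unfolding v_def using that(2) by (subst pairing_arens[OF zA]) (auto intro: bounded_onI)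
      also have "\<dots> \<le> C * (1 / (2 * (C + 1)) * K)"
        using that C(1) by (intro C(2) e) auto
      also have "\<dots> = (C / (C + 1)) * (K / 2)" using C(1) by (simp add: field_simps)
      also have "\<dots> \<le> 1 * (K / 2)" using C(1) that(1) by (intro mult_right_mono) auto
      finally show ?thesis by simp
    qed
    obtain S where S: "S \<in> l1_bidual G" "S = l1_arens G S v + bidual_one"
      by (rule neumann_series[OF vA bv])
    define w where "w = l1_arens G a y + m"
    have ayM: "l1_arens G a y \<in> M" using LM a yM by (simp add: left_ideal_def)
    have wM: "w \<in> M" unfolding w_def 
      using LM ayM m cfun.subspace_add unfolding left_ideal_def by metis
    have wA: "w \<in> l1_bidual G" using wM LM by (auto simp: left_ideal_def)
    have "l1_arens G a x = l1_arens G a y + v"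
      unfolding v_def using arens_add_right[OF a yA zA] by (simp del: plus_fun_apply)
    then have one: "bidual_one = v + w" using um u by (simp add: w_def add_ac)
    \<comment> \<open>S = S v + S w and S = S v + 1 together give S w = 1.\<close>
    have "S = l1_arens G S (v + w)" using arens_one_right[OF S(1)] one by simp
    also have "\<dots> = l1_arens G S v + l1_arens G S w" by (rule arens_add_right[OF S(1) vA wA])
    finally have "bidual_one = l1_arens G S w" using S(2) by (metis add_left_cancel)
    then have "bidual_one \<in> M" using LM S(1) wM by (simp add: left_ideal_def)
    then show False using one_notin_maximal_left_ideal[OF M] by simp
  qed
  then show ?thesis using x by (simp add: jacobson_radical_def)
qed

end

section \<open>Invariant differences and nilpotent left ideals\<close>

lemma bdd_functional_mono:
  assumes "bdd_functional Y m" "Y \<subseteq> X"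
  shows "bdd_functional X m"
  using assms bounded_on_subset[OF _ assms(2)] unfolding bdd_functional_def
  by (meson subset_iff)

text \<open>The inner adjoint restricts a bounded function to H, since for an element of \<ell>1
  supported on H the pairing sums over H and over G agree. Identifying the biduals thus amounts to
  evaluating \<Gamma> on f unchanged, whose values off H do not count.\<close>

lemma l1_bidual_incl_props:
  assumes H: "H \<subseteq> carrier G" and \<Gamma>: "\<Gamma> \<in> l1_bidual (G\<lparr>carrier := H\<rparr>)"
  shows l1_bidual_incl_closed: "l1_bidual_incl G H \<Gamma> \<in> l1_bidual G"
    and pairing_incl: "bounded_on (carrier G) f \<Longrightarrow>
      pairing G (l1_bidual_incl G H \<Gamma>) f = pairing (G\<lparr>carrier := H\<rparr>) \<Gamma> f"
proof -
  let ?H = "G\<lparr>carrier := H\<rparr>"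
  have m: "bdd_functional (carrier G) (pairing ?H \<Gamma>)"
    using bdd_functional_mono[OF bdd_functional_pairing[OF \<Gamma>]] H by simp
  have restrict: "banach_adjoint (l1_space ?H) (\<lambda>f. f) (linf_functional G f) = linf_functional ?H f"
    for f
  proof
    fix v show "banach_adjoint (l1_space ?H) (\<lambda>f. f) (linf_functional G f) v = linf_functional ?H f v"
    proof (cases "v \<in> l1_space ?H")
      case True
      then have v: "\<And>x. x \<notin> H \<Longrightarrow> v x = 0" by (simp add: l1_space_def)
      have "(\<lambda>x. cmod (v x)) summable_on carrier G"
        using True H v summable_on_cong_neutral[of "carrier G" H "\<lambda>x. cmod (v x)" "\<lambda>x. cmod (v x)"]
        by (auto simp: l1_space_def)
      then have "v \<in> l1_space G" using H v by (auto simp: l1_space_def)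
      moreover have "infsum (\<lambda>t. v t * f t) (carrier G) = infsum (\<lambda>t. v t * f t) H"
        using H v by (intro infsum_cong_neutral) auto
      ultimately show ?thesis using True by (simp add: banach_adjoint_def linf_functional_def)
    qed (simp add: banach_adjoint_def linf_functional_def)
  qed
  have eq: "l1_bidual_incl G H \<Gamma> = bidual_of G (pairing ?H \<Gamma>)"
  proof
    fix F show "l1_bidual_incl G H \<Gamma> F = bidual_of G (pairing ?H \<Gamma>) F"
    proof (cases "F \<in> dual_space (l1_space G) (l1_norm G)")
      case True
      then have "banach_adjoint (l1_space ?H) (\<lambda>f. f) F = linf_functional ?H (\<lambda>t. F (point_mass t))"
        using restrict dual_eq_linf_functional[OF True] by metis
      then show ?thesis using True
        by (simp add: l1_bidual_incl_def banach_adjoint_def[of "dual_space _ _"] bidual_of_def pairing_def)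
    qed (simp add: l1_bidual_incl_def banach_adjoint_def[of "dual_space _ _"] bidual_of_def)
  qed
  show "l1_bidual_incl G H \<Gamma> \<in> l1_bidual G" unfolding eq by (rule bidual_of_in_bidual[OF m])
  show "bounded_on (carrier G) f \<Longrightarrow> pairing G (l1_bidual_incl G H \<Gamma>) f = pairing ?H \<Gamma> f"
    unfolding eq by (rule pairing_bidual_of[OF m])
qed

lemma (in group) pairing_translate:
  assumes "s \<in> carrier G" "\<Phi> \<in> l1_bidual G" "bounded_on (carrier G) f"
  shows "pairing G (l1_arens G (bidual_point_mass G s) \<Phi>) f = pairing G \<Phi> (\<lambda>t. f (s \<otimes> t))"
  using pairing_arens[OF assms(2,3)] pairing_point_mass[OF assms(1) bounded_on_pairing[OF assms(2,3) order_refl]]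
  by simp

lemma (in group) translation_invariant_iff:
  assumes "\<Phi> \<in> l1_bidual G" "s \<in> carrier G"
  shows "l1_arens G (bidual_point_mass G s) \<Phi> = \<Phi> \<longleftrightarrow>
    (\<forall>f. bounded_on (carrier G) f \<longrightarrow> pairing G \<Phi> (\<lambda>t. f (s \<otimes> t)) = pairing G \<Phi> f)"
  using pairing_translate[OF assms(2,1)] 
    bidual_eqI[OF arens_closed[OF bidual_point_mass_in_bidual[OF assms(2)] assms(1)] assms(1)]
  by metis

lemma (in group) invariant_differences_subgroup_iff:
  assumes "subgroup H G"
  shows "\<Gamma> \<in> invariant_differences (G\<lparr>carrier := H\<rparr>) \<longleftrightarrow> \<Gamma> \<in> l1_bidual (G\<lparr>carrier := H\<rparr>) \<and>
    (\<forall>s\<in>H. \<forall>f. bounded_on H f \<longrightarrow>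
      pairing (G\<lparr>carrier := H\<rparr>) \<Gamma> (\<lambda>t. f (s \<otimes> t)) = pairing (G\<lparr>carrier := H\<rparr>) \<Gamma> f) \<and>
    pairing (G\<lparr>carrier := H\<rparr>) \<Gamma> (\<lambda>_. 1) = 0"
proof -
  interpret H: group "G\<lparr>carrier := H\<rparr>" by (rule subgroup.subgroup_is_group[OF assms is_group])
  show ?thesis
    using H.translation_invariant_iff unfolding invariant_differences_def 
    by (auto simp: pairing_def)
qed

section \<open>Left invariance and the left ideal generated by invariant differences\<close>

definition (in group) left_invariant where
  "left_invariant S \<Omega> \<longleftrightarrow> 
     (\<forall>s\<in>S. \<forall>f. bounded_on (carrier G) f \<longrightarrow> pairing G \<Omega> (\<lambda>t. f (s \<otimes> t)) = pairing G \<Omega> f)"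

lemma (in group) left_invariantD:
  "left_invariant S \<Omega> \<Longrightarrow> s \<in> S \<Longrightarrow> bounded_on (carrier G) f \<Longrightarrow>
    pairing G \<Omega> (\<lambda>t. f (s \<otimes> t)) = pairing G \<Omega> f"
  by (simp add: left_invariant_def)

text \<open>Same shape as \<open>J_sn\<close>, with \<open>fam\<close> in place of the subnormal
  subgroups, so that inclusion in \<open>J_sn\<close> is monotonicity of spans.\<close>

definition (in group) difference_ideal where
  "difference_ideal fam = cfun.span {l1_arens G \<Phi> (l1_bidual_incl G N \<Gamma>) |\<Phi> \<Gamma> N.
     \<Phi> \<in> l1_bidual G \<and> N \<in> fam \<and> \<Gamma> \<in> invariant_differences (G\<lparr>carrier := N\<rparr>)}"

context group
begin

text \<open>Reduces claims about products of two spans to generators. The right variable is treated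
  first, with the left one still in X, because linearity on the right needs the left factor in the
  bidual.\<close>

lemma arens_span:
  assumes X: "X \<subseteq> l1_bidual G" and W: "W \<subseteq> l1_bidual G" and V: "cfun.subspace V"
    and XW: "\<And>x w. x \<in> X \<Longrightarrow> w \<in> W \<Longrightarrow> l1_arens G x w \<in> V"
    and x: "x \<in> cfun.span X" and w: "w \<in> cfun.span W"
  shows "l1_arens G x w \<in> V"
proof -
  have XA: "cfun.span X \<subseteq> l1_bidual G" using cfun.span_minimal[OF X l1_bidual_subspace] .
  have 1: "cfun.subspace {w \<in> l1_bidual G. l1_arens G x w \<in> V}" if "x \<in> l1_bidual G" for x
    unfolding cfun.subspace_def
    using that V cfun.subspace_0[OF l1_bidual_subspace] cfun.subspace_scale[OF l1_bidual_subspace]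
    by (auto simp: arens_zero_right arens_add_right arens_cscale_right l1_bidual_add cfun.subspace_def
         simp del: plus_fun_apply)
  have "w \<in> {w \<in> l1_bidual G. l1_arens G x w \<in> V}" if "x \<in> X" "w \<in> cfun.span W" for x w
    using cfun.span_minimal[OF _ 1[of x], of W] that X W XW by blast
  then have XW': "l1_arens G x w \<in> V" if "x \<in> X" for x using that w by blast
  have wA: "w \<in> l1_bidual G" using cfun.span_minimal[OF W l1_bidual_subspace] w by blast
  have "cfun.subspace {x. l1_arens G x w \<in> V}"
    unfolding cfun.subspace_def using V
    by (auto simp: arens_zero_left arens_add_left[OF wA] arens_cscale_left cfun.subspace_def
         simp del: plus_fun_apply)
  then have "cfun.span X \<subseteq> {x. l1_arens G x w \<in> V}"
    using XW' by (intro cfun.span_minimal) auto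
  then show ?thesis using x by blast
qed

lemma incl_invariant_difference_closed:
  assumes "subgroup N G" "\<Gamma> \<in> invariant_differences (G\<lparr>carrier := N\<rparr>)"
  shows "l1_bidual_incl G N \<Gamma> \<in> l1_bidual G"
  using assms by (intro l1_bidual_incl_closed subgroup.subset) (auto simp: invariant_differences_def)

lemma difference_ideal_subset:
  assumes "\<And>N. N \<in> fam \<Longrightarrow> subgroup N G"
  shows "difference_ideal fam \<subseteq> l1_bidual G"
  unfolding difference_ideal_def
  using assms by (intro cfun.span_minimal l1_bidual_subspace) 
    (auto intro: arens_closed incl_invariant_difference_closed)

lemma incl_in_difference_ideal:
  assumes "\<And>N. N \<in> fam \<Longrightarrow> subgroup N G" "N \<in> fam" "\<Gamma> \<in> invariant_differences (G\<lparr>carrier := N\<rparr>)"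
  shows "l1_bidual_incl G N \<Gamma> \<in> difference_ideal fam"
proof -
  have "l1_bidual_incl G N \<Gamma> = l1_arens G bidual_one (l1_bidual_incl G N \<Gamma>)"
    using assms by (intro arens_one_left[symmetric] incl_invariant_difference_closed) auto
  then show ?thesis
    unfolding difference_ideal_def using assms(2,3) bidual_point_mass_in_bidual[OF one_closed]
    by (intro cfun.span_base) blast
qed

lemma left_ideal_difference_ideal:
  assumes sub: "\<And>N. N \<in> fam \<Longrightarrow> subgroup N G"
  shows "left_ideal (l1_bidual G) (l1_arens G) (difference_ideal fam)"
  unfolding left_ideal_def
proof (intro conjI ballI)
  show "difference_ideal fam \<subseteq> l1_bidual G" by (rule difference_ideal_subset[OF sub])
  show "cfun.subspace (difference_ideal fam)"
    unfolding difference_ideal_def by (rule cfun.subspace_span)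
  fix a x assume a: "a \<in> l1_bidual G" and x: "x \<in> difference_ideal fam"
  show "l1_arens G a x \<in> difference_ideal fam"
  proof (rule arens_span[OF order_refl _ _ _ cfun.span_base[OF a] x[unfolded difference_ideal_def]])
    show "cfun.subspace (difference_ideal fam)"
      unfolding difference_ideal_def by (rule cfun.subspace_span)
    let ?W = "{l1_arens G \<Phi> (l1_bidual_incl G N \<Gamma>) |\<Phi> \<Gamma> N.
       \<Phi> \<in> l1_bidual G \<and> N \<in> fam \<and> \<Gamma> \<in> invariant_differences (G\<lparr>carrier := N\<rparr>)}"
    show "?W \<subseteq> l1_bidual G" using sub by (auto intro: arens_closed incl_invariant_difference_closed)
    fix b w assume b: "b \<in> l1_bidual G" and "w \<in> ?W"
    then obtain \<Phi> \<Gamma> N where N: "N \<in> fam" and \<Gamma>: "\<Gamma> \<in> invariant_differences (G\<lparr>carrier := N\<rparr>)"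
      and \<Phi>: "\<Phi> \<in> l1_bidual G" and w: "w = l1_arens G \<Phi> (l1_bidual_incl G N \<Gamma>)" by blast
    have "l1_arens G b w = l1_arens G (l1_arens G b \<Phi>) (l1_bidual_incl G N \<Gamma>)"
      unfolding w using sub N \<Gamma> b \<Phi> by (intro arens_assoc[symmetric] incl_invariant_difference_closed) auto
    then show "l1_arens G b w \<in> difference_ideal fam"
      unfolding difference_ideal_def using N \<Gamma> arens_closed[OF b \<Phi>] by (intro cfun.span_base) blast
  qed
qed

lemma J_sn_subset: "J_sn G \<subseteq> l1_bidual G"
proof -
  have "subgroup H G" if "subnormal G H" for H
    using that
  proof induction
    case top show ?case by (rule subgroup_self)
  next
    case (step K H)
    then show ?case using incl_subgroup[OF step.IH] normal_imp_subgroup by blast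
  qed
  then show ?thesis
    unfolding J_sn_def by (intro cfun.span_minimal l1_bidual_subspace)
      (auto intro: arens_closed incl_invariant_difference_closed)
qed

lemma difference_ideal_subset_J_sn:
  assumes "\<And>N. N \<in> fam \<Longrightarrow> subnormal G N"
  shows "difference_ideal fam \<subseteq> J_sn G"
  unfolding difference_ideal_def J_sn_def using assms by (intro cfun.span_mono) blast

end

text \<open>\<open>fam\<close> stands for the set of factors of one H_i. By
  \<open>fam_normal\<close> and \<open>fam_conj\<close>, t -> t^-1 N t is constant on each coset of
  H and its value is again a factor; \<open>fam_commute\<close> lets a product with an invariant
  difference keep the other invariances of its right factor.\<close>

locale conjugation_family = group G for G (structure) +
  fixes H :: "'a set" and fam :: "'a set set"
  assumes normal: "H \<lhd> G" and finite_index: "finite (rcosets H)"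
    and finite_fam: "finite fam"
    and fam_subgroup: "\<And>N. N \<in> fam \<Longrightarrow> subgroup N G"
    and fam_normal: "\<And>N h n. N \<in> fam \<Longrightarrow> h \<in> H \<Longrightarrow> n \<in> N \<Longrightarrow> inv h \<otimes> n \<otimes> h \<in> N"
    and fam_conj: "\<And>N g. N \<in> fam \<Longrightarrow> g \<in> carrier G \<Longrightarrow> conjugate_set G g N \<in> fam"
    and fam_commute: "\<And>N N' n n'. N \<in> fam \<Longrightarrow> N' \<in> fam \<Longrightarrow> N \<noteq> N' \<Longrightarrow> n \<in> N \<Longrightarrow> n' \<in> N' 
       \<Longrightarrow> n \<otimes> n' = n' \<otimes> n"
begin

text \<open>Not a subspace in general: two members may be invariant under different sets of r
  factors. Sums are therefore taken in the span, and only the count r is remembered.\<close>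

definition invariant_under where
  "invariant_under r = {\<Omega> \<in> l1_bidual G. \<exists>S\<subseteq>fam. r \<le> card S \<and> (\<forall>N\<in>S. left_invariant N \<Omega>)}"

lemma conjugate_set_eq: 
  "g \<in> carrier G \<Longrightarrow> conjugate_set G g N = (\<lambda>n. g \<otimes> n \<otimes> inv g) ` N"
  by (auto simp: conjugate_set_def l_coset_def r_coset_def)

lemma conj_fam_inj: 
  assumes "g \<in> carrier G"
  shows "inj_on (conjugate_set G g) fam"
proof (rule inj_onI)
  fix N N' assume N: "N \<in> fam" "N' \<in> fam" and eq: "conjugate_set G g N = conjugate_set G g N'"
  have inverse: "conjugate_set G (inv g) (conjugate_set G g M) = M" if "M \<subseteq> carrier G" for M
  proof -
    have "inv g \<otimes> (g \<otimes> m \<otimes> inv g) \<otimes> inv (inv g) = m" if "m \<in> carrier G" for m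
      using that assms by (simp add: m_assoc) (simp add: m_assoc[symmetric])
    then have "(\<lambda>m. inv g \<otimes> (g \<otimes> m \<otimes> inv g) \<otimes> inv (inv g)) ` M = M"
      using that by (auto simp: image_iff subset_iff)
    then show ?thesis using assms by (simp add: conjugate_set_eq image_image)
  qed
  show "N = N'"
    using inverse[of N] inverse[of N'] eq fam_subgroup[OF N(1)] fam_subgroup[OF N(2)] subgroup.subset by metis
qed

text \<open>For t in H g one has n t = t n' with n' = t^-1 n t in g^-1 N g, the same factor for all
  t in the coset. So N-invariance of the product follows from invariance of \<Omega> under g^-1 N g,
  and since conjugation permutes the factors the number of invariances is unchanged.\<close>

lemma coset_piece_invariant:
  assumes \<Omega>: "\<Omega> \<in> invariant_under r" and \<Phi>: "\<Phi> \<in> l1_bidual G" and g: "g \<in> carrier G"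
    and \<Psi>: "\<Psi> \<in> l1_bidual G"
    and piece: "\<And>f. bounded_on (carrier G) f \<Longrightarrow> 
       pairing G \<Psi> f = pairing G \<Phi> (\<lambda>t. if t \<in> H #> g then f t else 0)"
  shows "l1_arens G \<Psi> \<Omega> \<in> invariant_under r"
proof -
  obtain S where S: "S \<subseteq> fam" "r \<le> card S" "\<And>N. N \<in> S \<Longrightarrow> left_invariant N \<Omega>"
    and \<Omega>A: "\<Omega> \<in> l1_bidual G"
    using \<Omega> by (auto simp: invariant_under_def)
  let ?\<sigma> = "conjugate_set G (inv g)"
  define S' where "S' = {N \<in> fam. ?\<sigma> N \<in> S}"
  have ig: "inv g \<in> carrier G" using g by simp
  have "?\<sigma> ` fam = fam"
    using fam_conj[OF _ ig] conj_fam_inj[OF ig] finite_fam by (intro endo_inj_surj) auto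
  then have "S \<subseteq> ?\<sigma> ` fam" using S(1) by simp
  then have "?\<sigma> ` S' = S" by (auto simp: S'_def)
  moreover have "inj_on ?\<sigma> S'" using conj_fam_inj[OF ig] by (rule inj_on_subset) (auto simp: S'_def)
  ultimately have "card S' = card S" using card_image by metis
  moreover have "left_invariant N (l1_arens G \<Psi> \<Omega>)" if "N \<in> S'" for N
    unfolding left_invariant_def
  proof (intro ballI allI impI)
    fix n f assume n: "n \<in> N" and f: "bounded_on (carrier G) f"
    have N: "N \<in> fam" and \<sigma>N: "?\<sigma> N \<in> S" using that by (auto simp: S'_def)
    have nG: "n \<in> carrier G" using n fam_subgroup[OF N] subgroup.subset by blast
    have fn: "bounded_on (carrier G) (\<lambda>t. f (n \<otimes> t))" using f nG by (auto intro: bounded_on_compose)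
    have HG: "H \<subseteq> carrier G" using normal by (simp add: normal_imp_subgroup subgroup.subset)
    have move: "pairing G \<Omega> (\<lambda>u. f (n \<otimes> (t \<otimes> u))) = pairing G \<Omega> (\<lambda>u. f (t \<otimes> u))"
      if t: "t \<in> H #> g" for t
    proof -
      obtain h where h: "h \<in> H" "t = h \<otimes> g" using t by (auto simp: r_coset_def)
      have hG: "h \<in> carrier G" using h HG by blast
      define n' where "n' = inv g \<otimes> (inv h \<otimes> n \<otimes> h) \<otimes> g"
      have n'\<sigma>: "n' \<in> ?\<sigma> N" unfolding conjugate_set_eq[OF ig] n'_def
        using fam_normal[OF N h(1) n] g by (intro image_eqI[of _ _ "inv h \<otimes> n \<otimes> h"]) simp_all
      have n'G: "n' \<in> carrier G" using g hG nG by (simp add: n'_def)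
      have tG: "t \<in> carrier G" using h g hG by simp
      have tn: "t \<otimes> n' = n \<otimes> t"
        using g hG nG unfolding n'_def h(2) by (simp add: m_assoc) (simp add: m_assoc[symmetric])
      have ft: "bounded_on (carrier G) (\<lambda>u. f (t \<otimes> u))" using f tG by (auto intro: bounded_on_compose)
      have "pairing G \<Omega> (\<lambda>u. f (n \<otimes> (t \<otimes> u))) = pairing G \<Omega> (\<lambda>u. f (t \<otimes> (n' \<otimes> u)))"
      proof (rule bdd_functional_cong[OF bdd_functional_pairing[OF \<Omega>A]])
        show "bounded_on (carrier G) (\<lambda>u. f (n \<otimes> (t \<otimes> u)))"
          using f nG tG by (auto intro: bounded_on_compose)
        show "f (n \<otimes> (t \<otimes> u)) = f (t \<otimes> (n' \<otimes> u))" if "u \<in> carrier G" for u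
          using that tn nG tG n'G by (metis m_assoc)
      qed
      also have "\<dots> = pairing G \<Omega> (\<lambda>u. f (t \<otimes> u))"
        by (rule left_invariantD[OF S(3)[OF \<sigma>N] n'\<sigma> ft])
      finally show ?thesis .
    qed
    have "pairing G (l1_arens G \<Psi> \<Omega>) (\<lambda>t. f (n \<otimes> t)) 
       = pairing G \<Psi> (\<lambda>t. pairing G \<Omega> (\<lambda>u. f (n \<otimes> (t \<otimes> u))))"
      by (rule pairing_arens[OF \<Omega>A fn])
    also have "\<dots> = pairing G \<Phi> (\<lambda>t. if t \<in> H #> g then pairing G \<Omega> (\<lambda>u. f (n \<otimes> (t \<otimes> u))) else 0)"
      by (rule piece[OF bounded_on_pairing[OF \<Omega>A fn order_refl]])
    \<comment> \<open>The piece sees only t in H g, so \<open>move\<close>, available only there,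
      may be applied under the pairing.\<close>
    also have "\<dots> = pairing G \<Phi> (\<lambda>t. if t \<in> H #> g then pairing G \<Omega> (\<lambda>u. f (t \<otimes> u)) else 0)"
      using move by (intro arg_cong[of _ _ "pairing G \<Phi>"]) (auto simp: fun_eq_iff)
    also have "\<dots> = pairing G \<Psi> (\<lambda>t. pairing G \<Omega> (\<lambda>u. f (t \<otimes> u)))"
      by (rule piece[OF bounded_on_pairing[OF \<Omega>A f order_refl], symmetric])
    also have "\<dots> = pairing G (l1_arens G \<Psi> \<Omega>) f"
      by (rule pairing_arens[OF \<Omega>A f, symmetric])
    finally show "pairing G (l1_arens G \<Psi> \<Omega>) (\<lambda>t. f (n \<otimes> t)) = pairing G (l1_arens G \<Psi> \<Omega>) f" .
  qed
  ultimately show ?thesis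
    using S(2) arens_closed[OF \<Psi> \<Omega>A] unfolding invariant_under_def
    by (intro CollectI conjI exI[of _ S']) (auto simp: S'_def)
qed

text \<open>Cutting \<Phi> along the right cosets of H gives finitely many pieces, each covered by
  \<open>coset_piece_invariant\<close>; the pieces keep different factors, hence the span.\<close>

lemma bidual_arens_invariant_under:
  assumes \<Omega>: "\<Omega> \<in> invariant_under r" and \<Phi>: "\<Phi> \<in> l1_bidual G"
  shows "l1_arens G \<Phi> \<Omega> \<in> cfun.span (invariant_under r)"
proof -
  have HG: "H \<subseteq> carrier G" and sub: "subgroup H G" 
    using normal by (simp_all add: normal_imp_subgroup subgroup.subset)
  define m where "m C f = pairing G \<Phi> (\<lambda>t. if t \<in> C then f t else 0)" for C f
  note b\<Phi> = bdd_functional_pairing[OF \<Phi>]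
  have bm: "bdd_functional (carrier G) (m C)" for C
  proof -
    obtain K where K: "K \<ge> 0"
      "\<And>f L. L \<ge> 0 \<Longrightarrow> (\<And>x. x \<in> carrier G \<Longrightarrow> cmod (f x) \<le> L) \<Longrightarrow> cmod (pairing G \<Phi> f) \<le> K * L"
      using bdd_functional_bound[OF b\<Phi>] by metis
    have cut: "bounded_on (carrier G) (\<lambda>t. if t \<in> C then f t else 0)" if "bounded_on (carrier G) f" for f
      using that by (intro bounded_on_if) auto
    have "m C (\<lambda>x. f x + g x) = m C f + m C g" 
      if "bounded_on (carrier G) f" "bounded_on (carrier G) g" for f g
      unfolding m_def bdd_functional_add[OF b\<Phi> cut[OF that(1)] cut[OF that(2)], symmetric]
      by (rule arg_cong[of _ _ "pairing G \<Phi>"]) auto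
    moreover have "m C (\<lambda>x. c * f x) = c * m C f" if "bounded_on (carrier G) f" for c f
      unfolding m_def bdd_functional_cmult[OF b\<Phi> cut[OF that], symmetric]
      by (rule arg_cong[of _ _ "pairing G \<Phi>"]) auto
    moreover have "cmod (m C f) \<le> K * L" if "L \<ge> 0" "\<forall>x\<in>carrier G. cmod (f x) \<le> L" for f L
      unfolding m_def using that by (intro K) auto
    ultimately show ?thesis using K(1) unfolding bdd_functional_def by blast
  qed
  define P where "P C = bidual_of G (m C)" for C
  have PA: "P C \<in> l1_bidual G" for C unfolding P_def by (rule bidual_of_in_bidual[OF bm])
  have pP: "pairing G (P C) f = m C f" if "bounded_on (carrier G) f" for C f
    unfolding P_def by (rule pairing_bidual_of[OF bm that])
  have \<Omega>A: "\<Omega> \<in> l1_bidual G" using \<Omega> by (simp add: invariant_under_def)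
  have sumA: "(\<Sum>C\<in>X. l1_arens G (P C) \<Omega>) \<in> l1_bidual G" for X
    by (intro cfun.subspace_sum[OF l1_bidual_subspace] arens_closed PA \<Omega>A)
  have psum: "pairing G (\<Sum>C\<in>X. l1_arens G (P C) \<Omega>) f = (\<Sum>C\<in>X. pairing G (l1_arens G (P C) \<Omega>) f)"
    for X f by (induction X rule: infinite_finite_induct) (simp_all add: pairing_def)
  have "l1_arens G \<Phi> \<Omega> = (\<Sum>C\<in>rcosets H. l1_arens G (P C) \<Omega>)"
  proof (rule bidual_eqI[OF arens_closed[OF \<Phi> \<Omega>A] sumA])
    fix f assume f: "bounded_on (carrier G) f"
    define k where "k t = pairing G \<Omega> (\<lambda>u. f (t \<otimes> u))" for t
    have bk: "bounded_on (carrier G) k" unfolding k_def by (rule bounded_on_pairing[OF \<Omega>A f order_refl])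
    have split: "k t = (\<Sum>C\<in>rcosets H. if t \<in> C then k t else 0)" if "t \<in> carrier G" for t
    proof -
      have "t \<in> H #> t" using that sub by (simp add: rcos_self)
      have "C = H #> t" if C: "C \<in> rcosets H" "t \<in> C" for C
      proof -
        obtain x where "x \<in> carrier G" "C = H #> x" using C(1) unfolding RCOSETS_def by blast
        then show ?thesis using C(2) repr_independence[of t H x] sub by simp
      qed
      moreover have "H #> t \<in> rcosets H" using that HG by (intro rcosetsI)
      ultimately have "{C \<in> rcosets H. t \<in> C} = {H #> t}" using \<open>t \<in> H #> t\<close> by blast
      then show ?thesis using finite_index by (simp add: sum.If_cases Int_def)
    qed
    have "pairing G \<Phi> k = pairing G \<Phi> (\<lambda>t. \<Sum>C\<in>rcosets H. if t \<in> C then k t else 0)"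
      by (rule bdd_functional_cong[OF b\<Phi> bk split])
    also have "\<dots> = (\<Sum>C\<in>rcosets H. m C k)"
      unfolding m_def using bk by (intro bdd_functional_sum[OF b\<Phi>] bounded_on_if) auto
    also have "\<dots> = (\<Sum>C\<in>rcosets H. pairing G (l1_arens G (P C) \<Omega>) f)"
      using pairing_arens[OF \<Omega>A f] pP[OF bk] by (simp add: k_def[abs_def])
    finally show "pairing G (l1_arens G \<Phi> \<Omega>) f = pairing G (\<Sum>C\<in>rcosets H. l1_arens G (P C) \<Omega>) f"
      using pairing_arens[OF \<Omega>A f, of \<Phi>] unfolding psum by (simp add: k_def[abs_def])
  qed
  moreover have "l1_arens G (P C) \<Omega> \<in> invariant_under r" if C: "C \<in> rcosets H" for C
  proof -
    obtain g where "g \<in> carrier G" "C = H #> g" using C by (auto simp: RCOSETS_def)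
    then show ?thesis using coset_piece_invariant[OF \<Omega> \<Phi> _ PA, of g C] pP by (simp add: m_def)
  qed
  ultimately show ?thesis by (simp add: cfun.span_sum cfun.span_base)
qed

text \<open>If N is among the factors S fixing \<Omega>, then s -> <\<Omega>, f (s .)> is constant
  on N, and \<Gamma> annihilates constants. Otherwise invariance of \<Gamma> adds N to S, and the
  factors already in S survive because they commute with N.\<close>

lemma incl_arens_invariant_under:
  assumes \<Omega>: "\<Omega> \<in> invariant_under r" and N: "N \<in> fam" 
    and \<Gamma>: "\<Gamma> \<in> invariant_differences (G\<lparr>carrier := N\<rparr>)"
  shows "l1_arens G (l1_bidual_incl G N \<Gamma>) \<Omega> \<in> cfun.span (invariant_under (Suc r))"
proof -
  let ?\<Gamma> = "l1_bidual_incl G N \<Gamma>" and ?N = "G\<lparr>carrier := N\<rparr>"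
  obtain S where S: "S \<subseteq> fam" "r \<le> card S" "\<And>N. N \<in> S \<Longrightarrow> left_invariant N \<Omega>"
    and \<Omega>A: "\<Omega> \<in> l1_bidual G"
    using \<Omega> by (auto simp: invariant_under_def)
  have subN: "subgroup N G" by (rule fam_subgroup[OF N])
  have NG: "N \<subseteq> carrier G" by (rule subgroup.subset[OF subN])
  have \<Gamma>N: "\<Gamma> \<in> l1_bidual ?N" and \<Gamma>inv: "\<And>s f. s \<in> N \<Longrightarrow> bounded_on N f \<Longrightarrow> 
      pairing ?N \<Gamma> (\<lambda>t. f (s \<otimes> t)) = pairing ?N \<Gamma> f" and \<Gamma>0: "pairing ?N \<Gamma> (\<lambda>_. 1) = 0"
    using \<Gamma> invariant_differences_subgroup_iff[OF subN] by blast+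
  have b\<Gamma>: "bdd_functional N (pairing ?N \<Gamma>)" using bdd_functional_pairing[OF \<Gamma>N] by simp
  have \<Gamma>A: "?\<Gamma> \<in> l1_bidual G" by (rule incl_invariant_difference_closed[OF subN \<Gamma>])
  have pair: "pairing G (l1_arens G ?\<Gamma> \<Omega>) f = pairing ?N \<Gamma> (\<lambda>s. pairing G \<Omega> (\<lambda>t. f (s \<otimes> t)))"
    if "bounded_on (carrier G) f" for f
    using pairing_arens[OF \<Omega>A that] pairing_incl[OF NG \<Gamma>N bounded_on_pairing[OF \<Omega>A that order_refl]] by simp
  show ?thesis
  proof (cases "N \<in> S")
    case True
    have "l1_arens G ?\<Gamma> \<Omega> = 0"
    proof (rule bidual_eqI[OF arens_closed[OF \<Gamma>A \<Omega>A] cfun.subspace_0[OF l1_bidual_subspace]])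
      fix f assume f: "bounded_on (carrier G) f"
      have "pairing ?N \<Gamma> (\<lambda>s. pairing G \<Omega> (\<lambda>t. f (s \<otimes> t))) = pairing ?N \<Gamma> (\<lambda>_. pairing G \<Omega> f)"
        using S(3)[OF True] f
        by (intro bdd_functional_cong[OF b\<Gamma> bounded_on_pairing[OF \<Omega>A f NG]]) (simp add: left_invariant_def)
      also have "\<dots> = 0" using bdd_functional_const[OF b\<Gamma>] \<Gamma>0 by simp
      finally show "pairing G (l1_arens G ?\<Gamma> \<Omega>) f = pairing G 0 f" 
        using pair[OF f] by (simp add: pairing_def)
    qed
    then show ?thesis by (simp add: cfun.span_zero)
  next
    case False
    have "left_invariant N (l1_arens G ?\<Gamma> \<Omega>)"
      unfolding left_invariant_def
    proof (intro ballI allI impI)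
      fix n f assume n: "n \<in> N" and f: "bounded_on (carrier G) f"
      have nG: "n \<in> carrier G" using n NG by blast
      have fn: "bounded_on (carrier G) (\<lambda>t. f (n \<otimes> t))" using f nG by (auto intro: bounded_on_compose)
      define k where "k s = pairing G \<Omega> (\<lambda>t. f (s \<otimes> t))" for s
      have bk: "bounded_on (carrier G) k" unfolding k_def by (rule bounded_on_pairing[OF \<Omega>A f order_refl])
      have "pairing ?N \<Gamma> (\<lambda>s. pairing G \<Omega> (\<lambda>t. f (n \<otimes> (s \<otimes> t)))) = pairing ?N \<Gamma> (\<lambda>s. k (n \<otimes> s))"
      proof (rule bdd_functional_cong[OF b\<Gamma> bounded_on_pairing[OF \<Omega>A fn NG]])
        fix s assume "s \<in> N"
        then have sG: "s \<in> carrier G" using NG by blast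
        then show "pairing G \<Omega> (\<lambda>t. f (n \<otimes> (s \<otimes> t))) = k (n \<otimes> s)"
          unfolding k_def using nG f 
          by (intro bdd_functional_cong[OF bdd_functional_pairing[OF \<Omega>A]]) 
             (auto intro: bounded_on_compose simp: m_assoc)
      qed
      also have "\<dots> = pairing ?N \<Gamma> k" by (rule \<Gamma>inv[OF n bounded_on_subset[OF bk NG]])
      finally show "pairing G (l1_arens G ?\<Gamma> \<Omega>) (\<lambda>t. f (n \<otimes> t)) = pairing G (l1_arens G ?\<Gamma> \<Omega>) f"
        using pair[OF fn] pair[OF f] by (simp add: k_def[abs_def])
    qed
    moreover have "left_invariant M (l1_arens G ?\<Gamma> \<Omega>)" if M: "M \<in> S" for M
      unfolding left_invariant_def
    proof (intro ballI allI impI)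
      fix n f assume n: "n \<in> M" and f: "bounded_on (carrier G) f"
      have MF: "M \<in> fam" and MN: "M \<noteq> N" using M S(1) False by auto
      have nG: "n \<in> carrier G" using n subgroup.subset[OF fam_subgroup[OF MF]] by blast
      have fn: "bounded_on (carrier G) (\<lambda>t. f (n \<otimes> t))" using f nG by (auto intro: bounded_on_compose)
      have "pairing ?N \<Gamma> (\<lambda>s. pairing G \<Omega> (\<lambda>t. f (n \<otimes> (s \<otimes> t)))) 
         = pairing ?N \<Gamma> (\<lambda>s. pairing G \<Omega> (\<lambda>t. f (s \<otimes> t)))"
      proof (rule bdd_functional_cong[OF b\<Gamma> bounded_on_pairing[OF \<Omega>A fn NG]])
        fix s assume s: "s \<in> N"
        then have sG: "s \<in> carrier G" using NG by blast
        have fs: "bounded_on (carrier G) (\<lambda>t. f (s \<otimes> t))" using f sG by (auto intro: bounded_on_compose)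
        have "pairing G \<Omega> (\<lambda>t. f (n \<otimes> (s \<otimes> t))) = pairing G \<Omega> (\<lambda>t. f (s \<otimes> (n \<otimes> t)))"
        proof (rule bdd_functional_cong[OF bdd_functional_pairing[OF \<Omega>A]])
          show "bounded_on (carrier G) (\<lambda>t. f (n \<otimes> (s \<otimes> t)))" 
            using f nG sG by (auto intro: bounded_on_compose)
          show "f (n \<otimes> (s \<otimes> t)) = f (s \<otimes> (n \<otimes> t))" if "t \<in> carrier G" for t
            using fam_commute[OF MF N MN n s] that nG sG by (metis m_assoc)
        qed
        also have "\<dots> = pairing G \<Omega> (\<lambda>t. f (s \<otimes> t))"
          by (rule left_invariantD[OF S(3)[OF M] n fs])
        finally show "pairing G \<Omega> (\<lambda>t. f (n \<otimes> (s \<otimes> t))) = pairing G \<Omega> (\<lambda>t. f (s \<otimes> t))" .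
      qed
      then show "pairing G (l1_arens G ?\<Gamma> \<Omega>) (\<lambda>t. f (n \<otimes> t)) = pairing G (l1_arens G ?\<Gamma> \<Omega>) f"
        using pair[OF fn] pair[OF f] by simp
    qed
    moreover have "card (insert N S) = Suc (card S)"
      using False finite_subset[OF S(1) finite_fam] by simp
    ultimately have "l1_arens G ?\<Gamma> \<Omega> \<in> invariant_under (Suc r)"
      using S N arens_closed[OF \<Gamma>A \<Omega>A] unfolding invariant_under_def
      by (intro CollectI conjI exI[of _ "insert N S"]) auto
    then show ?thesis by (rule cfun.span_base)
  qed
qed

text \<open>In \<Phi> \<box> \<Gamma> \<box> \<Omega> the difference \<Gamma> acts first and raises
  the count, after which \<Phi> preserves it.\<close>

lemma difference_ideal_arens_invariant_under:
  assumes x: "x \<in> difference_ideal fam" and v: "v \<in> cfun.span (invariant_under r)"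
  shows "l1_arens G x v \<in> cfun.span (invariant_under (Suc r))"
proof (rule arens_span[OF _ _ cfun.subspace_span _ x[unfolded difference_ideal_def] v])
  let ?W = "{l1_arens G \<Phi> (l1_bidual_incl G N \<Gamma>) |\<Phi> \<Gamma> N.
       \<Phi> \<in> l1_bidual G \<and> N \<in> fam \<and> \<Gamma> \<in> invariant_differences (G\<lparr>carrier := N\<rparr>)}"
  show "?W \<subseteq> l1_bidual G" using fam_subgroup by (auto intro: arens_closed incl_invariant_difference_closed)
  show VA: "invariant_under r \<subseteq> l1_bidual G" for r by (auto simp: invariant_under_def)
  fix w \<Omega> assume "w \<in> ?W" and \<Omega>: "\<Omega> \<in> invariant_under r"
  then obtain \<Phi> \<Gamma> N where N: "N \<in> fam" and \<Gamma>: "\<Gamma> \<in> invariant_differences (G\<lparr>carrier := N\<rparr>)"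
    and \<Phi>: "\<Phi> \<in> l1_bidual G" and w: "w = l1_arens G \<Phi> (l1_bidual_incl G N \<Gamma>)" by blast
  have \<Gamma>A: "l1_bidual_incl G N \<Gamma> \<in> l1_bidual G" 
    by (rule incl_invariant_difference_closed[OF fam_subgroup[OF N] \<Gamma>])
  have "l1_arens G w \<Omega> = l1_arens G \<Phi> (l1_arens G (l1_bidual_incl G N \<Gamma>) \<Omega>)"
    unfolding w using \<Omega> VA by (intro arens_assoc[OF \<Phi> \<Gamma>A]) auto
  also have "\<dots> \<in> cfun.span (invariant_under (Suc r))"
  proof (rule arens_span[OF order_refl VA cfun.subspace_span _ cfun.span_base[OF \<Phi>] 
        incl_arens_invariant_under[OF \<Omega> N \<Gamma>]])
    show "l1_arens G x w \<in> cfun.span (invariant_under (Suc r))" 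
      if "x \<in> l1_bidual G" "w \<in> invariant_under (Suc r)" for x w
      by (rule bidual_arens_invariant_under[OF that(2,1)])
  qed
  finally show "l1_arens G w \<Omega> \<in> cfun.span (invariant_under (Suc r))" .
qed

text \<open>Products are bracketed to the left, so x y acts on v as x after y: y raises the count
  from r to r + 1 and x adds the remaining n. Membership in the bidual is carried along because
  associativity asks for it.\<close>

lemma nfold_product_invariant_under:
  assumes "nfold_product (l1_arens G) (difference_ideal fam) n x"
  shows "x \<in> l1_bidual G" "v \<in> cfun.span (invariant_under r) \<Longrightarrow> l1_arens G x v \<in> cfun.span (invariant_under (r + n))"
  using assms
proof (induction arbitrary: r v)
  note IA = difference_ideal_subset[of fam, OF fam_subgroup]
  {
    case (one x)
    case 1 show ?case using one IA by blast
    case 2 show ?case using difference_ideal_arens_invariant_under[OF one 2] by simp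
  next
    case (mult n x y)
    case 1 show ?case using mult IA by (auto intro: arens_closed)
    case 2
    have "invariant_under r \<subseteq> l1_bidual G" by (auto simp: invariant_under_def)
    then have vA: "v \<in> l1_bidual G" using cfun.span_minimal[OF _ l1_bidual_subspace] 2 by blast
    have yA: "y \<in> l1_bidual G" using mult IA by blast
    show ?case 
      using mult.IH(2)[OF difference_ideal_arens_invariant_under[OF mult(2) 2]] 
      unfolding arens_assoc[OF mult.IH(1) yA vA] by simp
  }
qed

text \<open>The identity lies in \<open>invariant_under 0\<close>, so x = x 1 lies in the span of
  \<open>invariant_under (card fam + 1)\<close>, an empty set since there are not that many
  factors.\<close>

lemma nilpotent_difference_ideal: "nilpotent_ideal (l1_arens G) (difference_ideal fam)"
proof -
  have "x = 0" if "nfold_product (l1_arens G) (difference_ideal fam) (Suc (card fam)) x" for x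
  proof -
    have "bidual_one \<in> invariant_under 0" 
      by (auto simp: invariant_under_def bidual_point_mass_in_bidual intro!: exI[of _ "{}"])
    then have "l1_arens G x bidual_one \<in> cfun.span (invariant_under (0 + Suc (card fam)))"
      by (intro nfold_product_invariant_under(2)[OF that] cfun.span_base)
    moreover have "invariant_under (0 + Suc (card fam)) = {}"
      using card_mono[OF finite_fam] by (fastforce simp: invariant_under_def)
    ultimately show ?thesis
      using arens_one_right[OF nfold_product_invariant_under(1)[OF that]] by simp
  qed
  then show ?thesis unfolding nilpotent_ideal_def power_vanishes_def by (intro exI[of _ "Suc (card fam)"]) simp
qed

end

section \<open>Internal direct products\<close>

context group
begin

lemma normal_in_subgroup:
  assumes D: "subgroup D G" and N: "N \<lhd> G\<lparr>carrier := D\<rparr>"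
  shows normal_in_subgroup_subset: "N \<subseteq> D"
    and normal_in_subgroup_subgroup: "subgroup N G"
    and normal_in_subgroup_conj: "x \<in> D \<Longrightarrow> n \<in> N \<Longrightarrow> x \<otimes> n \<otimes> inv x \<in> N"
proof -
  have sub: "subgroup N (G\<lparr>carrier := D\<rparr>)" using N by (rule normal_imp_subgroup)
  show "N \<subseteq> D" using subgroup.subset[OF sub] by simp
  show "subgroup N G" by (rule incl_subgroup[OF D sub])
  show "x \<otimes> n \<otimes> inv x \<in> N" if "x \<in> D" "n \<in> N"
    using normal.inv_op_closed2[OF N, of x n] that m_inv_consistent[OF D that(1)] by simp
qed

lemma internal_direct_product_component:
  assumes "internal_direct_product G D J N" "j \<in> J"
  shows "subgroup D G" "N j \<lhd> G\<lparr>carrier := D\<rparr>" "N j \<subseteq> D" "subgroup (N j) G" "N j \<subseteq> carrier G"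
proof -
  show D: "subgroup D G" and n: "N j \<lhd> G\<lparr>carrier := D\<rparr>"
    using assms by (auto simp: internal_direct_product_def)
  show "N j \<subseteq> D" "subgroup (N j) G" 
    by (rule normal_in_subgroup_subset[OF D n], rule normal_in_subgroup_subgroup[OF D n])
  then show "N j \<subseteq> carrier G" by (simp add: subgroup.subset)
qed

text \<open>The commutator a b a^-1 b^-1 is trivial: bracketed one way it is a product of elements
  of M, bracketed the other way a product of elements of N.\<close>

lemma normal_disjoint_commute:
  assumes D: "subgroup D G" and N: "N \<lhd> G\<lparr>carrier := D\<rparr>" and M: "M \<lhd> G\<lparr>carrier := D\<rparr>"
    and disj: "N \<inter> M \<subseteq> {\<one>}" and a: "a \<in> N" and b: "b \<in> M"
  shows "a \<otimes> b = b \<otimes> a"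
proof -
  have aD: "a \<in> D" and bD: "b \<in> D" 
    using a b normal_in_subgroup_subset[OF D N] normal_in_subgroup_subset[OF D M] by auto
  have aG: "a \<in> carrier G" and bG: "b \<in> carrier G" using aD bD subgroup.subset[OF D] by auto
  have "(a \<otimes> b \<otimes> inv a) \<otimes> inv b \<in> M"
    using normal_in_subgroup_conj[OF D M aD b] normal_in_subgroup_subgroup[OF D M] b
    by (meson subgroup.m_closed subgroup.m_inv_closed)
  moreover have "a \<otimes> (b \<otimes> inv a \<otimes> inv b) \<in> N"
    using normal_in_subgroup_conj[OF D N bD] normal_in_subgroup_subgroup[OF D N] a
    by (meson subgroup.m_closed subgroup.m_inv_closed)
  ultimately have "(a \<otimes> b \<otimes> inv a) \<otimes> inv b = \<one>" using disj aG bG by (auto simp: m_assoc)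
  then have "a \<otimes> b \<otimes> inv a = b" using aG bG by (metis inv_equality inv_inv inv_closed m_closed)
  then show ?thesis using aG bG by (metis inv_solve_right m_closed)
qed

lemma internal_direct_product_disjoint:
  assumes idp: "internal_direct_product G D J N" and "i \<in> J" "j \<in> J" "i \<noteq> j"
  shows "N i \<inter> N j = {\<one>}"
proof -
  have "N i \<subseteq> generate G (\<Union>k\<in>J - {j}. N k)" using assms(2,4) by (auto intro: generate.incl)
  moreover have "N j \<inter> generate G (\<Union>i\<in>J - {j}. N i) = {\<one>}" 
    using assms by (simp add: internal_direct_product_def)
  ultimately have "N i \<inter> N j \<subseteq> {\<one>}" by blast
  moreover have "\<one> \<in> N i" "\<one> \<in> N j"
    using internal_direct_product_component(4)[OF idp] assms subgroup.one_closed by metis+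
  ultimately show ?thesis by blast
qed

lemma internal_direct_product_commute:
  assumes idp: "internal_direct_product G D J N" and ij: "i \<in> J" "j \<in> J" "i \<noteq> j" 
    and ab: "a \<in> N i" "b \<in> N j"
  shows "a \<otimes> b = b \<otimes> a"
  using normal_disjoint_commute[OF internal_direct_product_component(1,2)[OF idp ij(1)]
      internal_direct_product_component(2)[OF idp ij(2)] _ ab] internal_direct_product_disjoint[OF idp ij] 
  by simp

lemma generate_commute:
  assumes A: "A \<subseteq> carrier G" and x: "x \<in> carrier G" and comm: "\<And>a. a \<in> A \<Longrightarrow> a \<otimes> x = x \<otimes> a"
    and a: "a \<in> generate G A"
  shows "a \<otimes> x = x \<otimes> a"
  using a
proof (induction rule: generate.induct)
  case one then show ?case using x by simp
next
  case (incl h) then show ?case by (rule comm)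
next
  case (inv h)
  then have h: "h \<in> carrier G" using A by blast
  have "inv h \<otimes> (h \<otimes> x) \<otimes> inv h = x \<otimes> inv h" using h x by (simp add: m_assoc[symmetric])
  moreover have "inv h \<otimes> (x \<otimes> h) \<otimes> inv h = inv h \<otimes> x" using h x by (simp add: m_assoc)
  ultimately show ?case using comm[OF inv] by simp
next
  case (eng h1 h2)
  then have "h1 \<in> carrier G" "h2 \<in> carrier G" using generate_in_carrier[OF A] by auto
  then show ?case using eng.IH x by (metis m_assoc)
qed

text \<open>Splits off one subgroup B: since A commutes with B, the products a b are closed under
  multiplication. The decompositions below come from peeling off one factor in this way.\<close>

lemma generate_commuting_Un:
  assumes A: "A \<subseteq> carrier G" and B: "subgroup B G" 
    and comm: "\<And>a b. a \<in> A \<Longrightarrow> b \<in> B \<Longrightarrow> a \<otimes> b = b \<otimes> a"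
    and g: "g \<in> generate G (A \<union> B)"
  shows "\<exists>a\<in>generate G A. \<exists>b\<in>B. g = a \<otimes> b"
proof -
  have BG: "B \<subseteq> carrier G" by (rule subgroup.subset[OF B])
  have one: "\<one> \<in> generate G A" "\<one> \<in> B" using generate.one subgroup.one_closed[OF B] by auto
  have left: "\<exists>a\<in>generate G A. \<exists>b\<in>B. h = a \<otimes> b" if "h \<in> generate G A" for h
    using that one generate_in_carrier[OF A that] by (metis r_one)
  have right: "\<exists>a\<in>generate G A. \<exists>b\<in>B. h = a \<otimes> b" if "h \<in> B" for h
    using that one BG by (metis l_one subsetD)
  show ?thesis using g
  proof (induction rule: generate.induct)
    case one then show ?case using left[OF generate.one] .
  next
    case (incl h) then show ?case using left[OF generate.incl] right by blast
  next
    case (inv h) then show ?case using left[OF generate.inv] right subgroup.m_inv_closed[OF B] by blast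
  next
    case (eng h1 h2)
    then obtain a1 b1 a2 b2 where ab: "a1 \<in> generate G A" "b1 \<in> B" "h1 = a1 \<otimes> b1"
      "a2 \<in> generate G A" "b2 \<in> B" "h2 = a2 \<otimes> b2" by blast
    have c: "a1 \<in> carrier G" "a2 \<in> carrier G" "b1 \<in> carrier G" "b2 \<in> carrier G"
      using ab generate_in_carrier[OF A] BG by auto
    have "a2 \<otimes> b1 = b1 \<otimes> a2" 
      by (rule generate_commute[OF A c(3) _ ab(4)]) (rule comm[OF _ ab(2)])
    have "h1 \<otimes> h2 = a1 \<otimes> (b1 \<otimes> a2) \<otimes> b2" using ab c by (simp add: m_assoc)
    also have "\<dots> = (a1 \<otimes> a2) \<otimes> (b1 \<otimes> b2)"
      using c by (simp only: \<open>a2 \<otimes> b1 = b1 \<otimes> a2\<close>[symmetric]) (simp add: m_assoc)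
    finally show ?case using generate.eng[OF ab(1,4)] subgroup.m_closed[OF B ab(2,5)] by blast
  qed
qed

text \<open>With K generated by the other factors, D = K N_j, and K and N_j commute and meet
  trivially, so the N_j-component of d is well defined. Its behaviour under right multiplication is
  what is recorded, because the pairing formula evaluates at s t with t running over one
  factor.\<close>

lemma internal_direct_product_projection:
  assumes idp: "internal_direct_product G D J N" and j: "j \<in> J"
  obtains p where "\<And>d. d \<in> D \<Longrightarrow> p d \<in> N j" "\<And>d t. d \<in> D \<Longrightarrow> t \<in> N j \<Longrightarrow> p (d \<otimes> t) = p d \<otimes> t"
    "\<And>d t i. d \<in> D \<Longrightarrow> i \<in> J \<Longrightarrow> i \<noteq> j \<Longrightarrow> t \<in> N i \<Longrightarrow> p (d \<otimes> t) = p d"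
proof -
  define K where "K = generate G (\<Union>i\<in>J - {j}. N i)"
  note comp = internal_direct_product_component[OF idp]
  have UG: "(\<Union>i\<in>J - {j}. N i) \<subseteq> carrier G" using comp(5) by blast
  have subK: "subgroup K G" unfolding K_def by (rule generate_is_subgroup[OF UG])
  have subN: "subgroup (N j) G" by (rule comp(4)[OF j])
  have KG: "K \<subseteq> carrier G" and NG: "N j \<subseteq> carrier G" using subK subN by (auto simp: subgroup.subset)
  have disj: "N j \<inter> K = {\<one>}" using idp j by (simp add: internal_direct_product_def K_def)
  have D: "D = generate G (\<Union>i\<in>J. N i)" using idp by (simp add: internal_direct_product_def)
  have comm1: "k \<otimes> n = n \<otimes> k" if "k \<in> (\<Union>i\<in>J - {j}. N i)" "n \<in> N j" for k n
    using that internal_direct_product_commute[OF idp _ j] by auto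
  have comm: "k \<otimes> n = n \<otimes> k" if "k \<in> K" "n \<in> N j" for k n
    using that NG comm1 by (intro generate_commute[OF UG _ _ that(1)[unfolded K_def]]) auto
  have "(\<Union>i\<in>J. N i) = (\<Union>i\<in>J - {j}. N i) \<union> N j" using j by auto
  then have decomp: "\<exists>k\<in>K. \<exists>n\<in>N j. d = k \<otimes> n" if "d \<in> D" for d
    using generate_commuting_Un[OF UG subN comm1] that by (simp add: D K_def)
  have unique: "n = n'" if "k \<in> K" "k' \<in> K" "n \<in> N j" "n' \<in> N j" "k \<otimes> n = k' \<otimes> n'" for k k' n n'
  proof -
    have c: "k \<in> carrier G" "n \<in> carrier G" "k' \<in> carrier G" "n' \<in> carrier G" using KG NG that by auto
    have "inv k' \<otimes> k = n' \<otimes> inv n"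
      using that(5) c by (metis inv_solve_left inv_solve_right m_assoc m_closed inv_closed)
    moreover have "inv k' \<otimes> k \<in> K" "n' \<otimes> inv n \<in> N j"
      using that subK subN by (meson subgroup.m_closed subgroup.m_inv_closed)+
    ultimately have "n' \<otimes> inv n = \<one>" using disj by (metis IntI singletonD)
    then show ?thesis using c by (metis inv_equality inv_inv inv_closed)
  qed
  \<comment> \<open>\<open>unique\<close> makes the component independent of the choice made by
    \<open>SOME\<close>.\<close>
  define p where "p d = (SOME n. n \<in> N j \<and> (\<exists>k\<in>K. d = k \<otimes> n))" for d
  have p: "p d \<in> N j \<and> (\<exists>k\<in>K. d = k \<otimes> p d)" if "d \<in> D" for d
    unfolding p_def by (rule someI_ex) (use decomp[OF that] in blast)
  have p_eq: "p (k \<otimes> n) = n" if "k \<in> K" "n \<in> N j" "k \<otimes> n \<in> D" for k n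
    using p[OF that(3)] unique that by metis
  have subD: "subgroup D G" by (rule comp(1)[OF j])
  show ?thesis
  proof (rule that)
    show "p d \<in> N j" if "d \<in> D" for d using p[OF that] by simp
    fix d assume d: "d \<in> D"
    obtain k where k: "k \<in> K" "d = k \<otimes> p d" using p[OF d] by blast
    have c: "k \<in> carrier G" "p d \<in> carrier G" using k p[OF d] KG NG by auto
    { fix t assume t: "t \<in> N j"
      have "k \<otimes> (p d \<otimes> t) = d \<otimes> t" using k c t NG by (metis m_assoc subsetD)
      moreover have "d \<otimes> t \<in> D" using d t comp(3)[OF j] subgroup.m_closed[OF subD] by auto
      ultimately show "p (d \<otimes> t) = p d \<otimes> t" 
        using p_eq[OF k(1), of "p d \<otimes> t"] p[OF d] t subgroup.m_closed[OF subN] by metis }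
    { fix t i assume t: "i \<in> J" "i \<noteq> j" "t \<in> N i"
      have tK: "t \<in> K" unfolding K_def using t by (auto intro: generate.incl)
      have tG: "t \<in> carrier G" using tK KG by auto
      have "d \<otimes> t = k \<otimes> (p d \<otimes> t)" using k(2) c tG by (metis m_assoc)
      also have "\<dots> = (k \<otimes> t) \<otimes> p d" using comm[OF tK] p[OF d] c tG by (metis m_assoc)
      finally have "d \<otimes> t = (k \<otimes> t) \<otimes> p d" .
      moreover have "d \<otimes> t \<in> D" using d t comp(3)[of i] subgroup.m_closed[OF subD] by auto
      ultimately show "p (d \<otimes> t) = p d"
        using p_eq[of "k \<otimes> t" "p d"] p[OF d] subgroup.m_closed[OF subK k(1) tK] by metis }
  qed
qed

section \<open>Nonvanishing powers of sums of invariant differences\<close>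

lemma nfold_product_power:
  assumes "x \<in> I"
  shows "nfold_product mul I (Suc n) (((\<lambda>y. mul y x) ^^ n) x)"
proof (induction n)
  case 0
  then show ?case using nfold_product.one[OF assms, of mul] by simp
next
  case (Suc n)
  then show ?case using nfold_product.mult[OF Suc assms] by simp
qed

text \<open>Right multiplication by \<open>x\<close> acts on the functions \<open>f\<^sub>S = 1\<^sub>D \<cdot> \<Prod>\<^bsub>j\<in>S\<^esub> f\<^sub>j \<circ> p\<^sub>j\<close>, where \<open>p\<^sub>j\<close> is the projection
  onto \<open>N\<^sub>j\<close>, like a derivation: \<open>x \<cdot> f\<^sub>S = \<Sum>\<^bsub>j\<in>S\<^esub> a\<^sub>j f\<^bsub>S-{j}\<^esub>\<close> with \<open>a\<^sub>j = c\<^sub>j \<langle>\<Gamma>\<^sub>j, f\<^sub>j\<rangle>\<close>.\<close>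

lemma power_of_invariant_differences_nonzero:
  fixes \<Gamma> :: "'i \<Rightarrow> (('a \<Rightarrow> complex) \<Rightarrow> complex) \<Rightarrow> complex"
  assumes idp: "internal_direct_product G D J N"
    and \<Gamma>: "\<And>j. j \<in> J \<Longrightarrow> \<Gamma> j \<in> invariant_differences (G\<lparr>carrier := N j\<rparr>)"
    and f: "\<And>j. j \<in> J \<Longrightarrow> bounded_on (N j) (f j)"
    and nonzero: "\<And>j. j \<in> J \<Longrightarrow> c j * pairing (G\<lparr>carrier := N j\<rparr>) (\<Gamma> j) (f j) \<noteq> 0"
    and x: "x \<in> l1_bidual G"
    and x_sum: "\<And>h. bounded_on (carrier G) h \<Longrightarrow>
       ((\<lambda>j. c j * pairing (G\<lparr>carrier := N j\<rparr>) (\<Gamma> j) h) has_sum pairing G x h) J"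
    and S: "S \<subseteq> J" "finite S" "card S = Suc n"
  shows "((\<lambda>y. l1_arens G y x) ^^ n) x \<noteq> 0"
proof -
  let ?N = "\<lambda>j. G\<lparr>carrier := N j\<rparr>"
  note comp = internal_direct_product_component[OF idp]
  have "\<forall>j\<in>J. \<exists>p. (\<forall>d\<in>D. p d \<in> N j) \<and> (\<forall>d\<in>D. \<forall>t\<in>N j. p (d \<otimes> t) = p d \<otimes> t) \<and>
     (\<forall>d\<in>D. \<forall>i\<in>J. i \<noteq> j \<longrightarrow> (\<forall>t\<in>N i. p (d \<otimes> t) = p d))"
    using internal_direct_product_projection[OF idp] by metis
  then obtain p where "\<forall>j\<in>J. (\<forall>d\<in>D. p j d \<in> N j) \<and> (\<forall>d\<in>D. \<forall>t\<in>N j. p j (d \<otimes> t) = p j d \<otimes> t) \<and>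
     (\<forall>d\<in>D. \<forall>i\<in>J. i \<noteq> j \<longrightarrow> (\<forall>t\<in>N i. p j (d \<otimes> t) = p j d))"
    by (auto simp: bchoice_iff)
  then have p1: "\<And>j d. j \<in> J \<Longrightarrow> d \<in> D \<Longrightarrow> p j d \<in> N j"
    and p2: "\<And>j d t. j \<in> J \<Longrightarrow> d \<in> D \<Longrightarrow> t \<in> N j \<Longrightarrow> p j (d \<otimes> t) = p j d \<otimes> t"
    and p3: "\<And>i j d t. j \<in> J \<Longrightarrow> i \<in> J \<Longrightarrow> i \<noteq> j \<Longrightarrow> d \<in> D \<Longrightarrow> t \<in> N i \<Longrightarrow> p j (d \<otimes> t) = p j d"
    by blast+
  \<comment> \<open>Cut off outside D, where the projections \<open>p j\<close> carry no
    information.\<close>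
  define F where "F S = (\<lambda>d. if d \<in> D then \<Prod>j\<in>S. f j (p j d) else 0)" for S
  define a where "a j = c j * pairing (?N j) (\<Gamma> j) (f j)" for j
  have subD: "subgroup D G" using idp by (simp add: internal_direct_product_def)
  have DG: "D \<subseteq> carrier G" by (rule subgroup.subset[OF subD])
  have bF: "bounded_on (carrier G) (F S)" if "S \<subseteq> J" for S
  proof -
    have "bounded_on D (\<lambda>d. f j (p j d))" if "j \<in> S" for j
    proof -
      have "j \<in> J" using that \<open>S \<subseteq> J\<close> by blast
      then show ?thesis using bounded_on_compose[of "N j" "f j" D "p j"] f p1 by blast
    qed
    then have bp: "bounded_on D (\<lambda>d. \<Prod>j\<in>S. f j (p j d))" by (rule bounded_on_prod)
    obtain K where "K \<ge> 0" "\<And>d. d \<in> D \<Longrightarrow> cmod (\<Prod>j\<in>S. f j (p j d)) \<le> K"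
      using bounded_onE[OF bp] by metis
    then show ?thesis by (intro bounded_onI[of _ _ K]) (simp add: F_def)
  qed
  have key: "pairing G x (\<lambda>t. F S (s \<otimes> t)) = (\<Sum>j\<in>S. a j * F (S - {j}) s)"
    if S: "S \<subseteq> J" "finite S" and s: "s \<in> carrier G" for S s
  proof -
    have bFs: "bounded_on (carrier G) (\<lambda>t. F S (s \<otimes> t))" 
      using bF[OF S(1)] s by (auto intro: bounded_on_compose)
    \<comment> \<open>Three cases. If s is outside D, then s N_j misses D and both sides are 0. If j
      is not in S, the function is constant on N_j and \<Gamma>_j annihilates it. If j is in S, only
      the factor with index j varies, and invariance of \<Gamma>_j absorbs the translation by
      \<open>p j s\<close>.\<close>
    have one: "c j * pairing (?N j) (\<Gamma> j) (\<lambda>t. F S (s \<otimes> t)) = (if j \<in> S then a j * F (S - {j}) s else 0)"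
      if j: "j \<in> J" for j
    proof -
      have \<Gamma>N: "\<Gamma> j \<in> l1_bidual (?N j)" and \<Gamma>inv: "\<And>s f. s \<in> N j \<Longrightarrow> bounded_on (N j) f \<Longrightarrow> 
          pairing (?N j) (\<Gamma> j) (\<lambda>t. f (s \<otimes> t)) = pairing (?N j) (\<Gamma> j) f" and \<Gamma>0: "pairing (?N j) (\<Gamma> j) (\<lambda>_. 1) = 0"
        using \<Gamma>[OF j] invariant_differences_subgroup_iff[OF comp(4)[OF j]] by blast+
      have b\<Gamma>: "bdd_functional (N j) (pairing (?N j) (\<Gamma> j))" using bdd_functional_pairing[OF \<Gamma>N] by simp
      have bFN: "bounded_on (N j) (\<lambda>t. F S (s \<otimes> t))" by (rule bounded_on_subset[OF bFs comp(5)[OF j]])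
      show ?thesis
      proof (cases "s \<in> D")
        case False
        have "s \<otimes> t \<notin> D" if "t \<in> N j" for t
        proof
          assume "s \<otimes> t \<in> D"
          moreover have "t \<in> D" using that comp(3)[OF j] by blast
          moreover have "s = s \<otimes> t \<otimes> inv t" using s \<open>t \<in> D\<close> DG by (simp add: m_assoc subset_iff)
          ultimately show False using False subgroup.m_closed[OF subD] subgroup.m_inv_closed[OF subD] by metis
        qed
        then have "pairing (?N j) (\<Gamma> j) (\<lambda>t. F S (s \<otimes> t)) = 0"
          by (intro bdd_functional_vanish[OF b\<Gamma>]) (simp add: F_def)
        then show ?thesis using False by (simp add: F_def)
      next
        case True
        have tD: "s \<otimes> t \<in> D" if "t \<in> N j" for t
          using that comp(3)[OF j] True subgroup.m_closed[OF subD] by auto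
        have other: "(\<Prod>i\<in>S - {j}. f i (p i (s \<otimes> t))) = F (S - {j}) s" if "t \<in> N j" for t
        proof -
          have "f i (p i (s \<otimes> t)) = f i (p i s)" if "i \<in> S - {j}" for i
            using that p3[of i j s t] S(1) j True \<open>t \<in> N j\<close> by auto
          then show ?thesis using True by (simp add: F_def)
        qed
        show ?thesis
        proof (cases "j \<in> S")
          case False
          then have "pairing (?N j) (\<Gamma> j) (\<lambda>t. F S (s \<otimes> t)) = pairing (?N j) (\<Gamma> j) (\<lambda>_. F S s)"
            using other tD True by (intro bdd_functional_cong[OF b\<Gamma> bFN]) (simp add: F_def)
          then show ?thesis using False bdd_functional_const[OF b\<Gamma>, of "F S s"] \<Gamma>0 by simp
        next
          case j': True
          have "pairing (?N j) (\<Gamma> j) (\<lambda>t. F S (s \<otimes> t)) 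
             = pairing (?N j) (\<Gamma> j) (\<lambda>t. F (S - {j}) s * f j (p j s \<otimes> t))"
          proof (rule bdd_functional_cong[OF b\<Gamma> bFN])
            fix t assume t: "t \<in> N j"
            have "F S (s \<otimes> t) = f j (p j (s \<otimes> t)) * (\<Prod>i\<in>S - {j}. f i (p i (s \<otimes> t)))"
              using tD[OF t] prod.remove[OF S(2) j', of "\<lambda>i. f i (p i (s \<otimes> t))"] by (simp add: F_def)
            then show "F S (s \<otimes> t) = F (S - {j}) s * f j (p j s \<otimes> t)"
              using other[OF t] p2[OF j True t] by simp
          qed
          also have "\<dots> = F (S - {j}) s * pairing (?N j) (\<Gamma> j) (\<lambda>t. f j (p j s \<otimes> t))"
            using f[OF j] p1[OF j True] subgroup.m_closed[OF comp(4)[OF j]]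
            by (intro bdd_functional_cmult[OF b\<Gamma>]) (auto intro: bounded_on_compose)
          also have "\<dots> = F (S - {j}) s * pairing (?N j) (\<Gamma> j) (f j)"
            using \<Gamma>inv[OF p1[OF j True] f[OF j]] by simp
          finally show ?thesis using j' by (simp add: a_def)
        qed
      qed
    qed
    \<comment> \<open>By \<open>one\<close> only the finitely many j in S contribute, so the
      possibly infinite sum representing x reduces to a sum over S.\<close>
    have hs: "((\<lambda>j. if j \<in> S then a j * F (S - {j}) s else 0) has_sum pairing G x (\<lambda>t. F S (s \<otimes> t))) J"
      using x_sum[OF bFs] one by (simp cong: has_sum_cong)
    have hs': "((\<lambda>j. if j \<in> S then a j * F (S - {j}) s else 0) has_sum (\<Sum>j\<in>S. a j * F (S - {j}) s)) J"
      using has_sum_cong_neutral[of J S "\<lambda>j. if j \<in> S then a j * F (S - {j}) s else 0" 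
          "\<lambda>j. if j \<in> S then a j * F (S - {j}) s else 0"] S
        has_sum_finite[OF S(2), of "\<lambda>j. if j \<in> S then a j * F (S - {j}) s else 0"] by auto
    show ?thesis by (rule has_sum_unique[OF hs hs'])
  qed
  \<comment> \<open>The iterate is x^(n+1), hence \<open>card S = Suc n\<close>. Each multiplication
    removes one index from S, and each of the (n+1)! orders of removal contributes the product of
    all \<open>a j\<close>.\<close>
  have "pairing G (((\<lambda>y. l1_arens G y x) ^^ n) x) (F S) = fact (Suc n) * (\<Prod>j\<in>S. a j)"
    if "S \<subseteq> J" "finite S" "card S = Suc n" for n S
    using that
  proof (induction n arbitrary: S)
    case 0
    then obtain j where j: "S = {j}" by (auto simp: card_1_singleton_iff)
    have "pairing G x (F S) = pairing G x (\<lambda>t. F S (\<one> \<otimes> t))"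
      by (rule bdd_functional_cong[OF bdd_functional_pairing[OF x] bF[OF 0(1)]]) simp
    also have "\<dots> = a j * F {} \<one>" using key[OF 0(1,2) one_closed] j by simp
    also have "\<dots> = a j" using subgroup.one_closed[OF subD] by (simp add: F_def)
    finally show ?case using j by simp
  next
    case (Suc n)
    let ?P = "((\<lambda>y. l1_arens G y x) ^^ n) x"
    have PA: "?P \<in> l1_bidual G" by (induction n) (simp_all add: x arens_closed)
    have "pairing G (((\<lambda>y. l1_arens G y x) ^^ Suc n) x) (F S) = pairing G ?P (\<lambda>s. pairing G x (\<lambda>t. F S (s \<otimes> t)))"
      using pairing_arens[OF x bF[OF Suc(2)]] by simp
    also have "\<dots> = pairing G ?P (\<lambda>s. \<Sum>j\<in>S. a j * F (S - {j}) s)"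
      by (rule bdd_functional_cong[OF bdd_functional_pairing[OF PA] bounded_on_pairing[OF x bF[OF Suc(2)] order_refl]
          key[OF Suc(2,3)]])
    also have "\<dots> = (\<Sum>j\<in>S. pairing G ?P (\<lambda>s. a j * F (S - {j}) s))"
      using Suc(2) by (intro bdd_functional_sum[OF bdd_functional_pairing[OF PA]] bounded_on_mult bF) auto
    also have "\<dots> = (\<Sum>j\<in>S. a j * (fact (Suc n) * (\<Prod>i\<in>S - {j}. a i)))"
    proof (rule sum.cong[OF refl])
      fix j assume j: "j \<in> S"
      have "pairing G ?P (F (S - {j})) = fact (Suc n) * (\<Prod>i\<in>S - {j}. a i)"
        using Suc.prems j by (intro Suc.IH) auto
      moreover have "bounded_on (carrier G) (F (S - {j}))" using Suc(2) by (intro bF) auto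
      ultimately show "pairing G ?P (\<lambda>s. a j * F (S - {j}) s) = a j * (fact (Suc n) * (\<Prod>i\<in>S - {j}. a i))"
        using bdd_functional_cmult[OF bdd_functional_pairing[OF PA], of "F (S - {j})" "a j"] by simp
    qed
    also have "\<dots> = (\<Sum>j\<in>S. fact (Suc n) * (\<Prod>i\<in>S. a i))"
      using prod.remove[OF Suc(3), of _ a] by (intro sum.cong refl) (metis mult.left_commute)
    also have "\<dots> = fact (Suc (Suc n)) * (\<Prod>i\<in>S. a i)" using Suc(4) by (simp add: algebra_simps)
    finally show ?case .
  qed
  from this[OF S] have "pairing G (((\<lambda>y. l1_arens G y x) ^^ n) x) (F S) = fact (Suc n) * (\<Prod>j\<in>S. a j)" .
  moreover have "(\<Prod>j\<in>S. a j) \<noteq> 0" using S nonzero by (auto simp: a_def)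
  moreover have "(fact (Suc n) :: complex) \<noteq> 0" by (rule fact_nonzero)
  ultimately have "pairing G (((\<lambda>y. l1_arens G y x) ^^ n) x) (F S) \<noteq> 0" by (metis mult_eq_0_iff)
  then show ?thesis by (auto simp: pairing_def)
qed

end

section \<open>Nonzero invariant differences on infinite amenable groups\<close>

text \<open>Every element is the value \<open>val w\<close> of a word in X and its inverses, and
  there are countably many words.\<close>

lemma (in group) countable_generate:
  assumes X: "X \<subseteq> carrier G" "countable X"
  shows "countable (generate G X)"
proof -
  let ?Y = "X \<union> (\<lambda>x. inv x) ` X"
  define val where "val w = foldr (\<otimes>) w \<one>" for w
  have YG: "?Y \<subseteq> carrier G" using X by auto
  have val_closed: "val w \<in> carrier G" if "w \<in> lists ?Y" for w
    using that YG by (induction w) (auto simp: val_def)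
  have val_append: "val (v @ w) = val v \<otimes> val w" if "v \<in> lists ?Y" "w \<in> lists ?Y" for v w
    using that(1)
  proof (induction v)
    case Nil then show ?case using val_closed[OF that(2)] by (simp add: val_def)
  next
    case (Cons a v)
    then show ?case using val_closed[OF that(2)] val_closed[of v] YG by (auto simp: val_def m_assoc)
  qed
  have single: "val [y] = y" if "y \<in> ?Y" for y using that YG by (auto simp: val_def)
  have "generate G X \<subseteq> val ` lists ?Y"
  proof
    fix g assume "g \<in> generate G X"
    then show "g \<in> val ` lists ?Y"
    proof (induction rule: generate.induct)
      case one show ?case by (rule image_eqI[of _ _ "[]"]) (simp_all add: val_def)
    next
      case (incl h) then show ?case using single[of h] by (intro image_eqI[of _ _ "[h]"]) auto
    next
      case (inv h) then show ?case using single[of "inv h"] by (intro image_eqI[of _ _ "[inv h]"]) auto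
    next
      case (eng h1 h2)
      then obtain v w where vw: "v \<in> lists ?Y" "h1 = val v" "w \<in> lists ?Y" "h2 = val w" by blast
      then have "h1 \<otimes> h2 = val (v @ w)" using val_append by simp
      then show ?case using vw by (metis append_in_lists_conv image_eqI)
    qed
  qed
  moreover have "countable (val ` lists ?Y)" using X(2) by (intro countable_image countable_lists) auto
  ultimately show ?thesis by (rule countable_subset)
qed

text \<open>The construction of an invariant difference enumerates group elements and therefore
  works inside a countable subgroup.\<close>

lemma (in group) infinite_subgroup_has_countable:
  assumes L: "subgroup L G" "infinite L"
  obtains C where "subgroup C G" "C \<subseteq> L" "countable C" "infinite C"
proof -
  obtain X where X: "X \<subseteq> L" "infinite X" "countable X"
    using infinite_countable_subset'[OF L(2)] by blast
  have XG: "X \<subseteq> carrier G" using X L(1) subgroup.subset by blast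
  have "X \<subseteq> generate G X" by (auto intro: generate.incl)
  then show ?thesis
    using that generate_is_subgroup[OF XG] generate_subgroup_incl[OF X(1) L(1)] 
      countable_generate[OF XG X(3)] X(2) infinite_super by blast
qed

text \<open>Choose a representative r in each right coset S g and put \<phi> g = g r^-1; multiplying
  g on the left by u in S keeps the coset and hence r. Composition with \<phi> carries functions on
  S to functions on G, compatibly with left translation by S.\<close>

lemma (in group) subgroup_equivariant_map:
  assumes S: "subgroup S G"
  obtains \<phi> where "\<And>g. g \<in> carrier G \<Longrightarrow> \<phi> g \<in> S"
    "\<And>u g. u \<in> S \<Longrightarrow> g \<in> carrier G \<Longrightarrow> \<phi> (u \<otimes> g) = u \<otimes> \<phi> g"
proof -
  define r where "r g = (SOME x. x \<in> S #> g)" for g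
  have SG: "S \<subseteq> carrier G" by (rule subgroup.subset[OF S])
  have r: "r g \<in> S #> g" if "g \<in> carrier G" for g
    unfolding r_def using rcos_self[OF that S] by (rule someI)
  have rG: "r g \<in> carrier G" if "g \<in> carrier G" for g
    using r[OF that] r_coset_subset_G[OF SG that] by blast
  have coset: "S #> (u \<otimes> g) = S #> g" if "u \<in> S" "g \<in> carrier G" for u g
    using that SG coset_mult_assoc[OF SG _ that(2), of u] coset_join2[OF _ S that(1)] by auto
  show ?thesis
  proof (rule that[of "\<lambda>g. g \<otimes> inv (r g)"])
    fix g assume g: "g \<in> carrier G"
    obtain s where s: "s \<in> S" "r g = s \<otimes> g" using r[OF g] by (auto simp: r_coset_def)
    then have "g \<otimes> inv (r g) = inv s" using g SG by (simp add: inv_mult_group m_assoc[symmetric] subset_iff)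
    then show "g \<otimes> inv (r g) \<in> S" using s S by (simp add: subgroup.m_inv_closed)
    fix u assume u: "u \<in> S"
    then have "r (u \<otimes> g) = r g" using coset[OF u g] by (simp add: r_def)
    then show "u \<otimes> g \<otimes> inv (r (u \<otimes> g)) = u \<otimes> (g \<otimes> inv (r g))"
      using g u SG rG[OF g] by (simp add: m_assoc subset_iff)
  qed
qed

section \<open>Invariant means and the construction of a nonzero invariant difference\<close>

context group
begin

text \<open>The name is loose: positivity is not required.\<close>

definition invariant_mean where
  "invariant_mean S m \<longleftrightarrow> bdd_functional S m \<and> m (\<lambda>_. 1) = 1 \<and>
     (\<forall>s\<in>S. \<forall>f. bounded_on S f \<longrightarrow> m (\<lambda>t. f (s \<otimes> t)) = m f)"

text \<open>A mean on G cannot simply be restricted to S, so functions on S are pulled back to G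
  along the equivariant map \<phi>.\<close>

lemma amenable_subgroup_invariant_mean:
  assumes am: "amenable_group G" and S: "subgroup S G"
  obtains m where "invariant_mean S m"
proof -
  obtain M where M: "M \<in> l1_bidual G" and M1: "pairing G M (\<lambda>_. 1) = 1"
    and Minv: "\<And>s. s \<in> carrier G \<Longrightarrow> l1_arens G (bidual_point_mass G s) M = M"
    using am by (auto simp: amenable_group_def pairing_def)
  note bM = bdd_functional_pairing[OF M]
  obtain \<phi> where \<phi>: "\<And>g. g \<in> carrier G \<Longrightarrow> \<phi> g \<in> S"
    "\<And>u g. u \<in> S \<Longrightarrow> g \<in> carrier G \<Longrightarrow> \<phi> (u \<otimes> g) = u \<otimes> \<phi> g"
    using subgroup_equivariant_map[OF S] by metis
  define m where "m f = pairing G M (\<lambda>g. f (\<phi> g))" for f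
  have b\<phi>: "bounded_on (carrier G) (\<lambda>g. f (\<phi> g))" if "bounded_on S f" for f
    using bounded_on_compose[OF that] \<phi>(1) by metis
  have SG: "S \<subseteq> carrier G" by (rule subgroup.subset[OF S])
  obtain K where K: "K \<ge> 0"
    "\<And>f L. L \<ge> 0 \<Longrightarrow> (\<And>x. x \<in> carrier G \<Longrightarrow> cmod (f x) \<le> L) \<Longrightarrow> cmod (pairing G M f) \<le> K * L"
    using bdd_functional_bound[OF bM] by metis
  have "cmod (m f) \<le> K * L" if "L \<ge> 0" "\<forall>x\<in>S. cmod (f x) \<le> L" for f L
    unfolding m_def using that \<phi>(1) by (intro K(2)) auto
  then have "bdd_functional S m"
    unfolding bdd_functional_def using K(1) bdd_functional_add[OF bM b\<phi> b\<phi>] bdd_functional_cmult[OF bM b\<phi>]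
    by (intro conjI allI impI exI[of _ K]) (auto simp: m_def)
  moreover have "m (\<lambda>_. 1) = 1" using M1 by (simp add: m_def)
  moreover have "m (\<lambda>t. f (s \<otimes> t)) = m f" if s: "s \<in> S" and f: "bounded_on S f" for s f
  proof -
    have sG: "s \<in> carrier G" using s SG by blast
    have "m (\<lambda>t. f (s \<otimes> t)) = pairing G M (\<lambda>g. f (\<phi> (s \<otimes> g)))"
      unfolding m_def
    proof (rule bdd_functional_cong[OF bM])
      show "bounded_on (carrier G) (\<lambda>g. f (s \<otimes> \<phi> g))"
        using f \<phi>(1) s S by (auto intro: bounded_on_compose simp: subgroup.m_closed)
      show "f (s \<otimes> \<phi> g) = f (\<phi> (s \<otimes> g))" if "g \<in> carrier G" for g using \<phi>(2)[OF s that] by simp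
    qed
    also have "\<dots> = pairing G M (\<lambda>g. f (\<phi> g))"
      using translation_invariant_iff[OF M sG] Minv[OF sG] b\<phi>[OF f] by blast
    finally show ?thesis by (simp add: m_def)
  qed
  ultimately have "invariant_mean S m" by (simp add: invariant_mean_def)
  then show ?thesis by (rule that)
qed

text \<open>By invariance all point masses have the same value e, and a sum of n distinct ones is
  bounded by 1, so n |e| stays bounded and e = 0. Finite sets are thus negligible, and the
  functional behaves like a limit along C.\<close>

lemma invariant_mean_cofinite:
  assumes m: "invariant_mean C m" and C: "subgroup C G" "infinite C"
    and g: "bounded_on C g" and F: "finite F" "F \<subseteq> C" "\<And>c. c \<in> C - F \<Longrightarrow> g c = 1"
  shows "m g = 1"
proof -
  have bm: "bdd_functional C m" and m1: "m (\<lambda>_. 1) = 1"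
    and inv: "\<And>s f. s \<in> C \<Longrightarrow> bounded_on C f \<Longrightarrow> m (\<lambda>t. f (s \<otimes> t)) = m f"
    using m by (auto simp: invariant_mean_def)
  have CG: "C \<subseteq> carrier G" by (rule subgroup.subset[OF C(1)])
  have bpm: "bounded_on C (point_mass c)" for c
    by (rule bounded_onI[of _ _ 1]) (simp add: point_mass_def)
  have same: "m (point_mass c) = m (point_mass \<one>)" if c: "c \<in> C" for c
  proof -
    have "m (point_mass c) = m (\<lambda>t. point_mass c (c \<otimes> t))" using inv[OF c bpm] by simp
    also have "\<dots> = m (point_mass \<one>)"
    proof (rule bdd_functional_cong[OF bm])
      show "bounded_on C (\<lambda>t. point_mass c (c \<otimes> t))"
        using bounded_on_compose[of C "point_mass c" C "\<lambda>t. c \<otimes> t"] bpm c subgroup.m_closed[OF C(1)] 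
        by blast
      show "point_mass c (c \<otimes> t) = point_mass \<one> t" if "t \<in> C" for t
        using that c CG by (auto simp: point_mass_def subset_iff)
    qed
    finally show ?thesis .
  qed
  define e where "e = m (point_mass \<one>)"
  obtain K where K: "K \<ge> 0"
    "\<And>f L. L \<ge> 0 \<Longrightarrow> (\<And>x. x \<in> C \<Longrightarrow> cmod (f x) \<le> L) \<Longrightarrow> cmod (m f) \<le> K * L"
    using bdd_functional_bound[OF bm] by metis
  have card_e: "real n * cmod e \<le> K" for n
  proof -
    obtain T where T: "finite T" "card T = n" "T \<subseteq> C" using infinite_arbitrarily_large[OF C(2)] by metis
    have "m (\<lambda>x. \<Sum>t\<in>T. point_mass t x) = (\<Sum>t\<in>T. m (point_mass t))"
      by (rule bdd_functional_sum[OF bm bpm])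
    also have "\<dots> = of_nat n * e" using same T by (simp add: e_def subset_iff)
    finally have "real n * cmod e = cmod (m (\<lambda>x. \<Sum>t\<in>T. point_mass t x))" by (simp add: norm_mult)
    also have "\<dots> \<le> K * 1" using T by (intro K(2)) (auto simp: point_mass_def)
    finally show ?thesis by simp
  qed
  have "e = 0"
  proof (rule ccontr)
    assume "e \<noteq> 0"
    then obtain n where "real n * cmod e > K" using reals_Archimedean3[of "cmod e"] by auto
    then show False using card_e[of n] by simp
  qed
  then have pm0: "m (point_mass c) = 0" if "c \<in> C" for c using same[OF that] by (simp add: e_def)
  have bh: "bounded_on C (\<lambda>x. \<Sum>c\<in>F. (g c - 1) * point_mass c x)"
    by (intro bounded_on_sum bounded_on_mult bpm bounded_on_const)
  have "m g = m (\<lambda>x. 1 + (\<Sum>c\<in>F. (g c - 1) * point_mass c x))"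
  proof (rule bdd_functional_cong[OF bm g])
    fix x assume "x \<in> C"
    have "(\<Sum>c\<in>F. (g c - 1) * point_mass c x) = (\<Sum>c\<in>F. if x = c then g c - 1 else 0)"
      by (intro sum.cong) (auto simp: point_mass_def)
    then show "g x = 1 + (\<Sum>c\<in>F. (g c - 1) * point_mass c x)"
      using F(1,3) \<open>x \<in> C\<close> by simp
  qed
  also have "\<dots> = 1 + m (\<lambda>x. \<Sum>c\<in>F. (g c - 1) * point_mass c x)"
    using bdd_functional_add[OF bm bounded_on_const[of _ 1] bh] m1 by simp
  also have "m (\<lambda>x. \<Sum>c\<in>F. (g c - 1) * point_mass c x) = (\<Sum>c\<in>F. m (\<lambda>x. (g c - 1) * point_mass c x))"
    by (intro bdd_functional_sum[OF bm] bounded_on_mult bpm bounded_on_const)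
  also have "\<dots> = 0"
    using F(2) pm0 bdd_functional_cmult[OF bm bpm] by (intro sum.neutral) auto
  finally show ?thesis by simp
qed

text \<open>Recursive choice: at stage n only finitely many x in C produce a coincidence c_a x = c_b
  z_i with i < n, and C is infinite.\<close>

lemma disjoint_translates:
  fixes c :: "nat \<Rightarrow> 'a"
  assumes C: "subgroup C G" "infinite C" and c: "\<And>n. c n \<in> C"
  obtains z where "\<And>n. z n \<in> C" "\<And>n i a b. a \<le> n \<Longrightarrow> b \<le> i \<Longrightarrow> n \<noteq> i \<Longrightarrow> c a \<otimes> z n \<noteq> c b \<otimes> z i"
proof -
  have CG: "C \<subseteq> carrier G" by (rule subgroup.subset[OF C(1)])
  define P where "P z n x \<longleftrightarrow> x \<in> C \<and> (\<forall>i<n. \<forall>a\<le>n. \<forall>b\<le>i. c a \<otimes> x \<noteq> c b \<otimes> z i)"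
    for z :: "nat \<Rightarrow> 'a" and n x
  have ex: "\<exists>x. P z n x" for z n
  proof -
    let ?bad = "(\<lambda>(i, a, b). inv (c a) \<otimes> (c b \<otimes> z i)) ` ({..<n} \<times> {..n} \<times> {..n})"
    have "finite ?bad" by simp
    then obtain x where x: "x \<in> C" "x \<notin> ?bad" using C(2) by (meson finite_subset subsetI)
    have "c a \<otimes> x \<noteq> c b \<otimes> z i" if "i < n" "a \<le> n" "b \<le> i" for i a b
    proof
      assume eq: "c a \<otimes> x = c b \<otimes> z i"
      have "x = inv (c a) \<otimes> (c a \<otimes> x)" using c[of a] x(1) CG by (simp add: m_assoc[symmetric] subset_iff)
      then have "x = inv (c a) \<otimes> (c b \<otimes> z i)" using eq by simp
      then show False using x(2) that by (force intro!: image_eqI[of _ _ "(i, a, b)"])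
    qed
    then show ?thesis using x(1) by (auto simp: P_def)
  qed
  have "\<exists>z. \<forall>n. P z n (z n)"
    by (rule dependent_wf_choice[of "{(m, n). m < n}"]) (use ex in \<open>auto simp: wf_less P_def\<close>)
  then obtain z where z: "\<And>n. P z n (z n)" by blast
  have zlt: "c a \<otimes> z n \<noteq> c b \<otimes> z i" if "i < n" "a \<le> n" "b \<le> i" for n i a b 
    using z[of n] that by (auto simp: P_def)
  show ?thesis
  proof (rule that)
    show "z n \<in> C" for n using z[of n] by (simp add: P_def)
    show "c a \<otimes> z n \<noteq> c b \<otimes> z i" if "a \<le> n" "b \<le> i" "n \<noteq> i" for n i a b
      using zlt[of i n a b] zlt[of n i b a] that by (metis nat_neq_iff)
  qed
qed

text \<open>
  With \<open>C \<le> L\<close> countable and \<open>z\<close> such that the sets \<open>{c\<^sub>0, \<dots>, c\<^sub>n} z\<^sub>n\<close> are disjoint, \<open>\<Gamma>\<close> is the product of an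
  invariant mean on \<open>L\<close> with a limit \<open>\<Theta>\<close> of the differences of point masses at \<open>z\<^sub>2\<^sub>n\<close> and \<open>z\<^sub>2\<^sub>n\<^sub>+\<^sub>1\<close>. The
  union of these sets over even \<open>n\<close>, pulled back to \<open>L\<close>, contains \<open>s z\<^sub>2\<^sub>n\<close> but not \<open>s z\<^sub>2\<^sub>n\<^sub>+\<^sub>1\<close> for
  every \<open>s\<close> and almost all \<open>n\<close>.
\<close>

lemma exists_nonzero_invariant_difference:
  assumes am: "amenable_group G" and L: "subgroup L G" "infinite L"
  obtains \<Gamma> f where "\<Gamma> \<in> invariant_differences (G\<lparr>carrier := L\<rparr>)" "bounded_on L f"
    "pairing (G\<lparr>carrier := L\<rparr>) \<Gamma> f = 1"
proof -
  obtain C where C: "subgroup C G" "C \<subseteq> L" "countable C" "infinite C"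
    using infinite_subgroup_has_countable[OF L] by metis
  have CG: "C \<subseteq> carrier G" and LG: "L \<subseteq> carrier G" using C(1) L(1) by (auto simp: subgroup.subset)
  define c where "c = from_nat_into C"
  have cC: "c n \<in> C" for n unfolding c_def using C(4) by (intro from_nat_into) auto
  have c_surj: "c (to_nat_on C x) = x" if "x \<in> C" for x using that C(3) by (simp add: c_def)
  obtain z where zC: "\<And>n. z n \<in> C" 
    and z: "\<And>n i a b. a \<le> n \<Longrightarrow> b \<le> i \<Longrightarrow> n \<noteq> i \<Longrightarrow> c a \<otimes> z n \<noteq> c b \<otimes> z i"
    using disjoint_translates[of C c, OF C(1,4) cC] by metis
  obtain mC where mC: "invariant_mean C mC" using amenable_subgroup_invariant_mean[OF am C(1)] by metis
  obtain mL where mL: "invariant_mean L mL" using amenable_subgroup_invariant_mean[OF am L(1)] by metis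
  have bC: "bdd_functional C mC" and bL: "bdd_functional L mL" and mL1: "mL (\<lambda>_. 1) = 1"
    and invL: "\<And>s f. s \<in> L \<Longrightarrow> bounded_on L f \<Longrightarrow> mL (\<lambda>t. f (s \<otimes> t)) = mL f"
    using mC mL by (auto simp: invariant_mean_def)
  obtain \<phi> where \<phi>: "\<And>g. g \<in> carrier G \<Longrightarrow> \<phi> g \<in> C"
    "\<And>u g. u \<in> C \<Longrightarrow> g \<in> carrier G \<Longrightarrow> \<phi> (u \<otimes> g) = u \<otimes> \<phi> g"
    using subgroup_equivariant_map[OF C(1)] by metis
  \<comment> \<open>Inverting before and after turns the left equivariance of \<phi> into right
    equivariance, as needed for evaluation at products \<open>s \<otimes> z n\<close> with
    \<open>z n\<close> in C.\<close>
  define \<rho> where "\<rho> g = inv (\<phi> (inv g))" for g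
  have \<rho>: "\<rho> g \<in> C" "u \<in> C \<Longrightarrow> \<rho> (g \<otimes> u) = \<rho> g \<otimes> u" if "g \<in> carrier G" for g u
  proof -
    show "\<rho> g \<in> C" unfolding \<rho>_def using that C(1) \<phi>(1) by (simp add: subgroup.m_inv_closed)
    assume u: "u \<in> C"
    have "\<phi> (inv u \<otimes> inv g) = inv u \<otimes> \<phi> (inv g)"
      using that u C(1) by (intro \<phi>(2)) (auto simp: subgroup.m_inv_closed)
    then show "\<rho> (g \<otimes> u) = \<rho> g \<otimes> u" 
      unfolding \<rho>_def using that u CG \<phi>(1)[of "inv g"] by (simp add: inv_mult_group subset_iff)
  qed
  define E where "E = {c a \<otimes> z n |a n. a \<le> n \<and> even n}"
  \<comment> \<open>C itself, through its numbering, indexes the sequence, so that an invariant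
    functional on C can serve as the limit. All values of \<open>q\<close> are even.\<close>
  define q where "q x = 2 * to_nat_on C x" for x
  define \<Theta> where "\<Theta> h = mC (\<lambda>x. h (z (q x)) - h (z (Suc (q x))))" for h
  have zL: "z n \<in> L" for n using zC C(2) by blast
  have bz: "bounded_on C (\<lambda>x. h (z (k x)))" if "bounded_on L h" for h k
    using that zL by (auto intro: bounded_on_compose)
  have \<Theta>_add: "\<Theta> (\<lambda>x. h x + h' x) = \<Theta> h + \<Theta> h'" if "bounded_on L h" "bounded_on L h'" for h h'
    using bdd_functional_add[OF bC bounded_on_diff[OF bz[OF that(1), of q] bz[OF that(1), of "\<lambda>x. Suc (q x)"]] 
        bounded_on_diff[OF bz[OF that(2), of q] bz[OF that(2), of "\<lambda>x. Suc (q x)"]]]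
    by (simp add: \<Theta>_def algebra_simps)
  have \<Theta>_cmult: "\<Theta> (\<lambda>x. k * h x) = k * \<Theta> h" if "bounded_on L h" for k h
    using bdd_functional_cmult[OF bC bounded_on_diff[OF bz[OF that, of q] bz[OF that, of "\<lambda>x. Suc (q x)"]], of k]
    by (simp add: \<Theta>_def algebra_simps)
  obtain K where K: "K \<ge> 0"
    "\<And>f B. B \<ge> 0 \<Longrightarrow> (\<And>x. x \<in> C \<Longrightarrow> cmod (f x) \<le> B) \<Longrightarrow> cmod (mC f) \<le> K * B"
    using bdd_functional_bound[OF bC] by metis
  have \<Theta>_bound: "cmod (\<Theta> h) \<le> (2 * K) * B" if "B \<ge> 0" "\<forall>x\<in>L. cmod (h x) \<le> B" for h B
  proof -
    have "cmod (\<Theta> h) \<le> K * (2 * B)"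
      unfolding \<Theta>_def
    proof (rule K(2))
      show "cmod (h (z (q x)) - h (z (Suc (q x)))) \<le> 2 * B" for x
        using norm_triangle_ineq4[of "h (z (q x))" "h (z (Suc (q x)))"] that(2) zL by (smt (verit))
    qed (use that in simp)
    then show ?thesis by simp
  qed
  have "\<exists>C\<ge>0. \<forall>f B. B \<ge> 0 \<longrightarrow> (\<forall>x\<in>L. cmod (f x) \<le> B) \<longrightarrow> cmod (\<Theta> f) \<le> C * B"
    using \<Theta>_bound K(1) by (intro exI[of _ "2 * K"]) simp
  then have b\<Theta>: "bdd_functional L \<Theta>" unfolding bdd_functional_def using \<Theta>_add \<Theta>_cmult by simp
  have Lm: "s \<otimes> t \<in> L" if "s \<in> L" "t \<in> L" for s t using that L(1) by (simp add: subgroup.m_closed)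
  have shift: "bounded_on L (\<lambda>t. h (s \<otimes> t))" if "bounded_on L h" "s \<in> L" for h s
    using that Lm by (auto intro: bounded_on_compose)
  have b\<Theta>s: "bounded_on L (\<lambda>s. \<Theta> (\<lambda>t. h (s \<otimes> t)))" if h: "bounded_on L h" for h
  proof -
    obtain B where "B \<ge> 0" "\<And>x. x \<in> L \<Longrightarrow> cmod (h x) \<le> B" using bounded_onE[OF h] by metis
    then show ?thesis using Lm by (intro bdd_functional_bounded_on[OF b\<Theta>]) auto
  qed
  \<comment> \<open>Averaging the left translates of \<Theta> by \<open>mL\<close> makes the result
    left invariant under L, while constants are still annihilated.\<close>
  define g where "g h = mL (\<lambda>s. \<Theta> (\<lambda>t. h (s \<otimes> t)))" for h
  let ?L = "G\<lparr>carrier := L\<rparr>"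
  have "bdd_functional L g"
  proof -
    obtain D where D: "D \<ge> 0"
      "\<And>f B. B \<ge> 0 \<Longrightarrow> (\<And>x. x \<in> L \<Longrightarrow> cmod (f x) \<le> B) \<Longrightarrow> cmod (mL f) \<le> D * B"
      using bdd_functional_bound[OF bL] by metis
    have "cmod (g h) \<le> (D * (2 * K)) * B" if "B \<ge> 0" "\<forall>x\<in>L. cmod (h x) \<le> B" for h B
      unfolding g_def mult.assoc[of D] using that K(1) Lm by (intro D(2) \<Theta>_bound) auto
    then have "\<exists>C\<ge>0. \<forall>f B. B \<ge> 0 \<longrightarrow> (\<forall>x\<in>L. cmod (f x) \<le> B) \<longrightarrow> cmod (g f) \<le> C * B"
      using D(1) K(1) by (intro exI[of _ "D * (2 * K)"]) simp
    moreover have "g (\<lambda>x. h x + h' x) = g h + g h'" if hh: "bounded_on L h" "bounded_on L h'" for h h'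
    proof -
      have "g (\<lambda>x. h x + h' x) = mL (\<lambda>s. \<Theta> (\<lambda>t. h (s \<otimes> t)) + \<Theta> (\<lambda>t. h' (s \<otimes> t)))"
        unfolding g_def using \<Theta>_add[OF shift[OF hh(1)] shift[OF hh(2)]] 
        by (intro bdd_functional_cong[OF bL b\<Theta>s[OF bounded_on_add[OF hh]]])
      then show ?thesis using bdd_functional_add[OF bL b\<Theta>s[OF hh(1)] b\<Theta>s[OF hh(2)]] by (simp add: g_def)
    qed
    moreover have "g (\<lambda>x. k * h x) = k * g h" if h: "bounded_on L h" for k h
    proof -
      have "g (\<lambda>x. k * h x) = mL (\<lambda>s. k * \<Theta> (\<lambda>t. h (s \<otimes> t)))"
        unfolding g_def using \<Theta>_cmult[OF shift[OF h]]
        by (intro bdd_functional_cong[OF bL b\<Theta>s[OF bounded_on_mult[OF bounded_on_const h]]])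
      then show ?thesis using bdd_functional_cmult[OF bL b\<Theta>s[OF h]] by (simp add: g_def)
    qed
    ultimately show ?thesis unfolding bdd_functional_def by simp
  qed
  then have bg: "bdd_functional (carrier ?L) g" by simp
  define \<Gamma> where "\<Gamma> = bidual_of ?L g"
  have p\<Gamma>: "pairing ?L \<Gamma> h = g h" if "bounded_on L h" for h
    unfolding \<Gamma>_def using pairing_bidual_of[OF bg] that by simp
  have g_inv: "g (\<lambda>t. h (s \<otimes> t)) = g h" if s: "s \<in> L" and h: "bounded_on L h" for s h
  proof -
    define k where "k = (\<lambda>u. \<Theta> (\<lambda>t. h (u \<otimes> t)))"
    have "g (\<lambda>t. h (s \<otimes> t)) = mL (\<lambda>u. k (s \<otimes> u))"
      unfolding g_def
    proof (rule bdd_functional_cong[OF bL b\<Theta>s[OF shift[OF h s]]])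
      fix u assume u: "u \<in> L"
      show "\<Theta> (\<lambda>t. h (s \<otimes> (u \<otimes> t))) = k (s \<otimes> u)"
        unfolding k_def using s u LG
        by (intro bdd_functional_cong[OF b\<Theta> shift[OF shift[OF h s] u]]) (auto simp: m_assoc subset_iff)
    qed
    also have "\<dots> = mL k" using invL[OF s] b\<Theta>s[OF h] by (simp add: k_def)
    finally show ?thesis by (simp add: g_def k_def)
  qed
  have "g (\<lambda>_. 1) = 0"
    using bdd_functional_zero[OF bC] bdd_functional_zero[OF bL] by (simp add: g_def \<Theta>_def)
  then have \<Gamma>: "\<Gamma> \<in> invariant_differences ?L"
    using invariant_differences_subgroup_iff[OF L(1)] bidual_of_in_bidual[OF bg] p\<Gamma> g_inv shift
    by (auto simp: \<Gamma>_def)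
  define f where "f t = (if \<rho> t \<in> E then 1 else 0 :: complex)" for t
  have bf: "bounded_on L f" by (rule bounded_onI[of _ _ 1]) (simp add: f_def)
  \<comment> \<open>The value is 1 at every s in L, so averaging over s loses nothing.\<close>
  have \<Theta>1: "\<Theta> (\<lambda>t. f (s \<otimes> t)) = 1" if s: "s \<in> L" for s
    unfolding \<Theta>_def
  proof (rule invariant_mean_cofinite[OF mC C(1,4)])
    have sG: "s \<in> carrier G" using s LG by blast
    have fs: "bounded_on L (\<lambda>t. f (s \<otimes> t))" by (rule shift[OF bf s])
    show "bounded_on C (\<lambda>x. f (s \<otimes> z (q x)) - f (s \<otimes> z (Suc (q x))))"
      using bounded_on_diff[OF bz[OF fs, of q] bz[OF fs, of "\<lambda>x. Suc (q x)"]] .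
    \<comment> \<open>\<open>\<rho> s\<close> has number k in the enumeration of C. Once
      \<open>k \<le> q x\<close> it takes part in the disjointness at \<open>z (q x)\<close> and at
      \<open>z (Suc (q x))\<close>; only finitely many x fail this.\<close>
    define k where "k = to_nat_on C (\<rho> s)"
    have ck: "c k = \<rho> s" unfolding k_def by (rule c_surj[OF \<rho>(1)[OF sG]])
    let ?F = "{x \<in> C. to_nat_on C x < k}"
    have "?F \<subseteq> c ` {..<k}" using c_surj by force
    then show "finite ?F" by (rule finite_subset) simp
    show "?F \<subseteq> C" by blast
    fix x assume x: "x \<in> C - ?F"
    then have kq: "k \<le> q x" by (auto simp: q_def)
    have "c k \<otimes> z (q x) \<in> E" unfolding E_def using kq
      by (intro CollectI exI[of _ k] exI[of _ "q x"]) (simp add: q_def)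
    moreover have "c k \<otimes> z (Suc (q x)) \<notin> E"
    proof
      assume "c k \<otimes> z (Suc (q x)) \<in> E"
      then obtain a n where an: "c k \<otimes> z (Suc (q x)) = c a \<otimes> z n" "a \<le> n" "even n" by (auto simp: E_def)
      moreover have "Suc (q x) \<noteq> n" using an(3) by (auto simp: q_def)
      ultimately show False using z[of k "Suc (q x)" a n] kq by simp
    qed
    ultimately show "f (s \<otimes> z (q x)) - f (s \<otimes> z (Suc (q x))) = 1"
      using \<rho>(2)[OF sG zC] ck by (simp add: f_def)
  qed
  have "g f = mL (\<lambda>_. 1)"
    unfolding g_def by (rule bdd_functional_cong[OF bL b\<Theta>s[OF bf] \<Theta>1])
  then have "pairing ?L \<Gamma> f = 1" using p\<Gamma>[OF bf] mL1 by simp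
  then show ?thesis using that \<Gamma> bf by blast
qed

end

section \<open>Branch groups\<close>

context group
begin

text \<open>K_n contains N_n and all later factors, while K_(n+1) commutes with N_n and meets it
  trivially. For independence of N_j, the factors before j are separated from K_j and those after j
  lie in K_(j+1), so the infinite family is handled by finite peeling.\<close>

lemma nested_complements_direct_product:
  fixes N K :: "nat \<Rightarrow> 'a set"
  assumes N: "\<And>n. subgroup (N n) G" and K: "\<And>n. subgroup (K n) G"
    and NK: "\<And>n. N n \<subseteq> K n" and KK: "\<And>n. K (Suc n) \<subseteq> K n"
    and disj: "\<And>n. N n \<inter> K (Suc n) \<subseteq> {\<one>}"
    and comm: "\<And>n a b. a \<in> N n \<Longrightarrow> b \<in> K (Suc n) \<Longrightarrow> a \<otimes> b = b \<otimes> a"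
  shows "internal_direct_product G (generate G (\<Union>n. N n)) UNIV N"
proof -
  have NG: "N n \<subseteq> carrier G" and KG: "K n \<subseteq> carrier G" for n 
    using N[of n] K[of n] by (auto simp: subgroup.subset)
  have mono: "K n \<subseteq> K m" if "m \<le> n" for m n
    by (rule lift_Suc_antimono_le[of K, OF KK that])
  have NKlt: "N j \<subseteq> K (Suc i)" if "i < j" for i j
    using NK[of j] mono[of "Suc i" j] that by auto
  have comm': "a \<otimes> b = b \<otimes> a" if "i \<noteq> j" "a \<in> N i" "b \<in> N j" for i j a b
    using that comm[of a i b] comm[of b j a] NKlt[of i j] NKlt[of j i] by (metis nat_neq_iff subsetD)
  let ?W = "\<lambda>n. generate G (\<Union>i<n. N i)"
  \<comment> \<open>Separates the first n factors from the tail. In the step b and w both lie in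
    K_n, so a = w b^-1 does too and is trivial by induction; then w = b lies in N_n and in
    K_(n+1).\<close>
  have WK: "w = \<one>" if "w \<in> ?W n" "w \<in> K n" for w n
    using that
  proof (induction n arbitrary: w)
    case 0 then show ?case using generate_empty by auto
  next
    case (Suc n)
    have "(\<Union>i<Suc n. N i) = (\<Union>i<n. N i) \<union> N n" by (auto simp: lessThan_Suc)
    then have "w \<in> generate G ((\<Union>i<n. N i) \<union> N n)" using Suc(2) by simp
    moreover have "a \<otimes> b = b \<otimes> a" if "a \<in> (\<Union>i<n. N i)" "b \<in> N n" for a b 
      using that comm'[of _ n a b] by (metis UN_E lessThan_iff less_irrefl)
    ultimately obtain a b where ab: "a \<in> ?W n" "b \<in> N n" "w = a \<otimes> b"
      using generate_commuting_Un[of "\<Union>i<n. N i" "N n" w] N NG by blast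
    have WG: "(\<Union>i<n. N i) \<subseteq> carrier G" using NG by blast
    have c: "a \<in> carrier G" "b \<in> carrier G" using ab NG generate_in_carrier[OF WG] by auto
    have "b \<in> K n" "w \<in> K n" using ab(2) NK[of n] Suc(3) KK[of n] by auto
    then have "w \<otimes> inv b \<in> K n" using K subgroup.m_closed subgroup.m_inv_closed by metis
    moreover have "w \<otimes> inv b = a" using c ab(3) by (simp add: m_assoc)
    ultimately have "a = \<one>" using Suc.IH[OF ab(1)] by simp
    then have "w = b" using ab(3) c by simp
    then show ?case using disj[of n] ab(2) Suc(3) by blast
  qed
  have UG: "(\<Union>n. N n) \<subseteq> carrier G" using NG by blast
  define D where "D = generate G (\<Union>n. N n)"
  have D: "subgroup D G" unfolding D_def by (rule generate_is_subgroup[OF UG])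
  have ND: "N n \<subseteq> D" for n by (auto simp: D_def intro: generate.incl)
  have norm: "N n \<lhd> G\<lparr>carrier := D\<rparr>" for n
  proof -
    interpret GD: group "G\<lparr>carrier := D\<rparr>" by (rule subgroup.subgroup_is_group[OF D is_group])
    \<comment> \<open>The part a of x coming from the other factors commutes with N_n, so
      conjugation by x acts on N_n as conjugation by the part b in N_n.\<close>
    have conj: "x \<otimes> h \<otimes> inv x \<in> N n" if "x \<in> D" "h \<in> N n" for x h
    proof -
      have UG': "(\<Union>i\<in>-{n}. N i) \<subseteq> carrier G" using NG by blast
      have "(\<Union>n. N n) = (\<Union>i\<in>-{n}. N i) \<union> N n" by auto
      then have "x \<in> generate G ((\<Union>i\<in>-{n}. N i) \<union> N n)" using that(1) by (simp add: D_def)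
      moreover have "a \<otimes> b = b \<otimes> a" if "a \<in> (\<Union>i\<in>-{n}. N i)" "b \<in> N n" for a b 
        using that comm'[of _ n a b] by auto
      ultimately obtain a b where ab: "a \<in> generate G (\<Union>i\<in>-{n}. N i)" "b \<in> N n" "x = a \<otimes> b"
        using generate_commuting_Un[OF UG' N, of n x] by blast
      have bh: "b \<otimes> h \<otimes> inv b \<in> N n" 
        using ab(2) that(2) N subgroup.m_closed subgroup.m_inv_closed by metis
      have c: "a \<in> carrier G" "b \<in> carrier G" "h \<in> carrier G" 
        using ab that(2) NG generate_in_carrier[OF UG'] by auto
      have "x \<otimes> h \<otimes> inv x = a \<otimes> (b \<otimes> h \<otimes> inv b) \<otimes> inv a"
        using ab(3) c by (simp add: inv_mult_group m_assoc)
      also have "a \<otimes> (b \<otimes> h \<otimes> inv b) = (b \<otimes> h \<otimes> inv b) \<otimes> a"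
        using comm'[of _ n] bh NG[of n] by (intro generate_commute[OF UG' _ _ ab(1)]) auto
      also have "\<dots> \<otimes> inv a = b \<otimes> h \<otimes> inv b" using c by (simp add: m_assoc)
      finally show ?thesis using bh by simp
    qed
    show ?thesis
      unfolding GD.normal_inv_iff
      using subgroup_incl[OF N D ND] conj m_inv_consistent[OF D] by simp
  qed
  have "N j \<inter> generate G (\<Union>i\<in>UNIV - {j}. N i) = {\<one>}" for j
  proof -
    have "x = \<one>" if x: "x \<in> N j" "x \<in> generate G (\<Union>i\<in>UNIV - {j}. N i)" for x
    proof -
      have WG: "(\<Union>i<j. N i) \<subseteq> carrier G" using NG by blast
      have "(\<Union>i\<in>UNIV - {j}. N i) \<subseteq> (\<Union>i<j. N i) \<union> K (Suc j)"
        using NKlt by (force simp: nat_neq_iff)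
      then have "x \<in> generate G ((\<Union>i<j. N i) \<union> K (Suc j))"
        using x(2) mono_generate by blast
      moreover have "a \<otimes> b = b \<otimes> a" if "a \<in> (\<Union>i<j. N i)" "b \<in> K (Suc j)" for a b 
        using that comm[of a _ b] mono[of _ "Suc j"] by (metis UN_E Suc_le_mono lessThan_iff less_imp_le subsetD)
      ultimately obtain a b where ab: "a \<in> ?W j" "b \<in> K (Suc j)" "x = a \<otimes> b"
        using generate_commuting_Un[OF WG K, of "Suc j" x] by blast
      have c: "a \<in> carrier G" "b \<in> carrier G" using ab KG generate_in_carrier[OF WG] by auto
      have "b \<in> K j" "x \<in> K j" using ab(2) KK[of j] x(1) NK[of j] by auto
      then have "x \<otimes> inv b \<in> K j" using K subgroup.m_closed subgroup.m_inv_closed by metis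
      moreover have "x \<otimes> inv b = a" using c ab(3) by (simp add: m_assoc)
      ultimately have "a = \<one>" using WK[OF ab(1)] by simp
      then show ?thesis using ab(2,3) c disj[of j] x(1) by auto
    qed
    then show ?thesis using subgroup.one_closed[OF N] generate.one by blast
  qed
  then show ?thesis
    using D norm by (auto simp: internal_direct_product_def D_def)
qed

text \<open>Bounds 2^-i make the series converge absolutely in norm, so the partial sums approximate
  x uniformly on functions bounded by K, and closedness of the radical passes to the sum.\<close>

lemma bidual_series:
  assumes \<Psi>: "\<And>i. \<Psi> i \<in> l1_bidual G"
    and bound: "\<And>i h K. K \<ge> 0 \<Longrightarrow> (\<And>t. t \<in> carrier G \<Longrightarrow> cmod (h t) \<le> K) \<Longrightarrow> 
       cmod (pairing G (\<Psi> i) h) \<le> (1 / 2) ^ i * K"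
  obtains x where "x \<in> l1_bidual G"
    "\<And>h. bounded_on (carrier G) h \<Longrightarrow> ((\<lambda>i. pairing G (\<Psi> i) h) has_sum pairing G x h) UNIV"
    "(\<And>i. \<Psi> i \<in> jacobson_radical (l1_bidual G) (l1_arens G)) \<Longrightarrow> 
       x \<in> jacobson_radical (l1_bidual G) (l1_arens G)"
proof -
  have geom: "(\<lambda>i. (1 / 2) ^ i * K) sums (2 * K)" for K :: real
    using sums_mult2[OF geometric_sums[of "1/2::real"], of K] by simp
  have summ: "summable (\<lambda>i. norm (pairing G (\<Psi> i) h))" if h: "bounded_on (carrier G) h" for h
  proof -
    obtain K where K: "K \<ge> 0" "\<And>x. x \<in> carrier G \<Longrightarrow> cmod (h x) \<le> K" using bounded_onE[OF h] by metis
    show ?thesis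
      by (rule summable_comparison_test'[OF sums_summable[OF geom[of K]], of 0]) (simp add: bound[OF K])
  qed
  note summ' = summable_norm_cancel[OF summ]
  define m where "m h = (\<Sum>i. pairing G (\<Psi> i) h)" for h
  have "cmod (m h) \<le> 2 * K" if "K \<ge> 0" "\<forall>t\<in>carrier G. cmod (h t) \<le> K" for h K
  proof -
    have "cmod (m h) \<le> (\<Sum>i. (1 / 2) ^ i * K)"
      unfolding m_def using that bound by (intro norm_suminf_le sums_summable[OF geom]) auto
    then show ?thesis using sums_unique[OF geom[of K]] by simp
  qed
  moreover have "m (\<lambda>x. h x + h' x) = m h + m h'" 
    if "bounded_on (carrier G) h" "bounded_on (carrier G) h'" for h h'
    using suminf_add[OF summ'[OF that(1)] summ'[OF that(2)]] bdd_functional_add[OF bdd_functional_pairing[OF \<Psi>] that]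
    by (simp add: m_def)
  moreover have "m (\<lambda>x. c * h x) = c * m h" if "bounded_on (carrier G) h" for h c
    using suminf_mult[OF summ'[OF that], of c] bdd_functional_cmult[OF bdd_functional_pairing[OF \<Psi>] that]
    by (simp add: m_def)
  ultimately have bm: "bdd_functional (carrier G) m"
    unfolding bdd_functional_def by (intro conjI allI impI exI[of _ 2]) auto
  define x where "x = bidual_of G m"
  have xA: "x \<in> l1_bidual G" unfolding x_def by (rule bidual_of_in_bidual[OF bm])
  have px: "pairing G x h = m h" if "bounded_on (carrier G) h" for h
    unfolding x_def by (rule pairing_bidual_of[OF bm that])
  have psum: "pairing G (\<Sum>i<n. \<Psi> i) h = (\<Sum>i<n. pairing G (\<Psi> i) h)" for n h
    by (induction n) (simp_all add: pairing_def)
  have tail: "cmod (pairing G (x - (\<Sum>i<n. \<Psi> i)) h) \<le> (1 / 2) ^ n * (2 * K)"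
    if K: "K \<ge> 0" "\<And>t. t \<in> carrier G \<Longrightarrow> cmod (h t) \<le> K" for h K n
  proof -
    have h: "bounded_on (carrier G) h" using K(2) by (rule bounded_onI)
    have "pairing G (x - (\<Sum>i<n. \<Psi> i)) h = m h - (\<Sum>i<n. pairing G (\<Psi> i) h)"
      using px[OF h] psum[of n h] by (simp add: pairing_def)
    also have "\<dots> = (\<Sum>i. pairing G (\<Psi> (i + n)) h)"
      unfolding m_def by (rule suminf_minus_initial_segment[OF summ'[OF h], symmetric])
    finally have eq: "pairing G (x - (\<Sum>i<n. \<Psi> i)) h = (\<Sum>i. pairing G (\<Psi> (i + n)) h)" .
    have "cmod (pairing G (\<Psi> (i + n)) h) \<le> (1 / 2) ^ n * ((1 / 2) ^ i * K)" for i
      using bound[OF K(1), of h "i + n"] K(2) by (simp add: power_add ac_simps)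
    then have "cmod (pairing G (x - (\<Sum>i<n. \<Psi> i)) h) \<le> (\<Sum>i. (1 / 2) ^ n * ((1 / 2) ^ i * K))"
      unfolding eq by (intro norm_suminf_le summable_mult sums_summable[OF geom])
    also have "\<dots> = (1 / 2) ^ n * (2 * K)"
      using sums_unique[OF sums_mult[OF geom[of K], of "(1 / 2) ^ n"]] by simp
    finally show ?thesis .
  qed
  show ?thesis
  proof (rule that[OF xA])
    show "((\<lambda>i. pairing G (\<Psi> i) h) has_sum pairing G x h) UNIV" if "bounded_on (carrier G) h" for h
      unfolding px[OF that] m_def
      by (rule norm_summable_imp_has_sum[OF summ[OF that] summable_sums[OF summ'[OF that]]])
    assume rad: "\<And>i. \<Psi> i \<in> jacobson_radical (l1_bidual G) (l1_arens G)"
    show "x \<in> jacobson_radical (l1_bidual G) (l1_arens G)"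
    proof (rule radical_closed[OF xA])
      fix e :: real assume e: "e > 0"
      then obtain n where n: "(1 / 2) ^ n < e / 2" using real_arch_pow_inv[of "e / 2" "1 / 2"] by auto
      have "cmod (pairing G (x - (\<Sum>i<n. \<Psi> i)) h) \<le> e * K" 
        if K: "K \<ge> 0" "\<forall>t\<in>carrier G. cmod (h t) \<le> K" for h K
      proof -
        have "cmod (pairing G (x - (\<Sum>i<n. \<Psi> i)) h) \<le> (1 / 2) ^ n * (2 * K)" using tail K by blast
        also have "\<dots> \<le> (e / 2) * (2 * K)" using n K(1) by (intro mult_right_mono) auto
        finally show ?thesis by simp
      qed
      moreover have "(\<Sum>i<n. \<Psi> i) \<in> jacobson_radical (l1_bidual G) (l1_arens G)"
        by (rule cfun.subspace_sum[OF radical_subspace rad])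
      ultimately show "\<exists>y\<in>jacobson_radical (l1_bidual G) (l1_arens G). \<forall>f K. K \<ge> 0 \<longrightarrow> 
          (\<forall>t\<in>carrier G. cmod (f t) \<le> K) \<longrightarrow> cmod (pairing G (x - y) f) \<le> e * K" by blast
    qed
  qed
qed

text \<open>The power x^(n+1) is tested on the n + 1 factors with index at most n; the terms of x
  with larger index contribute nothing to this test, and every exponent finds enough
  factors.\<close>

lemma nonnilpotent_radical_element:
  fixes N :: "nat \<Rightarrow> 'a set"
  assumes am: "amenable_group G" and idp: "internal_direct_product G D UNIV N"
    and inf: "\<And>i. infinite (N i)"
    and rad: "\<And>i \<Gamma>. \<Gamma> \<in> invariant_differences (G\<lparr>carrier := N i\<rparr>) \<Longrightarrow> 
       l1_bidual_incl G (N i) \<Gamma> \<in> jacobson_radical (l1_bidual G) (l1_arens G)"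
  shows "\<exists>x\<in>jacobson_radical (l1_bidual G) (l1_arens G). \<not> nilpotent_element (l1_arens G) x"
proof -
  let ?N = "\<lambda>i. G\<lparr>carrier := N i\<rparr>"
  note comp = internal_direct_product_component[OF idp UNIV_I]
  have "\<forall>i. \<exists>\<Gamma> f. \<Gamma> \<in> invariant_differences (?N i) \<and> bounded_on (N i) f \<and> pairing (?N i) \<Gamma> f = 1"
    using exists_nonzero_invariant_difference[OF am comp(4) inf] by metis
  then obtain \<Gamma> f where \<Gamma>: "\<And>i. \<Gamma> i \<in> invariant_differences (?N i)" and f: "\<And>i. bounded_on (N i) (f i)"
    and one: "\<And>i. pairing (?N i) (\<Gamma> i) (f i) = 1" by metis
  have \<Gamma>N: "\<Gamma> i \<in> l1_bidual (?N i)" for i using \<Gamma>[of i] by (simp add: invariant_differences_def)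
  define \<Lambda> where "\<Lambda> i = l1_bidual_incl G (N i) (\<Gamma> i)" for i
  have \<Lambda>A: "\<Lambda> i \<in> l1_bidual G" for i unfolding \<Lambda>_def by (rule l1_bidual_incl_closed[OF comp(5) \<Gamma>N])
  have "\<forall>i. \<exists>C\<ge>0. \<forall>h K. K \<ge> 0 \<longrightarrow> (\<forall>t\<in>carrier G. cmod (h t) \<le> K) \<longrightarrow> cmod (pairing G (\<Lambda> i) h) \<le> C * K"
    using bdd_functional_pairing[OF \<Lambda>A] unfolding bdd_functional_def by blast
  then obtain C where C: "\<And>i. C i \<ge> 0" "\<And>i h K. K \<ge> 0 \<Longrightarrow> (\<And>t. t \<in> carrier G \<Longrightarrow> cmod (h t) \<le> K) 
      \<Longrightarrow> cmod (pairing G (\<Lambda> i) h) \<le> C i * K" by metis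
  \<comment> \<open>Divides out the bound C_i of the i-th difference, leaving at most 2^-i; the + 1
    keeps the denominator positive.\<close>
  define c where "c i = complex_of_real ((1 / 2) ^ i / (C i + 1))" for i
  have c0: "c i \<noteq> 0" for i using C(1)[of i] by (simp add: c_def complex_eq_iff)
  have cnorm: "cmod (c i) = (1 / 2) ^ i / (C i + 1)" for i 
    unfolding c_def norm_of_real using C(1)[of i] by simp
  have "cmod (pairing G (cscale (c i) (\<Lambda> i)) h) \<le> (1 / 2) ^ i * K"
    if K: "K \<ge> 0" "\<And>t. t \<in> carrier G \<Longrightarrow> cmod (h t) \<le> K" for i h K
  proof -
    have "cmod (pairing G (cscale (c i) (\<Lambda> i)) h) \<le> cmod (c i) * (C i * K)"
      unfolding pairing_cscale norm_mult by (intro mult_left_mono C(2)[OF K]) auto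
    also have "\<dots> = ((1 / 2) ^ i * K) * (C i / (C i + 1))" by (simp add: cnorm)
    also have "\<dots> \<le> ((1 / 2) ^ i * K) * 1" using K(1) C(1)[of i] by (intro mult_left_mono) auto
    finally show ?thesis by simp
  qed
  moreover have "cscale (c i) (\<Lambda> i) \<in> l1_bidual G" for i
    by (rule cfun.subspace_scale[OF l1_bidual_subspace \<Lambda>A])
  ultimately obtain x where xA: "x \<in> l1_bidual G"
    and xs: "\<And>h. bounded_on (carrier G) h \<Longrightarrow> ((\<lambda>i. pairing G (cscale (c i) (\<Lambda> i)) h) has_sum pairing G x h) UNIV"
    and xrad: "(\<And>i. cscale (c i) (\<Lambda> i) \<in> jacobson_radical (l1_bidual G) (l1_arens G)) \<Longrightarrow> 
       x \<in> jacobson_radical (l1_bidual G) (l1_arens G)"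
    using bidual_series[of "\<lambda>i. cscale (c i) (\<Lambda> i)"] by blast
  have "x \<in> jacobson_radical (l1_bidual G) (l1_arens G)"
    using rad[OF \<Gamma>] by (intro xrad cfun.subspace_scale[OF radical_subspace]) (simp add: \<Lambda>_def)
  moreover have "((\<lambda>y. l1_arens G y x) ^^ n) x \<noteq> 0" for n
  proof (rule power_of_invariant_differences_nonzero[where c = c and S = "{..n}", OF idp \<Gamma> f])
    show "((\<lambda>j. c j * pairing (?N j) (\<Gamma> j) h) has_sum pairing G x h) UNIV" if "bounded_on (carrier G) h" for h
      using xs[OF that] pairing_incl[OF comp(5) \<Gamma>N that] by (simp add: pairing_cscale \<Lambda>_def)
  qed (use c0 one xA in auto)
  ultimately show ?thesis by (auto simp: nilpotent_element_def)
qed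

text \<open>For 1 \<le> p \<le> n the sum x of one invariant difference per factor satisfies x^p
  \<noteq> 0, tested on p of the n factors, so the p-th power of the ideal does not vanish.
  Nilpotence makes the least exponent meaningful.\<close>

lemma (in conjugation_family) nilpotence_index_difference_ideal:
  assumes am: "amenable_group G" and idp: "internal_direct_product G H {1..n} F" 
    and fam: "fam = F ` {1..n}" and inf: "\<And>j. j \<in> {1..n} \<Longrightarrow> infinite (F j)"
  shows "nilpotence_index (l1_arens G) (difference_ideal fam) > n"
proof -
  let ?N = "\<lambda>j. G\<lparr>carrier := F j\<rparr>" and ?I = "difference_ideal fam"
  note comp = internal_direct_product_component[OF idp]
  have "\<forall>j\<in>{1..n}. \<exists>\<Gamma> f. \<Gamma> \<in> invariant_differences (?N j) \<and> bounded_on (F j) f \<and> pairing (?N j) \<Gamma> f = 1"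
    using exists_nonzero_invariant_difference[OF am comp(4) inf] by metis
  then obtain \<Gamma> f where \<Gamma>: "\<And>j. j \<in> {1..n} \<Longrightarrow> \<Gamma> j \<in> invariant_differences (?N j)" 
    and f: "\<And>j. j \<in> {1..n} \<Longrightarrow> bounded_on (F j) (f j)"
    and one: "\<And>j. j \<in> {1..n} \<Longrightarrow> pairing (?N j) (\<Gamma> j) (f j) = 1" by metis
  have \<Gamma>N: "\<Gamma> j \<in> l1_bidual (?N j)" if "j \<in> {1..n}" for j 
    using \<Gamma>[OF that] by (simp add: invariant_differences_def)
  define x where "x = (\<Sum>j\<in>{1..n}. l1_bidual_incl G (F j) (\<Gamma> j))"
  have xI: "x \<in> ?I"
    unfolding x_def
  proof (rule cfun.subspace_sum)
    show "cfun.subspace ?I" unfolding difference_ideal_def by (rule cfun.subspace_span)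
    show "l1_bidual_incl G (F j) (\<Gamma> j) \<in> ?I" if "j \<in> {1..n}" for j
      using that fam \<Gamma>[OF that] by (intro incl_in_difference_ideal fam_subgroup) auto
  qed
  have xA: "x \<in> l1_bidual G" using xI difference_ideal_subset[of fam] fam_subgroup by blast
  have xs: "((\<lambda>j. 1 * pairing (?N j) (\<Gamma> j) h) has_sum pairing G x h) {1..n}" if h: "bounded_on (carrier G) h" for h
  proof -
    have "pairing G (\<Sum>j\<in>X. l1_bidual_incl G (F j) (\<Gamma> j)) h = (\<Sum>j\<in>X. pairing (?N j) (\<Gamma> j) h)" 
      if "finite X" "X \<subseteq> {1..n}" for X
      using that
    proof (induction X rule: finite_induct)
      case (insert j X)
      then show ?case
        using pairing_incl[OF comp(5) \<Gamma>N h, of j] by (simp add: pairing_plus del: plus_fun_apply)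
    qed (simp add: pairing_def)
    then show ?thesis unfolding x_def by (intro has_sum_finiteI) auto
  qed
  have "power_vanishes (l1_arens G) ?I p \<Longrightarrow> p > n" for p
  proof (rule ccontr)
    assume p: "power_vanishes (l1_arens G) ?I p" "\<not> p > n"
    then obtain q where q: "p = Suc q" by (auto simp: power_vanishes_def dest: Suc_le_D)
    have "((\<lambda>y. l1_arens G y x) ^^ q) x \<noteq> 0"
      by (rule power_of_invariant_differences_nonzero[where c = "\<lambda>_. 1" and S = "{1..p}", OF idp \<Gamma> f _ xA xs])
         (use p(2) q one in auto)
    moreover have "((\<lambda>y. l1_arens G y x) ^^ q) x = 0"
      using p(1) nfold_product_power[OF xI, of "l1_arens G" q] unfolding power_vanishes_def q by blast
    ultimately show False by simp
  qed
  moreover have "\<exists>p. power_vanishes (l1_arens G) ?I p"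
    using nilpotent_difference_ideal by (simp add: nilpotent_ideal_def)
  ultimately show ?thesis unfolding nilpotence_index_def by (metis LeastI_ex)
qed

end

section \<open>The factors of a branch group and the conclusion\<close>

theorem theorem1p2:
  fixes G :: "('a, 'b) monoid_scheme"
  assumes "branch_group G" and "amenable_group G"
  shows "(\<forall>A \<in> {l1_bidual G, J_sn G}. \<forall>N.
            \<exists>I. left_ideal A (l1_arens G) I \<and> nilpotent_ideal (l1_arens G) I \<and>
                nilpotence_index (l1_arens G) I \<ge> N) \<and>
         (\<exists>x \<in> jacobson_radical (l1_bidual G) (l1_arens G). \<not> nilpotent_element (l1_arens G) x)"
proof -
  obtain H L :: "nat \<Rightarrow> 'a set" and k :: "nat \<Rightarrow> nat" and F where
    grp: "group G" and infG: "infinite (carrier G)"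
    and B: "\<forall>i\<ge>1. k i \<ge> 1"
      "\<forall>i\<ge>1. H i \<lhd> G \<and> finite (rcosets\<^bsub>G\<^esub> (H i))"
      "\<forall>i\<ge>1. internal_direct_product G (H i) {1..k i} (F i) \<and>
         (\<forall>j\<in>{1..k i}. G\<lparr>carrier := F i j\<rparr> \<cong> G\<lparr>carrier := L i\<rparr>)"
      "\<forall>i\<ge>1. \<exists>m\<ge>2. k (Suc i) = m * k i \<and>
         (\<forall>j\<in>{1..k i}. \<forall>l\<in>{(j - 1) * m + 1..j * m}. F (Suc i) l \<subseteq> F i j)"
      "\<forall>i\<ge>1. (\<forall>g\<in>carrier G. \<forall>j\<in>{1..k i}. \<exists>j'\<in>{1..k i}. conjugate_set G g (F i j) = F i j') \<and>
         (\<forall>j\<in>{1..k i}. \<forall>j'\<in>{1..k i}. \<exists>g\<in>carrier G. conjugate_set G g (F i j) = F i j')"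
    using assms(1) unfolding branch_group_def by (elim conjE exE) (rule that; assumption)
  have k1: "k i \<ge> 1" and H: "H i \<lhd> G" "finite (rcosets\<^bsub>G\<^esub> (H i))"
    and idp: "internal_direct_product G (H i) {1..k i} (F i)"
    if "i \<ge> 1" for i
    using B(1,2,3) that by blast+
  have iso: "G\<lparr>carrier := F i j\<rparr> \<cong> G\<lparr>carrier := L i\<rparr>" if "i \<ge> 1" "j \<in> {1..k i}" for i j
    using B(3) that by blast
  have conj: "\<exists>j'\<in>{1..k i}. conjugate_set G g (F i j) = F i j'"
    if "i \<ge> 1" "g \<in> carrier G" "j \<in> {1..k i}" for i g j
    using B(5) that by blast
  note refine = B(4)[rule_format]
  interpret group G by (rule grp)
  note comp = internal_direct_product_component[OF idp]
  \<comment> \<open>All factors of a level are isomorphic to L_i; equality of cardinalities is what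
    is kept of this.\<close>
  have bij: "\<exists>h. bij_betw h (F i j) (F i j')" if ij: "i \<ge> 1" "j \<in> {1..k i}" "j' \<in> {1..k i}" for i j j'
  proof -
    obtain h h' where "bij_betw h (F i j) (L i)" "bij_betw h' (F i j') (L i)"
      using iso[OF ij(1,2)] iso[OF ij(1,3)] by (auto simp: is_iso_def iso_def)
    then show ?thesis using bij_betw_trans bij_betw_inv_into by blast
  qed
  \<comment> \<open>One trivial factor makes its whole level trivial, hence also H_i; as H_i has
    finite index, G would be finite.\<close>
  have nontrivial: "F i j \<noteq> {\<one>\<^bsub>G\<^esub>}" if i: "i \<ge> 1" and j: "j \<in> {1..k i}" for i j
  proof
    assume triv: "F i j = {\<one>\<^bsub>G\<^esub>}"
    have "F i j' = {\<one>\<^bsub>G\<^esub>}" if j': "j' \<in> {1..k i}" for j'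
    proof -
      obtain h where "bij_betw h (F i j) (F i j')" using bij[OF i j j'] by blast
      then have "F i j' = {h \<one>\<^bsub>G\<^esub>}" unfolding triv by (auto simp: bij_betw_def)
      then show ?thesis using subgroup.one_closed[OF comp(4)[OF i j']] by auto
    qed
    then have "(\<Union>j\<in>{1..k i}. F i j) = {\<one>\<^bsub>G\<^esub>}" using k1[OF i] by auto
    then have "H i = {\<one>\<^bsub>G\<^esub>}"
      using idp[OF i] generate_one by (simp add: internal_direct_product_def)
    then have "finite C" if "C \<in> rcosets\<^bsub>G\<^esub> (H i)" for C
      using that by (auto simp: RCOSETS_def r_coset_def)
    then have "finite (\<Union> (rcosets\<^bsub>G\<^esub> (H i)))" using H(2)[OF i] by blast
    moreover have "\<Union> (rcosets\<^bsub>G\<^esub> (H i)) = carrier G" 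
      using rcosets_part_G[OF normal_imp_subgroup[OF H(1)[OF i]]] .
    ultimately show False using infG by simp
  qed
  \<comment> \<open>The block below the first factor consists of the indices 1, ..., m with m \<ge>
    2, so it contains 1 and 2.\<close>
  have k_Suc: "k (Suc i) \<ge> 2 * k i" "F (Suc i) 1 \<subseteq> F i 1" "F (Suc i) 2 \<subseteq> F i 1" if i: "i \<ge> 1" for i
  proof -
    obtain m where m: "m \<ge> 2" "k (Suc i) = m * k i"
      "\<And>j l. j \<in> {1..k i} \<Longrightarrow> l \<in> {(j - 1) * m + 1..j * m} \<Longrightarrow> F (Suc i) l \<subseteq> F i j" 
      using refine[OF i] by metis
    show "k (Suc i) \<ge> 2 * k i" using m by simp
    show "F (Suc i) 1 \<subseteq> F i 1" "F (Suc i) 2 \<subseteq> F i 1" using m(1) k1[OF i] by (intro m(3); simp)+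
  qed
  have k2: "2 \<in> {1..k (Suc i)}" if "i \<ge> 1" for i using k_Suc(1)[OF that] k1[OF that] by simp
  have k_ge: "k (Suc i) \<ge> Suc i" for i
  proof (induction i)
    case 0 show ?case using k1[of 1] by simp
  next
    case (Suc i) then show ?case using k_Suc(1)[of "Suc i"] by simp
  qed
  have disj: "F (Suc i) 2 \<inter> F (Suc i) 1 = {\<one>\<^bsub>G\<^esub>}" if "i \<ge> 1" for i
    using k2[OF that] by (intro internal_direct_product_disjoint[OF idp]) auto
  \<comment> \<open>A finite first factor would properly contain the first factor one level down,
    because the sibling with index 2 is nontrivial and meets that one trivially. The smaller factor
    is infinite by induction on the cardinality, a contradiction.\<close>
  have inf1: "infinite (F i 1)" if "i \<ge> 1" for i
    using that
  proof (induction "card (F i 1)" arbitrary: i rule: less_induct)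
    case less
    show ?case
    proof
      assume fin: "finite (F i 1)"
      have "F (Suc i) 2 \<noteq> {\<one>\<^bsub>G\<^esub>}" using nontrivial[OF _ k2[OF less(2)]] by simp
      then have "F (Suc i) 1 \<noteq> F i 1" using disj[OF less(2)] k_Suc(3)[OF less(2)] by blast
      then have "F (Suc i) 1 \<subset> F i 1" using k_Suc(2)[OF less(2)] by blast
      then have "infinite (F (Suc i) 1)" using psubset_card_mono[OF fin] by (intro less(1)) auto
      then show False using finite_subset[OF k_Suc(2)[OF less(2)] fin] by simp
    qed
  qed
  have inf: "infinite (F i j)" if "i \<ge> 1" "j \<in> {1..k i}" for i j
    using bij[OF that(1) _ that(2), of 1] k1[OF that(1)] inf1[OF that(1)] bij_betw_finite by fastforce
  have family: "conjugation_family G (H i) (F i ` {1..k i})" if i: "i \<ge> 1" for i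
  proof (rule conjugation_family.intro[OF grp], rule conjugation_family_axioms.intro)
    show "H i \<lhd> G" "finite (rcosets\<^bsub>G\<^esub> (H i))" by (rule H[OF i])+
    show "finite (F i ` {1..k i})" by simp
    fix N assume "N \<in> F i ` {1..k i}"
    then obtain j where j: "j \<in> {1..k i}" "N = F i j" by blast
    show "subgroup N G" using comp(4)[OF i j(1)] j(2) by simp
    { fix h n assume h: "h \<in> H i" and n: "n \<in> N"
      have sub: "subgroup (H i) G" by (rule comp(1)[OF i j(1)])
      have hG: "h \<in> carrier G" using h subgroup.subset[OF sub] by blast
      show "inv\<^bsub>G\<^esub> h \<otimes>\<^bsub>G\<^esub> n \<otimes>\<^bsub>G\<^esub> h \<in> N"
        using normal_in_subgroup_conj[OF sub comp(2)[OF i j(1)] subgroup.m_inv_closed[OF sub h], of n] n j(2) hG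
        by simp }
    { fix g assume "g \<in> carrier G"
      then show "conjugate_set G g N \<in> F i ` {1..k i}" using conj[OF i _ j(1)] j(2) by fastforce }
    fix N' n n' assume N': "N' \<in> F i ` {1..k i}" "N \<noteq> N'" and n: "n \<in> N" "n' \<in> N'"
    obtain j' where j': "j' \<in> {1..k i}" "N' = F i j'" using N'(1) by blast
    have "j \<noteq> j'" using N'(2) j(2) j'(2) by blast
    then show "n \<otimes>\<^bsub>G\<^esub> n' = n' \<otimes>\<^bsub>G\<^esub> n"
      using n j(2) j'(2) by (intro internal_direct_product_commute[OF idp[OF i] j(1) j'(1)]) auto
  qed
  have sub: "subgroup N G" if "i \<ge> 1" "N \<in> F i ` {1..k i}" for i N
    using comp(4)[OF that(1)] that(2) by auto
  have ideal: "left_ideal (l1_bidual G) (l1_arens G) (difference_ideal (F i ` {1..k i}))"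
    and nil: "nilpotent_ideal (l1_arens G) (difference_ideal (F i ` {1..k i}))" if i: "i \<ge> 1" for i
    by (rule left_ideal_difference_ideal[OF sub[OF i]], assumption)
       (rule conjugation_family.nilpotent_difference_ideal[OF family[OF i]])
  have "\<exists>I. left_ideal A (l1_arens G) I \<and> nilpotent_ideal (l1_arens G) I \<and>
            nilpotence_index (l1_arens G) I \<ge> n" if A: "A \<in> {l1_bidual G, J_sn G}" for A n
  proof -
    \<comment> \<open>Levels are counted from 1, and level n + 1 has at least n + 1 factors by
      \<open>k_ge\<close>.\<close>
    let ?I = "difference_ideal (F (Suc n) ` {1..k (Suc n)})"
    have i: "Suc n \<ge> 1" by simp
    have "subnormal G N" if N: "N \<in> F (Suc n) ` {1..k (Suc n)}" for N
    proof -
      obtain j where j: "j \<in> {1..k (Suc n)}" "N = F (Suc n) j" using N by blast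
      have "subnormal G (H (Suc n))" using subnormal.step[OF subnormal.top, of "H (Suc n)" G] H(1)[OF i] by simp
      then show ?thesis using subnormal.step comp(2)[OF i j(1)] j(2) by metis
    qed
    then have "?I \<subseteq> J_sn G" by (rule difference_ideal_subset_J_sn)
    \<comment> \<open>A left ideal of the bidual that lies in \<open>J_sn G\<close> is a left ideal
      of \<open>J_sn G\<close>, which is itself contained in the bidual.\<close>
    then have "left_ideal A (l1_arens G) ?I"
      using A ideal[OF i] J_sn_subset unfolding left_ideal_def by blast
    moreover have "nilpotence_index (l1_arens G) ?I \<ge> n"
      using conjugation_family.nilpotence_index_difference_ideal[OF family[OF i] assms(2) idp[OF i] refl inf[OF i]]
        k_ge[of n] by simp
    ultimately show ?thesis using nil[OF i] by blast
  qed
  moreover have "\<exists>x\<in>jacobson_radical (l1_bidual G) (l1_arens G). \<not> nilpotent_element (l1_arens G) x"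
  proof (rule nonnilpotent_radical_element[OF assms(2)])
    \<comment> \<open>At each level the factor with index 2 is kept and the descent continues into
      the one with index 1: \<open>?N n\<close> and \<open>?K (Suc n)\<close> are different factors
      of level n + 2, both inside \<open>?K n\<close>.\<close>
    let ?N = "\<lambda>n. F (Suc (Suc n)) 2" and ?K = "\<lambda>n. F (Suc n) 1"
    have k1': "1 \<in> {1..k (Suc n)}" and k2': "2 \<in> {1..k (Suc (Suc n))}" for n
      using k1[of "Suc n"] k2[of "Suc n"] by auto
    show "internal_direct_product G (generate G (\<Union>n. ?N n)) UNIV ?N"
    proof (rule nested_complements_direct_product[where K = ?K])
      show "subgroup (?N n) G" "subgroup (?K n) G" for n 
        using comp(4)[of "Suc (Suc n)" 2] comp(4)[of "Suc n" 1] k1'[of n] k2'[of n] by auto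
      show "?N n \<subseteq> ?K n" "?K (Suc n) \<subseteq> ?K n" for n using k_Suc(2,3)[of "Suc n"] by auto
      show "?N n \<inter> ?K (Suc n) \<subseteq> {\<one>\<^bsub>G\<^esub>}" for n using disj[of "Suc n"] by simp
      show "a \<otimes>\<^bsub>G\<^esub> b = b \<otimes>\<^bsub>G\<^esub> a" if "a \<in> ?N n" "b \<in> ?K (Suc n)" for n a b
        using internal_direct_product_commute[OF idp k2'[of n] k1'[of "Suc n"] _ that] by simp
    qed
    show "infinite (?N n)" for n using inf k2'[of n] by simp
    fix n \<Gamma> assume \<Gamma>: "\<Gamma> \<in> invariant_differences (G\<lparr>carrier := ?N n\<rparr>)"
    let ?fam = "F (Suc (Suc n)) ` {1..k (Suc (Suc n))}"
    have i: "Suc (Suc n) \<ge> 1" by simp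
    have "l1_bidual_incl G (?N n) \<Gamma> \<in> difference_ideal ?fam"
      using k2'[of n] by (intro incl_in_difference_ideal[OF sub[OF i] _ \<Gamma>]) auto
    then show "l1_bidual_incl G (?N n) \<Gamma> \<in> jacobson_radical (l1_bidual G) (l1_arens G)"
      using nilpotent_left_ideal_subset_radical[OF ideal[OF i] nil[OF i]] by blast
  qed
  ultimately show ?thesis by blast
qed

end
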